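(* Let $k$ be a field of characteristic different from $2$ and let $L/k$ be a finite Galois extension with $L \neq k$ and Galois group $G$. Then the Dress map $h_{L/k}\colon A(G)\to GW(k)$ is injective if and only if $L=k(\sqrt{\alpha})$ for some $\alpha\in k^\times$ that is not a sum of squares in $k^\times$.
   Context: $A(G)$ is the Burnside ring of the finite group $G$: as an abelian group it is free on the classes $G/H$, with $H$ running over representatives of conjugacy classes of subgroups of $G$; addition is disjoint union and multiplication is cartesian product, with identity $G/G$. $GW(k)$ is the Grothendieck–Witt ring of $k$, generated as an abelian group by the one-dimensional forms $\langle a\rangle$, $a\in k^\times/(k^\times)^2$, with $\langle a\rangle+\langle b\rangle=\langle a,b\rangle$ (orthogonal sum) and $\langle a\rangle\langle b\rangle=\langle ab\rangle$. The Dress map $h_{L/k}$ is the ring homomorphism sending $G/H$ to the trace form $\mathrm{tr}_{L^H/k}\langle 1\rangle_{L^H}$, i.e. the class of the quadratic form $x\mapsto \mathrm{tr}_{L^H/k}(x^2)$ on the $k$-vector space $L^H$. "$\alpha$ is a sum of squares in $k^\times$" means $\alpha=x_1^2+\cdots+x_m^2$ for some $m\ge 1$ and $x_i\in k^\times$. *)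

theory Defs
  imports "Jordan_Normal_Form.Determinant"
begin

text \<open>The big field L is the whole type 'a (class field); the base field k is a
  subfield K of it, given as a set.\<close>

definition subfield :: "'a::field set \<Rightarrow> bool" where
  "subfield K \<longleftrightarrow> 0 \<in> K \<and> 1 \<in> K \<and>
     (\<forall>x\<in>K. \<forall>y\<in>K. x + y \<in> K \<and> x * y \<in> K) \<and>
     (\<forall>x\<in>K. - x \<in> K \<and> inverse x \<in> K)"

definition adjoin :: "'a::field set \<Rightarrow> 'a \<Rightarrow> 'a set" where
  "adjoin K s = \<Inter>{F. subfield F \<and> K \<subseteq> F \<and> s \<in> F}"

definition span_over :: "'a::field set \<Rightarrow> nat \<Rightarrow> (nat \<Rightarrow> 'a) \<Rightarrow> 'a set" where
  "span_over K n b = {(\<Sum>i<n. c i * b i) | c. \<forall>i<n. c i \<in> K}"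

definition lin_indep_over :: "'a::field set \<Rightarrow> nat \<Rightarrow> (nat \<Rightarrow> 'a) \<Rightarrow> bool" where
  "lin_indep_over K n b \<longleftrightarrow>
     (\<forall>c. (\<forall>i<n. c i \<in> K) \<and> (\<Sum>i<n. c i * b i) = 0 \<longrightarrow> (\<forall>i<n. c i = 0))"

definition basis_over :: "'a::field set \<Rightarrow> 'a set \<Rightarrow> nat \<Rightarrow> (nat \<Rightarrow> 'a) \<Rightarrow> bool" where
  "basis_over K F n b \<longleftrightarrow> (\<forall>i<n. b i \<in> F) \<and> lin_indep_over K n b \<and> span_over K n b = F"

definition finite_dim_over :: "'a::field set \<Rightarrow> 'a set \<Rightarrow> bool" where
  "finite_dim_over K F \<longleftrightarrow> (\<exists>n b. basis_over K F n b)"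

text \<open>A chosen K-basis of F (arbitrary if none exists).\<close>
definition chosen_dim :: "'a::field set \<Rightarrow> 'a set \<Rightarrow> nat" where
  "chosen_dim K F = fst (SOME nb. basis_over K F (fst nb) (snd nb))"

definition chosen_basis :: "'a::field set \<Rightarrow> 'a set \<Rightarrow> nat \<Rightarrow> 'a" where
  "chosen_basis K F = snd (SOME nb. basis_over K F (fst nb) (snd nb))"

definition trace_over :: "'a::field set \<Rightarrow> 'a set \<Rightarrow> 'a \<Rightarrow> 'a" where
  "trace_over K F x =
     (let n = chosen_dim K F; b = chosen_basis K F;
          C = (SOME C :: nat \<Rightarrow> nat \<Rightarrow> 'a. (\<forall>i<n. \<forall>j<n. C i j \<in> K) \<and>
                  (\<forall>j<n. x * b j = (\<Sum>i<n. C i j * b i)))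
      in \<Sum>i<n. C i i)"

definition field_aut :: "('a::field \<Rightarrow> 'a) \<Rightarrow> bool" where
  "field_aut \<sigma> \<longleftrightarrow> bij \<sigma> \<and> \<sigma> 1 = 1 \<and>
     (\<forall>x y. \<sigma> (x + y) = \<sigma> x + \<sigma> y \<and> \<sigma> (x * y) = \<sigma> x * \<sigma> y)"

definition Gal :: "'a::field set \<Rightarrow> ('a \<Rightarrow> 'a) set" where
  "Gal K = {\<sigma>. field_aut \<sigma> \<and> (\<forall>x\<in>K. \<sigma> x = x)}"

definition fixed_field :: "('a::field \<Rightarrow> 'a) set \<Rightarrow> 'a set" where
  "fixed_field H = {x. \<forall>\<sigma>\<in>H. \<sigma> x = x}"

definition finite_galois :: "'a::field set \<Rightarrow> bool" where
  "finite_galois K \<longleftrightarrow> subfield K \<and> finite_dim_over K UNIV \<and> fixed_field (Gal K) = K"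

definition subgroup_of :: "('a \<Rightarrow> 'a) set \<Rightarrow> ('a \<Rightarrow> 'a) set \<Rightarrow> bool" where
  "subgroup_of H G \<longleftrightarrow> H \<subseteq> G \<and> id \<in> H \<and>
     (\<forall>\<sigma>\<in>H. \<forall>\<tau>\<in>H. \<sigma> \<circ> \<tau> \<in> H) \<and> (\<forall>\<sigma>\<in>H. inv_into UNIV \<sigma> \<in> H)"

definition conjugate_in :: "('a \<Rightarrow> 'a) set \<Rightarrow> ('a \<Rightarrow> 'a) set \<Rightarrow> ('a \<Rightarrow> 'a) set \<Rightarrow> bool" where
  "conjugate_in G H H' \<longleftrightarrow> (\<exists>\<sigma>\<in>G. H' = (\<lambda>\<tau>. \<sigma> \<circ> \<tau> \<circ> inv_into UNIV \<sigma>) ` H)"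

text \<open>A list of representatives of the conjugacy classes of subgroups of G
  (each class represented exactly once).  The Burnside ring A(G), as an abelian
  group, is free on the classes G/H for H in such a list; its elements are thus
  integer coefficient vectors indexed by positions in the list.\<close>
definition subgroup_class_reps :: "('a \<Rightarrow> 'a) set \<Rightarrow> ('a \<Rightarrow> 'a) set list \<Rightarrow> bool" where
  "subgroup_class_reps G reps \<longleftrightarrow>
     (\<forall>i<length reps. subgroup_of (reps ! i) G) \<and>
     (\<forall>i<length reps. \<forall>j<length reps. conjugate_in G (reps ! i) (reps ! j) \<longrightarrow> i = j) \<and>
     (\<forall>H. subgroup_of H G \<longrightarrow> (\<exists>i<length reps. conjugate_in G (reps ! i) H))"

text \<open>Forms are given by Gram matrices with entries in K (char K \<noteq> 2, so quadratic
  forms and symmetric bilinear forms correspond).\<close>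
definition form_over :: "'a::field set \<Rightarrow> 'a mat \<Rightarrow> bool" where
  "form_over K A \<longleftrightarrow> A \<in> carrier_mat (dim_row A) (dim_row A) \<and> elements_mat A \<subseteq> K \<and>
     transpose_mat A = A \<and> det A \<noteq> 0"

definition isometric_over :: "'a::field set \<Rightarrow> 'a mat \<Rightarrow> 'a mat \<Rightarrow> bool" where
  "isometric_over K A B \<longleftrightarrow> (\<exists>P. P \<in> carrier_mat (dim_row A) (dim_row A) \<and>
     elements_mat P \<subseteq> K \<and> det P \<noteq> 0 \<and> transpose_mat P * A * P = B)"

definition osum :: "'a::field mat \<Rightarrow> 'a mat \<Rightarrow> 'a mat" where
  "osum A B = four_block_mat A (0\<^sub>m (dim_row A) (dim_col B)) (0\<^sub>m (dim_row B) (dim_col A)) B"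

definition osum_list :: "'a::field mat list \<Rightarrow> 'a mat" where
  "osum_list As = foldr osum As (0\<^sub>m 0 0)"

text \<open>An element of GW(K) = Grothendieck group of the monoid of isometry classes of
  nondegenerate forms, represented as a formal difference [P] - [N].
  Equality in the Grothendieck group: [P]-[N] = [P']-[N'] iff
  P + N' + R \<cong> P' + N + R for some form R.\<close>
definition gw_eq :: "'a::field set \<Rightarrow> 'a mat \<times> 'a mat \<Rightarrow> 'a mat \<times> 'a mat \<Rightarrow> bool" where
  "gw_eq K x y \<longleftrightarrow> (\<exists>R. form_over K R \<and>
     isometric_over K (osum (osum (fst x) (snd y)) R) (osum (osum (fst y) (snd x)) R))"

definition trace_form :: "'a::field set \<Rightarrow> 'a set \<Rightarrow> 'a mat" where
  "trace_form K F = (let n = chosen_dim K F; b = chosen_basis K F in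
     mat n n (\<lambda>(i, j). trace_over K F (b i * b j)))"

text \<open>Dress map h_{L/K} applied to \<Sum>_i a_i [G/H_i], H_i = reps!i:
  the GW-element \<Sum>_i a_i [tr_{L^{H_i}/K} <1>], as a formal difference.\<close>
definition dress :: "'a::field set \<Rightarrow> ('a \<Rightarrow> 'a) set list \<Rightarrow> (nat \<Rightarrow> int) \<Rightarrow> 'a mat \<times> 'a mat" where
  "dress K reps a =
     (osum_list (concat (map (\<lambda>i. replicate (nat (a i)) (trace_form K (fixed_field (reps ! i))))
                          [0..<length reps])),
      osum_list (concat (map (\<lambda>i. replicate (nat (- a i)) (trace_form K (fixed_field (reps ! i))))
                          [0..<length reps])))"

definition dress_injective :: "'a::field set \<Rightarrow> ('a \<Rightarrow> 'a) set list \<Rightarrow> bool" where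
  "dress_injective K reps \<longleftrightarrow>
     (\<forall>a b :: nat \<Rightarrow> int. gw_eq K (dress K reps a) (dress K reps b) \<longrightarrow>
        (\<forall>i<length reps. a i = b i))"

definition sum_of_squares_in :: "'a::field set \<Rightarrow> 'a \<Rightarrow> bool" where
  "sum_of_squares_in K al \<longleftrightarrow>
     (\<exists>(m::nat) (x::nat \<Rightarrow> 'a). m \<ge> 1 \<and> (\<forall>i<m. x i \<in> K \<and> x i \<noteq> 0) \<and> al = (\<Sum>i<m. (x i)\<^sup>2))"

end

theory Submission
  imports Defs "HOL-Library.Function_Algebras" "HOL-Library.Product_Plus" "HOL-Combinatorics.Permutations"
begin

text \<open>
  Up to torsion, an element of GW(K) is determined by the homomorphisms GW(K) \<rightarrow> \<rat>, so it suffices to compute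
  with rational-valued functions \<phi> on the nonzero elements of K that are additive on diagonal forms.
  If - 1 is a sum of squares in K, these only see the rank and G/1 - |G| G/G has torsion image. Otherwise the characteristic is 0, and up to
  positive integers, which are invisible to \<phi>, the trace form of L^H is x \<mapsto> tr (x^2) with tr the sum over G.
  A group with more than two elements contains a cyclic subgroup C of order 4, a Klein four-group V or a
  subgroup H of odd order n > 1, and the following elements have torsion image:
  G/C' - 2 G/C, where C' is the subgroup of order 2 of C, because L^C' is obtained from L^C by adjoining the square
  root of a sum of two squares; \<Sum> G/A - G/1 - 2 G/V over the subgroups A of order 2 of V, by decomposing L
  into eigenspaces; and G/1 - n G/H, because the diagonal entries of the trace form of L over L^H are sums of
  squares in L and the rank n is odd. If G has order 2 and L = K(\<surd>\<alpha>) with \<alpha> a sum of squares,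
  G/1 - 2 G/G has torsion image. Conversely, for L = K(\<surd>\<alpha>) the trace form of L is <2, 2 \<alpha>>, and Witt
  cancellation turns a relation into an isometry between d <2, 2 \<alpha>> and 2 d <1> with d > 0, so \<alpha> is a sum
  of squares.
\<close>

section \<open>Diagonal forms and isometries\<close>

text \<open>Torsion may be ignored because the Burnside ring is a free abelian group: if a nonzero
  combination of classes has torsion image, a positive multiple of it is a nonzero element of the
  kernel. Rational values permit division by 2, and this is what makes a nonzero sum of squares
  indistinguishable from 1. The case of - 1 a sum of squares must be split off because the
  characteristic may then divide |G|, so that x \<mapsto> tr (x^2) can be degenerate on an
  intermediate field. For formally real K, tr 1 = |G| is nonzero and every scaled form tr (c x y), c
  nonzero, is nondegenerate on every intermediate field containing c. The list of subgroups is
  exhaustive for the following reason. An element g with g^2 nontrivial has a power of order 4 or of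
  odd order greater than 1. If there is no such g, all elements are involutions, G is abelian, and
  two distinct nontrivial elements generate a Klein four-group. The odd case cannot split the trace
  form explicitly. It rests on a parity argument: a sum of an odd number of characters with values 1
  and - 1 never vanishes.\<close>

lemma subfield_0: "subfield K \<Longrightarrow> 0 \<in> K"
  and subfield_1: "subfield K \<Longrightarrow> 1 \<in> K"
  and subfield_add: "subfield K \<Longrightarrow> x \<in> K \<Longrightarrow> y \<in> K \<Longrightarrow> x + y \<in> K"
  and subfield_mult: "subfield K \<Longrightarrow> x \<in> K \<Longrightarrow> y \<in> K \<Longrightarrow> x * y \<in> K"
  and subfield_minus: "subfield K \<Longrightarrow> x \<in> K \<Longrightarrow> - x \<in> K"
  and subfield_inverse: "subfield K \<Longrightarrow> x \<in> K \<Longrightarrow> inverse x \<in> K"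
  by (auto simp: subfield_def)

lemma subfield_diff: "subfield K \<Longrightarrow> x \<in> K \<Longrightarrow> y \<in> K \<Longrightarrow> x - y \<in> K"
  using subfield_add[of K x "- y"] subfield_minus by fastforce

lemma subfield_divide: "subfield K \<Longrightarrow> x \<in> K \<Longrightarrow> y \<in> K \<Longrightarrow> x / y \<in> K"
  by (simp add: divide_inverse subfield_mult subfield_inverse)

lemma subfield_power: "subfield K \<Longrightarrow> x \<in> K \<Longrightarrow> x ^ n \<in> K"
  by (induction n) (auto simp: subfield_1 subfield_mult)

lemma subfield_sum: "subfield K \<Longrightarrow> (\<And>i. i \<in> I \<Longrightarrow> f i \<in> K) \<Longrightarrow> (\<Sum>i\<in>I. f i) \<in> K"
  by (induction I rule: infinite_finite_induct) (auto simp: subfield_0 subfield_add)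

lemma subfield_of_nat: "subfield K \<Longrightarrow> of_nat n \<in> K"
  by (induction n) (auto simp: subfield_0 subfield_1 subfield_add)

lemma subfield_numeral: "subfield K \<Longrightarrow> numeral n \<in> K"
  using subfield_of_nat[of K "numeral n"] by simp

lemmas subfield_closed = subfield_0 subfield_1 subfield_add subfield_mult subfield_minus
  subfield_inverse subfield_diff subfield_divide subfield_power subfield_sum subfield_of_nat
  subfield_numeral

definition diag :: "'a::field list \<Rightarrow> 'a mat" where
  "diag xs = mat (length xs) (length xs) (\<lambda>(i, j). if i = j then xs ! i else 0)"

lemma diag_carrier [simp]: "diag xs \<in> carrier_mat (length xs) (length xs)"
  by (simp add: diag_def)

lemma diag_dims [simp]: "dim_row (diag xs) = length xs" "dim_col (diag xs) = length xs"
  by (simp_all add: diag_def)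

lemma diag_index [simp]:
  "i < length xs \<Longrightarrow> j < length xs \<Longrightarrow> diag xs $$ (i, j) = (if i = j then xs ! i else 0)"
  by (simp add: diag_def)

lemma det_diag: "det (diag xs) = prod_list xs"
proof -
  have "det (diag xs) = prod_list (diag_mat (diag xs))"
    by (rule det_upper_triangular[OF _ diag_carrier]) auto
  also have "diag_mat (diag xs) = xs"
    by (auto simp: diag_mat_def intro!: nth_equalityI)
  finally show ?thesis .
qed

lemma det_diag_nonzero: "0 \<notin> set xs \<Longrightarrow> det (diag xs) \<noteq> 0"
  by (simp add: det_diag prod_list_zero_iff)

lemma elements_mat_subset_iff:
  "A \<in> carrier_mat n m \<Longrightarrow> elements_mat A \<subseteq> K \<longleftrightarrow> (\<forall>i<n. \<forall>j<m. A $$ (i, j) \<in> K)"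
  using elements_matI[of A n m] by (fastforce dest!: elements_matD)

lemma transpose_mult_mult_index:
  assumes "A \<in> carrier_mat n n" "P \<in> carrier_mat n m" "j < m" "k < m"
  shows "(transpose_mat P * A * P) $$ (j, k) =
    (\<Sum>i<n. \<Sum>l<n. P $$ (i, j) * A $$ (i, l) * P $$ (l, k))"
proof -
  have "(transpose_mat P * A * P) $$ (j, k) = (\<Sum>i<n. P $$ (i, j) * (\<Sum>l<n. A $$ (i, l) * P $$ (l, k)))"
    using assms by (auto simp: scalar_prod_def lessThan_atLeast0 intro!: sum.cong)
  also have "\<dots> = (\<Sum>i<n. \<Sum>l<n. P $$ (i, j) * A $$ (i, l) * P $$ (l, k))"
    by (simp add: sum_distrib_left mult.assoc)
  finally show ?thesis .
qed

text \<open>Invertibility of the basis change comes for free: taking determinants in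
  \<open>transpose_mat P * A * P = B\<close> shows that \<open>det P\<close> is nonzero as soon as
  \<open>det B\<close> is.\<close>

lemma isometric_overI:
  assumes "A \<in> carrier_mat n n" "B \<in> carrier_mat n n" "det B \<noteq> 0"
    and "\<And>i j. i < n \<Longrightarrow> j < n \<Longrightarrow> P i j \<in> K"
    and "\<And>j k. j < n \<Longrightarrow> k < n \<Longrightarrow> (\<Sum>i<n. \<Sum>l<n. P i j * A $$ (i, l) * P l k) = B $$ (j, k)"
  shows "isometric_over K A B"
proof -
  let ?P = "mat n n (\<lambda>(i, j). P i j)"
  have P: "?P \<in> carrier_mat n n" by simp
  have eq: "transpose_mat ?P * A * ?P = B"
  proof (rule eq_matI)
    fix j k assume "j < dim_row B" "k < dim_col B"
    hence "j < n" "k < n" using assms by auto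
    thus "(transpose_mat ?P * A * ?P) $$ (j, k) = B $$ (j, k)"
      by (subst transpose_mult_mult_index[OF assms(1) P]) (auto simp: assms(5)[symmetric] intro!: sum.cong)
  qed (use assms in auto)
  have "det ?P \<noteq> 0"
  proof
    assume "det ?P = 0"
    moreover have "det B = det (transpose_mat ?P * A) * det ?P"
      unfolding eq[symmetric] by (rule det_mult) (use assms in auto)
    ultimately show False using assms(3) by simp
  qed
  thus ?thesis
    unfolding isometric_over_def using assms(1,4) eq
    by (intro exI[of _ ?P]) (auto simp: elements_mat_subset_iff[OF P])
qed

lemma isometric_overE:
  assumes "isometric_over K A B" "A \<in> carrier_mat n n"
  obtains P where "\<And>i j. i < n \<Longrightarrow> j < n \<Longrightarrow> P i j \<in> K" "B \<in> carrier_mat n n"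
    "\<And>j k. j < n \<Longrightarrow> k < n \<Longrightarrow> (\<Sum>i<n. \<Sum>l<n. P i j * A $$ (i, l) * P l k) = B $$ (j, k)"
proof -
  obtain P where P: "P \<in> carrier_mat n n" "elements_mat P \<subseteq> K" "transpose_mat P * A * P = B"
    using assms unfolding isometric_over_def by auto
  show thesis
  proof (rule that[of "\<lambda>i j. P $$ (i, j)"])
    show "\<And>i j. i < n \<Longrightarrow> j < n \<Longrightarrow> P $$ (i, j) \<in> K" using P(2) elements_mat_subset_iff[OF P(1)] by blast
    show "B \<in> carrier_mat n n" using P assms by auto
    show "\<And>j k. j < n \<Longrightarrow> k < n \<Longrightarrow> (\<Sum>i<n. \<Sum>l<n. P $$ (i, j) * A $$ (i, l) * P $$ (l, k)) = B $$ (j, k)"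
      unfolding P(3)[symmetric] by (rule transpose_mult_mult_index[OF assms(2) P(1), symmetric])
  qed
qed

lemma diag_form_sum:
  "(\<Sum>i<length xs. \<Sum>l<length xs. p i * diag xs $$ (i, l) * q l) = (\<Sum>i<length xs. p i * xs ! i * q i)"
proof (rule sum.cong)
  fix i assume i: "i \<in> {..<length xs}"
  have "(\<Sum>l<length xs. p i * diag xs $$ (i, l) * q l) = (\<Sum>l<length xs. if l = i then p i * xs ! i * q i else 0)"
    using i by (intro sum.cong) auto
  thus "(\<Sum>l<length xs. p i * diag xs $$ (i, l) * q l) = p i * xs ! i * q i"
    using i by simp
qed auto

text \<open>The working form of isometry: the columns of \<open>P\<close> are pairwise orthogonal
  vectors for the form \<open>xs\<close>, with values \<open>ys\<close>. As no value is 0, such a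
  \<open>P\<close> is invertible.\<close>

lemma isometric_over_diag_iff:
  assumes "0 \<notin> set ys"
  shows "isometric_over K (diag xs) (diag ys) \<longleftrightarrow> length xs = length ys \<and>
    (\<exists>P. (\<forall>i<length xs. \<forall>j<length xs. P i j \<in> K) \<and>
      (\<forall>j<length xs. \<forall>k<length xs. (\<Sum>i<length xs. P i j * xs ! i * P i k) = (if j = k then ys ! j else 0)))"
    (is "?L \<longleftrightarrow> ?R")
proof
  assume ?L
  then obtain P where P: "\<And>i j. i < length xs \<Longrightarrow> j < length xs \<Longrightarrow> P i j \<in> K"
      "diag ys \<in> carrier_mat (length xs) (length xs)"
      "\<And>j k. j < length xs \<Longrightarrow> k < length xs \<Longrightarrow>
        (\<Sum>i<length xs. \<Sum>l<length xs. P i j * diag xs $$ (i, l) * P l k) = diag ys $$ (j, k)"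
    by (rule isometric_overE[OF _ diag_carrier]) blast
  have "length xs = length ys" using carrier_matD(1)[OF P(2)] by simp
  with P(1,3)[unfolded diag_form_sum] show ?R by (auto intro!: exI[of _ P])
next
  assume ?R
  then obtain P where P: "length xs = length ys" "\<And>i j. i < length xs \<Longrightarrow> j < length xs \<Longrightarrow> P i j \<in> K"
    "\<And>j k. j < length xs \<Longrightarrow> k < length xs \<Longrightarrow>
      (\<Sum>i<length xs. P i j * xs ! i * P i k) = (if j = k then ys ! j else 0)"
    by blast
  show ?L
    by (rule isometric_overI[where n = "length xs" and P = P], unfold diag_form_sum)
       (use P det_diag_nonzero[OF assms] in auto)
qed

lemma isometric_over_refl:
  assumes "subfield K" "A \<in> carrier_mat n n"
  shows "isometric_over K A A"
  unfolding isometric_over_def using assms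
  by (intro exI[of _ "1\<^sub>m (dim_row A)"]) (auto simp: elements_mat_def subfield_0 subfield_1)

lemma isometric_over_dim: "isometric_over K A B \<Longrightarrow> A \<in> carrier_mat n n \<Longrightarrow> B \<in> carrier_mat n n"
  by (rule isometric_overE)

lemma elements_mat_mult:
  assumes "subfield K" "A \<in> carrier_mat n m" "B \<in> carrier_mat m l" "elements_mat A \<subseteq> K" "elements_mat B \<subseteq> K"
  shows "elements_mat (A * B) \<subseteq> K"
proof -
  have AB: "A * B \<in> carrier_mat n l" using assms by simp
  show ?thesis unfolding elements_mat_subset_iff[OF AB]
    using assms elements_mat_subset_iff[OF assms(2), of K] elements_mat_subset_iff[OF assms(3), of K]
    by (auto simp: scalar_prod_def intro!: subfield_sum subfield_mult)
qed

lemma isometric_over_trans: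
  assumes "subfield K" "A \<in> carrier_mat n n" "isometric_over K A B" "isometric_over K B C"
  shows "isometric_over K A C"
proof -
  have B: "B \<in> carrier_mat n n" using assms isometric_over_dim by blast
  obtain P where P: "P \<in> carrier_mat n n" "elements_mat P \<subseteq> K" "det P \<noteq> 0" "transpose_mat P * A * P = B"
    using assms unfolding isometric_over_def by auto
  obtain Q where Q: "Q \<in> carrier_mat n n" "elements_mat Q \<subseteq> K" "det Q \<noteq> 0" "transpose_mat Q * B * Q = C"
    using assms B unfolding isometric_over_def by auto
  have "transpose_mat (P * Q) * A * (P * Q) = transpose_mat Q * (transpose_mat P * A * P) * Q"
    using P(1) Q(1) assms(2)
    by (simp add: transpose_mult[of _ n n _ n] assoc_mult_mat[of _ n n _ n _ n])
  thus ?thesis unfolding isometric_over_def using P Q assms(1,2)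
    by (intro exI[of _ "P * Q"]) (auto simp: det_mult elements_mat_mult)
qed

text \<open>As \<open>transpose_mat P * A * P\<close> is \<open>diag xs\<close>, the inverse of
  \<open>P\<close> is the diagonal matrix of the inverses of \<open>xs\<close> times
  \<open>transpose_mat P * A\<close>. This formula shows at once that the inverse has entries in
  \<open>K\<close>.\<close>

lemma isometric_over_diag_sym:
  assumes K: "subfield K" and A: "A \<in> carrier_mat n n" "elements_mat A \<subseteq> K"
    and iso: "isometric_over K A (diag xs)" and xs: "set xs \<subseteq> K - {0}"
  shows "isometric_over K (diag xs) A"
proof -
  have n: "length xs = n" using carrier_matD(1)[OF isometric_over_dim[OF iso A(1)]] by simp
  obtain P where P: "P \<in> carrier_mat n n" "elements_mat P \<subseteq> K" "det P \<noteq> 0" "transpose_mat P * A * P = diag xs"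
    using iso A unfolding isometric_over_def by auto
  define E where "E = diag (map inverse xs)"
  have E: "E \<in> carrier_mat n n" "elements_mat E \<subseteq> K" "E * diag xs = 1\<^sub>m n"
  proof -
    show E1: "E \<in> carrier_mat n n" using n unfolding E_def by (metis diag_carrier length_map)
    show "elements_mat E \<subseteq> K" unfolding elements_mat_subset_iff[OF E1] unfolding E_def
      using n xs K by (auto intro!: subfield_inverse simp: subfield_0 subset_iff)
    show "E * diag xs = 1\<^sub>m n"
    proof (rule eq_matI)
      fix i j assume ij: "i < dim_row (1\<^sub>m n)" "j < dim_col (1\<^sub>m n)"
      have "(E * diag xs) $$ (i, j) = (\<Sum>k<n. E $$ (i, k) * diag xs $$ (k, j))"
        using ij n E1 by (auto simp: scalar_prod_def lessThan_atLeast0)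
      also have "\<dots> = (\<Sum>k<n. if k = i then (if i = j then 1 else 0) else 0)"
      proof (rule sum.cong)
        fix k assume "k \<in> {..<n}"
        moreover have "xs ! i \<noteq> 0" using xs ij n nth_mem[of i xs] by (metis DiffD2 index_one_mat(2) singletonI subsetD)
        ultimately show "E $$ (i, k) * diag xs $$ (k, j) = (if k = i then (if i = j then 1 else 0) else 0)"
          using n ij by (auto simp: E_def)
      qed auto
      finally show "(E * diag xs) $$ (i, j) = 1\<^sub>m n $$ (i, j)" using ij by auto
    qed (use n E1 in auto)
  qed
  define Q where "Q = E * (transpose_mat P * A)"
  have Q: "Q \<in> carrier_mat n n" using E P A by (auto simp: Q_def)
  have "Q * P = 1\<^sub>m n"
    using E P A by (simp add: Q_def assoc_mult_mat[of _ n n _ n _ n])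
  hence PQ: "P * Q = 1\<^sub>m n" using mat_mult_left_right_inverse[OF Q P(1)] by simp
  have "transpose_mat Q * diag xs * Q = transpose_mat Q * (transpose_mat P * A * P) * Q"
    using P by simp
  also have "\<dots> = transpose_mat (P * Q) * A * (P * Q)"
    using P(1) Q A(1)
    by (simp add: transpose_mult[of _ n n _ n] assoc_mult_mat[of _ n n _ n _ n])
  also have "\<dots> = A" using PQ A by simp
  finally have "transpose_mat Q * diag xs * Q = A" .
  moreover have "det Q \<noteq> 0" using PQ det_mult[OF P(1) Q] by auto
  moreover have "elements_mat Q \<subseteq> K"
  proof -
    have "elements_mat (transpose_mat P) \<subseteq> K"
      using P elements_mat_subset_iff[OF P(1)] elements_mat_subset_iff[of "transpose_mat P" n n] by auto
    thus ?thesis unfolding Q_def using E P A K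
      by (intro elements_mat_mult[of K _ n n _ n]) auto
  qed
  ultimately show ?thesis unfolding isometric_over_def using Q n by auto
qed

section \<open>Orthogonal sums and permutations of diagonal entries\<close>

lemma osum_carrier: "A \<in> carrier_mat n n \<Longrightarrow> B \<in> carrier_mat m m \<Longrightarrow> osum A B \<in> carrier_mat (n + m) (n + m)"
  by (auto simp: osum_def)

lemma elements_mat_osum:
  assumes "subfield K" "A \<in> carrier_mat n n" "B \<in> carrier_mat m m" "elements_mat A \<subseteq> K" "elements_mat B \<subseteq> K"
  shows "elements_mat (osum A B) \<subseteq> K"
  using assms elements_mat_subset_iff[OF assms(2), of K] elements_mat_subset_iff[OF assms(3), of K]
  unfolding elements_mat_subset_iff[OF osum_carrier[OF assms(2,3)]]
  by (auto simp: osum_def subfield_0)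

lemma isometric_over_osum:
  assumes K: "subfield K" and A: "A \<in> carrier_mat n n" and B: "B \<in> carrier_mat m m"
    and iA: "isometric_over K A A'" and iB: "isometric_over K B B'"
  shows "isometric_over K (osum A B) (osum A' B')"
proof -
  have A': "A' \<in> carrier_mat n n" and B': "B' \<in> carrier_mat m m"
    using A B iA iB isometric_over_dim by blast+
  obtain P where P: "P \<in> carrier_mat n n" "elements_mat P \<subseteq> K" "det P \<noteq> 0" "transpose_mat P * A * P = A'"
    using iA A unfolding isometric_over_def by auto
  obtain Q where Q: "Q \<in> carrier_mat m m" "elements_mat Q \<subseteq> K" "det Q \<noteq> 0" "transpose_mat Q * B * Q = B'"
    using iB B unfolding isometric_over_def by auto
  have Pt: "transpose_mat P * A \<in> carrier_mat n n" and Qt: "transpose_mat Q * B \<in> carrier_mat m m"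
    using A B P Q by auto
  have 1: "transpose_mat (osum P Q) = osum (transpose_mat P) (transpose_mat Q)"
    unfolding osum_def using P Q by (subst transpose_four_block_mat[of _ n n _ m _ m]) auto
  have 2: "osum X Y * osum X' Y' = osum (X * X') (Y * Y')"
    if "X \<in> carrier_mat n n" "Y \<in> carrier_mat m m" "X' \<in> carrier_mat n n" "Y' \<in> carrier_mat m m" for X Y X' Y'
    unfolding osum_def using that
    by (subst mult_four_block_mat[of _ n n _ m _ m]) auto
  have "transpose_mat (osum P Q) * osum A B * osum P Q = osum A' B'"
    unfolding 1 using P Q A B Pt Qt by (simp add: 2)
  moreover have "det (osum P Q) = det P * det Q"
    unfolding osum_def using P Q
    by (subst det_four_block_mat_upper_right_zero[of _ n _ m]) auto
  ultimately show ?thesis unfolding isometric_over_def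
    using P Q A B elements_mat_osum[OF K P(1) Q(1)] osum_carrier[OF P(1) Q(1)] osum_carrier[OF A B]
    by (intro exI[of _ "osum P Q"]) auto
qed

lemma osum_diag: "osum (diag xs) (diag ys) = diag (xs @ ys)"
  by (rule eq_matI) (auto simp: osum_def nth_append)

lemma diag_Nil: "diag [] = 0\<^sub>m 0 0"
  by (rule eq_matI) auto

text \<open>The basis change is the permutation matrix whose column \<open>j\<close> has its only 1
  in row \<open>p j\<close>.\<close>

lemma isometric_over_diag_perm:
  assumes K: "subfield K" and m: "mset xs = mset ys" and nz: "0 \<notin> set ys"
  shows "isometric_over K (diag xs) (diag ys)"
proof -
  have nz': "0 \<notin> set xs" using m nz mset_eq_setD by blast
  obtain p where p: "p permutes {..<length xs}" "permute_list p xs = ys"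
    using mset_eq_permutation[OF m[symmetric]] by auto
  have len: "length xs = length ys" using m mset_eq_length by blast
  have ys: "ys ! j = xs ! p j" if "j < length xs" for j using p that permute_list_nth by metis
  have "(\<Sum>i<length xs. (if i = p j then 1 else 0) * xs ! i * (if i = p k then 1 else 0)) =
      (if j = k then ys ! j else 0)" if "j < length xs" "k < length xs" for j k
  proof -
    have "(\<Sum>i<length xs. (if i = p j then 1 else 0) * xs ! i * (if i = p k then 1 else 0)) =
       (\<Sum>i<length xs. if i = p j then (if p j = p k then xs ! p j else 0) else 0)"
      by (rule sum.cong) auto
    also have "\<dots> = (if p j = p k then xs ! p j else 0)"
      using permutes_in_image[OF p(1), of j] that by simp
    also have "p j = p k \<longleftrightarrow> j = k" using permutes_inj[OF p(1)] by (auto dest: injD)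
    finally show ?thesis using ys that by simp
  qed
  thus ?thesis unfolding isometric_over_diag_iff[OF nz] using len K
    by (intro conjI exI[of _ "\<lambda>i j. if i = p j then 1 else 0"]) (auto simp: subfield_0 subfield_1)
qed

text \<open>An invertible matrix of size \<open>m\<close> does not factor through dimension
  \<open>n < m\<close>: after padding both factors to size \<open>m\<close>, row \<open>n\<close> of
  the second one is zero, so the determinant of the product vanishes. All comparisons of dimensions
  below go back to this.\<close>

lemma inner_dim_ge:
  fixes U W :: "nat \<Rightarrow> nat \<Rightarrow> 'a::field"
  assumes "\<And>j k. j < m \<Longrightarrow> k < m \<Longrightarrow> (\<Sum>i<n. U j i * W i k) = (if j = k then e j else 0)"
    and "\<And>j. j < m \<Longrightarrow> e j \<noteq> 0"
  shows "m \<le> n"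
proof (rule ccontr)
  assume "\<not> m \<le> n"
  hence nm: "n < m" by simp
  define U' where "U' = mat m m (\<lambda>(j, i). if i < n then U j i else 0)"
  define W' where "W' = mat\<^sub>r m m (\<lambda>i. if i = n then 0\<^sub>v m else vec m (\<lambda>k. if i < n then W i k else 0))"
  have car: "U' \<in> carrier_mat m m" "W' \<in> carrier_mat m m" by (auto simp: U'_def W'_def)
  have "det W' = 0" unfolding W'_def by (rule det_row_0) (use nm in auto)
  moreover have "U' * W' = diag (map e [0..<m])"
  proof (rule eq_matI)
    fix j k assume "j < dim_row (diag (map e [0..<m]))" "k < dim_col (diag (map e [0..<m]))"
    hence jk: "j < m" "k < m" by auto
    have "(U' * W') $$ (j, k) = (\<Sum>i<m. U' $$ (j, i) * W' $$ (i, k))"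
      using jk car by (auto simp: scalar_prod_def lessThan_atLeast0)
    also have "\<dots> = (\<Sum>i<n. U' $$ (j, i) * W' $$ (i, k))"
      by (rule sum.mono_neutral_right) (use nm jk in \<open>auto simp: U'_def\<close>)
    also have "\<dots> = (\<Sum>i<n. U j i * W i k)"
      by (rule sum.cong) (use nm jk in \<open>auto simp: U'_def W'_def\<close>)
    finally show "(U' * W') $$ (j, k) = diag (map e [0..<m]) $$ (j, k)" using jk assms(1) by simp
  qed (use car in auto)
  ultimately have "det (diag (map e [0..<m])) = 0" using det_mult[OF car] by simp
  moreover have "0 \<notin> set (map e [0..<m])" using assms(2) by force
  ultimately show False using det_diag_nonzero by blast
qed

text \<open>Witt cancellation by a Cayley-type formula: if p is the corner entry, q the rest of the first row, r the
  rest of the first column and S the remaining block of an isometry, then S + l r q with l = 1 / (1 - p), or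
  l = - 1 / 2 if p = 1, is an isometry of the complements.\<close>
lemma isometric_over_cancel1:
  fixes K :: "'a::field set"
  assumes two: "(2::'a) \<noteq> 0" and K: "subfield K" and z: "z \<noteq> 0" and nz: "0 \<notin> set ys"
    and iso: "isometric_over K (diag (z # xs)) (diag (z # ys))"
  shows "isometric_over K (diag xs) (diag ys)"
proof -
  let ?n = "length xs"
  have "0 \<notin> set (z # ys)" using z nz by simp
  from iso[unfolded isometric_over_diag_iff[OF this] length_Cons less_Suc_eq_le]
  obtain P where len: "length xs = length ys" and PK: "\<And>i j. i \<le> ?n \<Longrightarrow> j \<le> ?n \<Longrightarrow> P i j \<in> K"
    and P: "\<And>j k. j \<le> ?n \<Longrightarrow> k \<le> ?n \<Longrightarrow> (\<Sum>i<Suc ?n. P i j * (z # xs) ! i * P i k) = (if j = k then (z # ys) ! j else 0)"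
    by blast
  define p where "p = P 0 0"
  define q where "q j = P 0 (Suc j)" for j
  define r where "r i = P (Suc i) 0" for i
  define S where "S i j = P (Suc i) (Suc j)" for i j
  define l where "l = (if p = 1 then - 1 / 2 else 1 / (1 - p))"
  have lK: "l \<in> K" using PK[of 0 0] K by (auto simp: l_def p_def subfield_closed)
  \<comment> \<open>The left side is the coefficient of \<open>z * q j * q k\<close> in the Gram
    matrix of the new columns. It factors as ((1 - p) l - 1) ((1 + p) l + 1); for p = 1 the first
    factor is - 1 and the root of the second is - 1 / 2.\<close>
  have l: "l^2 * (1 - p^2) - 1 - 2 * l * p = 0"
  proof (cases "p = 1")
    case True thus ?thesis using two by (simp add: l_def)
  next
    case False
    hence "l * (1 - p) = 1" by (simp add: l_def)
    moreover have "l^2 * (1 - p^2) - 1 - 2 * l * p = l * (1 + p) * (l * (1 - p)) - 1 - 2 * l * p"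
      by (simp add: algebra_simps power2_eq_square)
    ultimately have "l^2 * (1 - p^2) - 1 - 2 * l * p = l * (1 + p) - 1 - 2 * l * p" by simp
    also have "\<dots> = l * (1 - p) - 1" by (simp add: algebra_simps)
    finally show ?thesis using \<open>l * (1 - p) = 1\<close> by simp
  qed
  have e00: "z * p^2 + (\<Sum>i<?n. r i * xs ! i * r i) = z"
    using P[of 0 0] by (simp del: sum.lessThan_Suc add: sum.lessThan_Suc_shift p_def r_def power2_eq_square mult_ac)
  have e0k: "z * p * q k + (\<Sum>i<?n. r i * xs ! i * S i k) = 0" if "k < ?n" for k
    using P[of 0 "Suc k"] that by (simp del: sum.lessThan_Suc add: sum.lessThan_Suc_shift p_def r_def q_def S_def mult_ac)
  have ejk: "z * q j * q k + (\<Sum>i<?n. S i j * xs ! i * S i k) = (if j = k then ys ! j else 0)" if "j < ?n" "k < ?n" for j k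
    using P[of "Suc j" "Suc k"] that by (simp del: sum.lessThan_Suc add: sum.lessThan_Suc_shift p_def r_def q_def S_def mult_ac)
  define T where "T i j = S i j + l * r i * q j" for i j
  have "(\<Sum>i<?n. T i j * xs ! i * T i k) = (if j = k then ys ! j else 0)" if jk: "j < ?n" "k < ?n" for j k
  proof -
    have "(\<Sum>i<?n. T i j * xs ! i * T i k) = (\<Sum>i<?n. S i j * xs ! i * S i k)
        + l * q k * (\<Sum>i<?n. r i * xs ! i * S i j) + l * q j * (\<Sum>i<?n. r i * xs ! i * S i k)
        + l^2 * q j * q k * (\<Sum>i<?n. r i * xs ! i * r i)"
      unfolding sum_distrib_left sum.distrib[symmetric] T_def
      by (rule sum.cong) (auto simp: algebra_simps power2_eq_square)
    also have "(\<Sum>i<?n. r i * xs ! i * S i j) = - z * p * q j" using e0k[OF jk(1)] by (simp add: eq_neg_iff_add_eq_0 add.commute)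
    also have "(\<Sum>i<?n. r i * xs ! i * S i k) = - z * p * q k" using e0k[OF jk(2)] by (simp add: eq_neg_iff_add_eq_0 add.commute)
    also have "(\<Sum>i<?n. r i * xs ! i * r i) = z * (1 - p^2)" using e00 by (simp add: algebra_simps eq_diff_eq)
    also have "(\<Sum>i<?n. S i j * xs ! i * S i k) = (if j = k then ys ! j else 0) - z * q j * q k"
      using ejk[OF jk] by (simp add: eq_diff_eq algebra_simps)
    finally have "(\<Sum>i<?n. T i j * xs ! i * T i k) =
        (if j = k then ys ! j else 0) + z * q j * q k * (l^2 * (1 - p^2) - 1 - 2 * l * p)"
      by (simp add: algebra_simps power2_eq_square)
    thus ?thesis using l by simp
  qed
  moreover have "T i j \<in> K" if "i < ?n" "j < ?n" for i j
    using that K lK PK by (auto simp: T_def S_def r_def q_def intro!: subfield_add subfield_mult)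
  ultimately show ?thesis using isometric_over_diag_iff[OF nz] len by blast
qed

lemma isometric_over_cancel:
  fixes K :: "'a::field set"
  assumes "(2::'a) \<noteq> 0" "subfield K" "0 \<notin> set ys" "0 \<notin> set zs"
    "isometric_over K (diag (zs @ xs)) (diag (zs @ ys))"
  shows "isometric_over K (diag xs) (diag ys)"
  using assms 
proof (induction zs)
  case (Cons z zs)
  thus ?case using isometric_over_cancel1[of K z "zs @ ys" "zs @ xs"] by auto
qed simp

section \<open>Orthogonal bases\<close>

lemma sum_nth_eq_sum_list: "(\<Sum>i<length xs. h (xs ! i)) = sum_list (map h xs)"
  by (simp add: sum_list_sum_nth atLeast0LessThan)

text \<open>Spanning is expressed by the expansion formula with explicit coefficients, from which
  linear independence and base change matrices are read off. The scalar multiplication is a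
  parameter because the notion is applied to subsets of the field, to pairs and to coordinate
  vectors.\<close>

definition orth_basis :: "('a::field \<Rightarrow> 'v::ab_group_add \<Rightarrow> 'v) \<Rightarrow> 'v set \<Rightarrow> ('v \<Rightarrow> 'v \<Rightarrow> 'a) \<Rightarrow> 'v list \<Rightarrow> bool" where
  "orth_basis sc V B bs \<longleftrightarrow> set bs \<subseteq> V \<and>
     (\<forall>i<length bs. \<forall>j<length bs. i \<noteq> j \<longrightarrow> B (bs ! i) (bs ! j) = 0) \<and>
     (\<forall>b\<in>set bs. B b b \<noteq> 0) \<and>
     (\<forall>x\<in>V. x = (\<Sum>i<length bs. sc (B x (bs ! i) / B (bs ! i) (bs ! i)) (bs ! i)))"

lemma orth_basis_nth: "orth_basis sc V B bs \<Longrightarrow> i < length bs \<Longrightarrow> bs ! i \<in> V"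
  and orth_basis_orth: "orth_basis sc V B bs \<Longrightarrow> i < length bs \<Longrightarrow> j < length bs \<Longrightarrow> i \<noteq> j \<Longrightarrow> B (bs ! i) (bs ! j) = 0"
  and orth_basis_nonzero: "orth_basis sc V B bs \<Longrightarrow> b \<in> set bs \<Longrightarrow> B b b \<noteq> 0"
  and orth_basis_set: "orth_basis sc V B bs \<Longrightarrow> b \<in> set bs \<Longrightarrow> b \<in> V"
  by (auto simp: orth_basis_def)

lemma orth_basis_expand: "orth_basis sc V B bs \<Longrightarrow> x \<in> V \<Longrightarrow>
    (\<Sum>i<length bs. sc (B x (bs ! i) / B (bs ! i) (bs ! i)) (bs ! i)) = x"
  unfolding orth_basis_def by (elim conjE, drule (1) bspec, erule sym)

abbreviation squares :: "('v \<Rightarrow> 'v \<Rightarrow> 'a) \<Rightarrow> 'v list \<Rightarrow> 'a list" where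
  "squares B bs \<equiv> map (\<lambda>b. B b b) bs"

text \<open>The ambient space has the whole type as scalars, whereas \<open>V\<close> is closed only
  under scalars from \<open>K\<close> and \<open>B\<close> is controlled only on \<open>V\<close>.
  In this way an intermediate field is a space over \<open>K\<close> without a new type.\<close>

locale bilinear_space = vector_space sc
  for sc :: "'a::field \<Rightarrow> 'v::ab_group_add \<Rightarrow> 'v" (infixr "*s" 75) +
  fixes K :: "'a set" and V :: "'v set" and B :: "'v \<Rightarrow> 'v \<Rightarrow> 'a"
  assumes subfield_K: "subfield K"
    and zero_V: "0 \<in> V" and add_V: "x \<in> V \<Longrightarrow> y \<in> V \<Longrightarrow> x + y \<in> V"
    and scale_V: "c \<in> K \<Longrightarrow> x \<in> V \<Longrightarrow> c *s x \<in> V"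
    and B_K: "x \<in> V \<Longrightarrow> y \<in> V \<Longrightarrow> B x y \<in> K"
    and B_sym: "x \<in> V \<Longrightarrow> y \<in> V \<Longrightarrow> B x y = B y x"
    and B_add_left: "x \<in> V \<Longrightarrow> y \<in> V \<Longrightarrow> z \<in> V \<Longrightarrow> B (x + y) z = B x z + B y z"
    and B_scale_left: "c \<in> K \<Longrightarrow> x \<in> V \<Longrightarrow> y \<in> V \<Longrightarrow> B (c *s x) y = c * B x y"
begin

lemma minus_V: "x \<in> V \<Longrightarrow> - x \<in> V"
  using scale_V[of "-1" x] subfield_K by (auto simp: subfield_closed)

lemma diff_V: "x \<in> V \<Longrightarrow> y \<in> V \<Longrightarrow> x - y \<in> V"
  using add_V[of x "- y"] minus_V by fastforce

lemma sum_V: "(\<And>i. i \<in> I \<Longrightarrow> f i \<in> V) \<Longrightarrow> sum f I \<in> V"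
  by (induction I rule: infinite_finite_induct) (auto simp: zero_V add_V)

lemma B_zero_left: "y \<in> V \<Longrightarrow> B 0 y = 0"
  using B_scale_left[of 0 0 y] zero_V subfield_K by (simp add: subfield_0)

lemma B_sum_left: "(\<And>i. i \<in> I \<Longrightarrow> f i \<in> V) \<Longrightarrow> y \<in> V \<Longrightarrow> B (sum f I) y = (\<Sum>i\<in>I. B (f i) y)"
  by (induction I rule: infinite_finite_induct) (auto simp: B_zero_left B_add_left sum_V)

lemma B_lincomb_left:
  "(\<And>i. i \<in> I \<Longrightarrow> f i \<in> V) \<Longrightarrow> (\<And>i. i \<in> I \<Longrightarrow> c i \<in> K) \<Longrightarrow> y \<in> V \<Longrightarrow>
    B (\<Sum>i\<in>I. c i *s f i) y = (\<Sum>i\<in>I. c i * B (f i) y)"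
  by (simp add: B_sum_left scale_V B_scale_left)

lemma B_lincomb_right:
  assumes "\<And>i. i \<in> I \<Longrightarrow> f i \<in> V" "\<And>i. i \<in> I \<Longrightarrow> c i \<in> K" "y \<in> V"
  shows "B y (\<Sum>i\<in>I. c i *s f i) = (\<Sum>i\<in>I. c i * B y (f i))"
proof -
  have "B y (\<Sum>i\<in>I. c i *s f i) = B (\<Sum>i\<in>I. c i *s f i) y"
    using assms by (intro B_sym sum_V scale_V)
  also have "\<dots> = (\<Sum>i\<in>I. c i * B (f i) y)" using assms by (rule B_lincomb_left)
  also have "\<dots> = (\<Sum>i\<in>I. c i * B y (f i))" using assms B_sym by (intro sum.cong) auto
  finally show ?thesis .
qed

lemma B_add_right: "x \<in> V \<Longrightarrow> y \<in> V \<Longrightarrow> z \<in> V \<Longrightarrow> B z (x + y) = B z x + B z y"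
  using B_add_left[of x y z] B_sym add_V by metis

lemma B_diff_left: "x \<in> V \<Longrightarrow> y \<in> V \<Longrightarrow> z \<in> V \<Longrightarrow> B (x - y) z = B x z - B y z"
  using B_add_left[of "x - y" y z] diff_V by (simp add: eq_diff_eq)

text \<open>The Gram matrix of \<open>bs\<close> is diagonal with nonzero entries, and expanding the
  vectors in the \<open>n\<close> generators factors it through dimension \<open>n\<close>.\<close>

lemma orth_length_le:
  assumes gen: "\<And>i. i < n \<Longrightarrow> e i \<in> V"
    "\<And>x. x \<in> V \<Longrightarrow> \<exists>c. (\<forall>i<n. c i \<in> K) \<and> x = (\<Sum>i<n. c i *s e i)"
    and bs: "set bs \<subseteq> V" "\<And>i j. i < length bs \<Longrightarrow> j < length bs \<Longrightarrow> i \<noteq> j \<Longrightarrow> B (bs ! i) (bs ! j) = 0"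
    "\<And>b. b \<in> set bs \<Longrightarrow> B b b \<noteq> 0"
  shows "length bs \<le> n"
proof -
  have V: "bs ! j \<in> V" if "j < length bs" for j using bs(1) that by auto
  have "\<forall>j. \<exists>c. j < length bs \<longrightarrow> (\<forall>i<n. c i \<in> K) \<and> bs ! j = (\<Sum>i<n. c i *s e i)"
    using gen(2) V by blast
  then obtain c where c: "\<And>j. j < length bs \<Longrightarrow> (\<forall>i<n. c j i \<in> K) \<and> bs ! j = (\<Sum>i<n. c j i *s e i)"
    by metis
  show ?thesis
  proof (rule inner_dim_ge)
    fix j k assume jk: "j < length bs" "k < length bs"
    have "(\<Sum>i<n. c j i * B (e i) (bs ! k)) = B (\<Sum>i<n. c j i *s e i) (bs ! k)"
      using jk c V gen by (subst B_lincomb_left) auto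
    also have "\<dots> = B (bs ! j) (bs ! k)" using c jk by metis
    finally show "(\<Sum>i<n. c j i * B (e i) (bs ! k)) = (if j = k then B (bs ! j) (bs ! j) else 0)"
      using bs(2) jk by auto
  qed (use bs(3) in auto)
qed

lemma orth_basis_coeff_K:
  "orth_basis sc V B bs \<Longrightarrow> x \<in> V \<Longrightarrow> i < length bs \<Longrightarrow> B x (bs ! i) / B (bs ! i) (bs ! i) \<in> K"
  by (intro subfield_divide[OF subfield_K] B_K orth_basis_nth)

lemma orth_basis_gen:
  assumes "orth_basis sc V B bs"
  shows "i < length bs \<Longrightarrow> bs ! i \<in> V"
    "x \<in> V \<Longrightarrow> \<exists>c. (\<forall>i<length bs. c i \<in> K) \<and> x = (\<Sum>i<length bs. c i *s bs ! i)"
proof -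
  show "i < length bs \<Longrightarrow> bs ! i \<in> V" using assms by (rule orth_basis_nth)
  assume x: "x \<in> V"
  show "\<exists>c. (\<forall>i<length bs. c i \<in> K) \<and> x = (\<Sum>i<length bs. c i *s bs ! i)"
    by (rule exI[of _ "\<lambda>i. B x (bs ! i) / B (bs ! i) (bs ! i)"])
       (use orth_basis_coeff_K[OF assms x] in \<open>simp add: orth_basis_expand[OF assms x]\<close>)
qed

lemma orth_basis_squares: "orth_basis sc V B bs \<Longrightarrow> set (squares B bs) \<subseteq> K - {0}"
  by (auto intro!: B_K dest: orth_basis_nonzero orth_basis_set)

lemma orth_basis_length_le:
  assumes bs: "orth_basis sc V B bs" and cs: "orth_basis sc V B cs"
  shows "length cs \<le> length bs"
proof (rule orth_length_le[OF orth_basis_gen[OF bs]])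
  show "set cs \<subseteq> V" using orth_basis_set[OF cs] by blast
qed (use orth_basis_orth[OF cs] orth_basis_nonzero[OF cs] in auto)

text \<open>The expansion coefficients of \<open>cs\<close> in \<open>bs\<close> are the base change
  matrix. Thanks to this, an invariant of forms may be computed in any orthogonal basis.\<close>

lemma orth_basis_isometric:
  assumes bs: "orth_basis sc V B bs" and cs: "orth_basis sc V B cs"
  shows "isometric_over K (diag (squares B bs)) (diag (squares B cs))"
proof -
  have len: "length bs = length cs"
    using orth_basis_length_le bs cs by (simp add: order.antisym)
  let ?n = "length bs"
  define P where "P i j = B (cs ! j) (bs ! i) / B (bs ! i) (bs ! i)" for i j
  note bV = orth_basis_gen(1)[OF bs] and cV = orth_basis_gen(1)[OF cs]
  have PK: "P i j \<in> K" if "i < ?n" "j < ?n" for i j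
    using that orth_basis_coeff_K[OF bs] cV len by (auto simp: P_def)
  have cs_eq: "cs ! j = (\<Sum>i<?n. P i j *s bs ! i)" if "j < ?n" for j
    unfolding P_def using orth_basis_expand[OF bs cV[of j]] that len by simp
  have "(\<Sum>i<?n. P i j * squares B bs ! i * P i k) = (if j = k then squares B cs ! j else 0)"
    if jk: "j < ?n" "k < ?n" for j k
  proof -
    have "B (cs ! k) (cs ! j) = B (\<Sum>i<?n. P i k *s bs ! i) (cs ! j)" using cs_eq jk by metis
    also have "\<dots> = (\<Sum>i<?n. P i k * B (bs ! i) (cs ! j))"
      using jk bV cV len PK by (subst B_lincomb_left) auto
    also have "\<dots> = (\<Sum>i<?n. P i j * squares B bs ! i * P i k)"
    proof (rule sum.cong)
      fix i assume "i \<in> {..<?n}"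
      moreover have "B (bs ! i) (bs ! i) \<noteq> 0" if "i < ?n" using orth_basis_nonzero[OF bs] that by simp
      ultimately show "P i k * B (bs ! i) (cs ! j) = P i j * squares B bs ! i * P i k"
        using B_sym[OF bV cV] jk len by (simp add: P_def)
    qed auto
    finally show ?thesis using orth_basis_orth[OF cs, of k j] jk len by auto
  qed
  moreover have "0 \<notin> set (squares B cs)" using orth_basis_nonzero[OF cs] by auto
  ultimately show ?thesis unfolding isometric_over_diag_iff[OF \<open>0 \<notin> set (squares B cs)\<close>] length_map using len PK
    by (intro conjI exI[of _ P] allI impI) blast+
qed

text \<open>Take an orthogonal family of anisotropic vectors of maximal length, which exists by the
  bound \<open>N\<close>. All vectors of its complement are isotropic, so \<open>B\<close> vanishes
  there by polarisation, and nondegeneracy makes the complement zero.\<close>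

lemma orth_basis_exists:
  assumes two: "(2::'a) \<noteq> 0"
    and bound: "\<And>bs. set bs \<subseteq> V \<Longrightarrow> \<forall>i<length bs. \<forall>j<length bs. i \<noteq> j \<longrightarrow> B (bs ! i) (bs ! j) = 0 \<Longrightarrow>
      \<forall>b\<in>set bs. B b b \<noteq> 0 \<Longrightarrow> length bs \<le> N"
    and nondeg: "\<And>x. x \<in> V \<Longrightarrow> x \<noteq> 0 \<Longrightarrow> \<exists>y\<in>V. B x y \<noteq> 0"
  shows "\<exists>bs. orth_basis sc V B bs"
proof -
  define Q where "Q bs \<longleftrightarrow> set bs \<subseteq> V \<and> (\<forall>i<length bs. \<forall>j<length bs. i \<noteq> j \<longrightarrow> B (bs ! i) (bs ! j) = 0) \<and>
      (\<forall>b\<in>set bs. B b b \<noteq> 0)" for bs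
  have "Q []" by (simp add: Q_def)
  moreover have "\<forall>bs. Q bs \<longrightarrow> length bs < Suc N" using bound by (auto simp: Q_def less_Suc_eq_le)
  ultimately obtain bs where bs: "Q bs" and max: "\<And>cs. Q cs \<Longrightarrow> length cs \<le> length bs"
    using ex_has_greatest_nat[of Q "[]" length "Suc N"] by (auto simp: less_imp_le_nat)
  let ?n = "length bs"
  have bV: "bs ! i \<in> V" "B (bs ! i) (bs ! i) \<noteq> 0" if "i < ?n" for i using bs that by (auto simp: Q_def)
  define pr where "pr x = x - (\<Sum>i<?n. (B x (bs ! i) / B (bs ! i) (bs ! i)) *s bs ! i)" for x
  have cK: "B x (bs ! i) / B (bs ! i) (bs ! i) \<in> K" if "x \<in> V" "i < ?n" for x i
    using that bV subfield_divide[OF subfield_K] B_K by auto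
  have prV: "pr x \<in> V" if "x \<in> V" for x
    unfolding pr_def using that bV cK by (intro diff_V sum_V scale_V) auto
  have pr_orth: "B (pr x) (bs ! j) = 0" if x: "x \<in> V" and j: "j < ?n" for x j
  proof -
    have "B (pr x) (bs ! j) = B x (bs ! j) - (\<Sum>i<?n. B x (bs ! i) / B (bs ! i) (bs ! i) * B (bs ! i) (bs ! j))"
    proof -
      have "(\<Sum>i<?n. (B x (bs ! i) / B (bs ! i) (bs ! i)) *s bs ! i) \<in> V"
        using x bV cK by (intro sum_V scale_V) auto
      hence "B (pr x) (bs ! j) = B x (bs ! j) - B (\<Sum>i<?n. (B x (bs ! i) / B (bs ! i) (bs ! i)) *s bs ! i) (bs ! j)"
        unfolding pr_def using x j bV by (intro B_diff_left) auto
      thus ?thesis using x j bV cK by (subst (asm) B_lincomb_left) auto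
    qed
    also have "(\<Sum>i<?n. B x (bs ! i) / B (bs ! i) (bs ! i) * B (bs ! i) (bs ! j)) =
        (\<Sum>i<?n. if i = j then B x (bs ! j) else 0)"
      using bs bV j by (intro sum.cong) (auto simp: Q_def)
    finally show ?thesis using j by simp
  qed
  \<comment> \<open>A counterexample could be put in front of \<open>bs\<close>, against its maximal
    length.\<close>
  have iso: "B w w = 0" if w: "w \<in> V" "\<And>j. j < ?n \<Longrightarrow> B w (bs ! j) = 0" for w
  proof (rule ccontr)
    assume "B w w \<noteq> 0"
    have w': "B (bs ! j) w = 0" if "j < ?n" for j
      using w(2)[OF that] B_sym[OF w(1) bV(1)[OF that]] by simp
    have "Q (w # bs)" unfolding Q_def
    proof (intro conjI allI impI)
      fix i j assume "i < length (w # bs)" "j < length (w # bs)" "i \<noteq> j"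
      thus "B ((w # bs) ! i) ((w # bs) ! j) = 0"
        using bs w(2) w' by (cases i; cases j) (auto simp: Q_def)
    qed (use bs w(1) \<open>B w w \<noteq> 0\<close> in \<open>auto simp: Q_def\<close>)
    from max[OF this] show False by simp
  qed
  have "pr x = 0" if x: "x \<in> V" for x
  proof (rule ccontr)
    assume "pr x \<noteq> 0"
    then obtain y where y: "y \<in> V" "B (pr x) y \<noteq> 0" using nondeg prV[OF x] by blast
    have yeq: "pr y + (\<Sum>i<?n. (B y (bs ! i) / B (bs ! i) (bs ! i)) *s bs ! i) = y" by (simp add: pr_def)
    have "B (pr x) (pr y + (\<Sum>i<?n. (B y (bs ! i) / B (bs ! i) (bs ! i)) *s bs ! i)) = B (pr x) (pr y) + (\<Sum>i<?n. B y (bs ! i) / B (bs ! i) (bs ! i) * B (pr x) (bs ! i))"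
    proof -
      have "(\<Sum>i<?n. (B y (bs ! i) / B (bs ! i) (bs ! i)) *s bs ! i) \<in> V"
        using y bV cK by (intro sum_V scale_V) auto
      moreover have "B (pr x) (\<Sum>i<?n. (B y (bs ! i) / B (bs ! i) (bs ! i)) *s bs ! i) =
          (\<Sum>i<?n. B y (bs ! i) / B (bs ! i) (bs ! i) * B (pr x) (bs ! i))"
        using prV[OF x] y bV cK by (intro B_lincomb_right) auto
      ultimately show ?thesis using prV[OF x] prV[OF y(1)] by (simp only: B_add_right)
    qed
    also have "(\<Sum>i<?n. B y (bs ! i) / B (bs ! i) (bs ! i) * B (pr x) (bs ! i)) = 0"
      using pr_orth[OF x] by (intro sum.neutral) auto
    \<comment> \<open>Polarisation: \<open>pr x\<close>, \<open>pr y\<close> and their sum are all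
      isotropic, and 2 is invertible.\<close>
    also have "B (pr x) (pr y) = 0"
    proof -
      have "B (pr x + pr y) (pr x + pr y) = 0"
        using prV[OF x] prV[OF y(1)] pr_orth x y(1) bV by (intro iso) (auto simp: add_V B_add_left)
      moreover have "B (pr x) (pr x) = 0" "B (pr y) (pr y) = 0"
        using prV[OF x] prV[OF y(1)] pr_orth x y(1) by (auto intro!: iso)
      ultimately have "2 * B (pr x) (pr y) = 0"
        using prV[OF x] prV[OF y(1)] B_sym[of "pr x" "pr y"] by (simp add: B_add_left B_add_right add_V)
      thus ?thesis using two by simp
    qed
    finally show False using y unfolding yeq by simp
  qed
  hence "x = (\<Sum>i<?n. (B x (bs ! i) / B (bs ! i) (bs ! i)) *s bs ! i)" if "x \<in> V" for x
    using that by (simp add: pr_def)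
  thus ?thesis using bs unfolding orth_basis_def Q_def by blast
qed

end

text \<open>\<open>V\<close> is the orthogonal sum of isometric images of \<open>V1\<close> and
  \<open>V2\<close>. The coefficient of \<open>f x + g y\<close> at \<open>f b\<close> is that of
  \<open>x\<close> at \<open>b\<close>, so the two expansions add up. With a zero second summand
  this transports an orthogonal basis along an isometry.\<close>

lemma orth_basis_sum:
  assumes bil: "bilinear_space sc K V B" and bil1: "bilinear_space sc1 K V1 B1" and bil2: "bilinear_space sc2 K V2 B2"
    and bs: "orth_basis sc1 V1 B1 bs" and cs: "orth_basis sc2 V2 B2 cs"
    and f: "\<And>x. x \<in> V1 \<Longrightarrow> f x \<in> V" "\<And>x y. x \<in> V1 \<Longrightarrow> y \<in> V1 \<Longrightarrow> B (f x) (f y) = B1 x y"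
      "\<And>x y. x \<in> V1 \<Longrightarrow> y \<in> V1 \<Longrightarrow> f (x + y) = f x + f y" "\<And>c x. c \<in> K \<Longrightarrow> x \<in> V1 \<Longrightarrow> f (sc1 c x) = sc c (f x)"
    and g: "\<And>x. x \<in> V2 \<Longrightarrow> g x \<in> V" "\<And>x y. x \<in> V2 \<Longrightarrow> y \<in> V2 \<Longrightarrow> B (g x) (g y) = B2 x y"
      "\<And>x y. x \<in> V2 \<Longrightarrow> y \<in> V2 \<Longrightarrow> g (x + y) = g x + g y" "\<And>c x. c \<in> K \<Longrightarrow> x \<in> V2 \<Longrightarrow> g (sc2 c x) = sc c (g x)"
    and orth: "\<And>x y. x \<in> V1 \<Longrightarrow> y \<in> V2 \<Longrightarrow> B (f x) (g y) = 0"
    and span: "\<And>v. v \<in> V \<Longrightarrow> \<exists>x\<in>V1. \<exists>y\<in>V2. v = f x + g y"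
  shows "orth_basis sc V B (map f bs @ map g cs)"
proof -
  interpret V: bilinear_space sc K V B by fact
  interpret V1: bilinear_space sc1 K V1 B1 by fact
  interpret V2: bilinear_space sc2 K V2 B2 by fact
  have bV: "bs ! i \<in> V1" if "i < length bs" for i using that bs orth_basis_nth by blast
  have cV: "cs ! i \<in> V2" if "i < length cs" for i using that cs orth_basis_nth by blast
  have f0: "f 0 = 0" using f(4)[of 0 0] V1.zero_V V.subfield_K by (auto simp: subfield_0)
  have g0: "g 0 = 0" using g(4)[of 0 0] V2.zero_V V.subfield_K by (auto simp: subfield_0)
  have fsum: "f (sum h I) = (\<Sum>i\<in>I. f (h i))" if "\<And>i. i \<in> I \<Longrightarrow> h i \<in> V1" for h and I :: "nat set"
    using that by (induction I rule: infinite_finite_induct) (auto simp: f0 f(3) V1.sum_V)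
  have gsum: "g (sum h I) = (\<Sum>i\<in>I. g (h i))" if "\<And>i. i \<in> I \<Longrightarrow> h i \<in> V2" for h and I :: "nat set"
    using that by (induction I rule: infinite_finite_induct) (auto simp: g0 g(3) V2.sum_V)
  have orth': "B (g y) (f x) = 0" if "x \<in> V1" "y \<in> V2" for x y
    using orth[OF that] V.B_sym[of "f x" "g y"] f(1) g(1) that by simp
  let ?ds = "map f bs @ map g cs"
  show ?thesis unfolding orth_basis_def
  proof (intro conjI ballI allI impI)
    show "set ?ds \<subseteq> V" using f(1) g(1) orth_basis_set[OF bs] orth_basis_set[OF cs] by auto
    fix i j assume ij: "i < length ?ds" "j < length ?ds" "i \<noteq> j"
    show "B (?ds ! i) (?ds ! j) = 0"
      using ij orth_basis_orth[OF bs] orth_basis_orth[OF cs] f(2)[OF bV bV] g(2)[OF cV cV] orth[OF bV cV] orth'[OF bV cV]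
      by (auto simp: nth_append)
  next
    fix b assume "b \<in> set ?ds"
    thus "B b b \<noteq> 0" using f(2) g(2) orth_basis_nonzero[OF bs] orth_basis_nonzero[OF cs] orth_basis_set[OF bs] orth_basis_set[OF cs]
      by auto
  next
    fix v assume "v \<in> V"
    then obtain x y where xy: "x \<in> V1" "y \<in> V2" "v = f x + g y" using span by blast
    let ?t = "\<lambda>d. sc (B v d / B d d) d"
    have 1: "?t (f (bs ! i)) = f (sc1 (B1 x (bs ! i) / B1 (bs ! i) (bs ! i)) (bs ! i))" if "i < length bs" for i
      using that bV xy f g orth' V1.orth_basis_coeff_K[OF bs xy(1) that] by (simp add: V.B_add_left)
    have 2: "?t (g (cs ! i)) = g (sc2 (B2 y (cs ! i) / B2 (cs ! i) (cs ! i)) (cs ! i))" if "i < length cs" for i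
      using that cV xy f g orth V2.orth_basis_coeff_K[OF cs xy(2) that] by (simp add: V.B_add_left)
    have "(\<Sum>i<length ?ds. ?t (?ds ! i)) = sum_list (map ?t ?ds)"
      by (rule sum_nth_eq_sum_list)
    also have "\<dots> = sum_list (map (?t \<circ> f) bs) + sum_list (map (?t \<circ> g) cs)" by simp
    also have "sum_list (map (?t \<circ> f) bs) = (\<Sum>i<length bs. ?t (f (bs ! i)))"
      by (simp add: sum_list_sum_nth atLeast0LessThan)
    also have "\<dots> = (\<Sum>i<length bs. f (sc1 (B1 x (bs ! i) / B1 (bs ! i) (bs ! i)) (bs ! i)))"
      using 1 by (intro sum.cong) auto
    also have "\<dots> = f (\<Sum>i<length bs. sc1 (B1 x (bs ! i) / B1 (bs ! i) (bs ! i)) (bs ! i))"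
      using bV V1.orth_basis_coeff_K[OF bs xy(1)] by (subst fsum) (auto intro!: V1.scale_V)
    also have "\<dots> = f x" using orth_basis_expand[OF bs xy(1)] by simp
    also have "sum_list (map (?t \<circ> g) cs) = (\<Sum>i<length cs. ?t (g (cs ! i)))"
      by (simp add: sum_list_sum_nth atLeast0LessThan)
    also have "\<dots> = (\<Sum>i<length cs. g (sc2 (B2 y (cs ! i) / B2 (cs ! i) (cs ! i)) (cs ! i)))"
      using 2 by (intro sum.cong) auto
    also have "\<dots> = g (\<Sum>i<length cs. sc2 (B2 y (cs ! i) / B2 (cs ! i) (cs ! i)) (cs ! i))"
      using cV V2.orth_basis_coeff_K[OF cs xy(2)] by (subst gsum) (auto intro!: V2.scale_V)
    also have "\<dots> = g y" using orth_basis_expand[OF cs xy(2)] by simp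
    finally show "v = (\<Sum>i<length ?ds. ?t (?ds ! i))" using xy(3) by simp
  qed
qed

section \<open>Rational invariants of forms\<close>

text \<open>A good function is a homomorphism from the group generated by the isometry classes of forms
  to the rationals, given by its values on one-dimensional forms.\<close>
definition good :: "'a::field set \<Rightarrow> ('a \<Rightarrow> rat) \<Rightarrow> bool" where
  "good K \<phi> \<longleftrightarrow> (\<forall>xs ys. set xs \<subseteq> K - {0} \<longrightarrow> set ys \<subseteq> K - {0} \<longrightarrow>
     isometric_over K (diag xs) (diag ys) \<longrightarrow> sum_list (map \<phi> xs) = sum_list (map \<phi> ys))"

lemma goodD: "good K \<phi> \<Longrightarrow> set xs \<subseteq> K - {0} \<Longrightarrow> set ys \<subseteq> K - {0} \<Longrightarrow>
    isometric_over K (diag xs) (diag ys) \<Longrightarrow> sum_list (map \<phi> xs) = sum_list (map \<phi> ys)"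
  by (auto simp: good_def)

lemma vector_space_rat_fun: "vector_space (\<lambda>(q::rat) (f::'a \<Rightarrow> rat) x. q * f x)"
  by unfold_locales (auto simp: fun_eq_iff algebra_simps)

text \<open>A maximal independent subset of \<open>S\<close> stays independent when \<open>v\<close>
  is added, so a functional may be prescribed as 0 on it and as 1 at \<open>v\<close>.\<close>

lemma separating_functional:
  fixes v :: "'a \<Rightarrow> rat" and sc defines "sc \<equiv> (\<lambda>(q::rat) (f::'a \<Rightarrow> rat) x. q * f x)"
  assumes "v \<notin> module.span sc S"
  shows "\<exists>g. Vector_Spaces.linear sc (*) g \<and> (\<forall>u\<in>S. g u = (0::rat)) \<and> g v = 1"
proof -
  interpret vector_space sc unfolding sc_def by (rule vector_space_rat_fun)
  interpret pair: vector_space_pair sc "(*) :: rat \<Rightarrow> rat \<Rightarrow> rat"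
    by unfold_locales (auto simp: algebra_simps)
  obtain B where B: "B \<subseteq> S" "independent B" "S \<subseteq> span B" using maximal_independent_subset by blast
  have "span B = span S" using B by (metis span_mono span_span order.antisym)
  hence v: "v \<notin> span B" using assms by simp
  hence "independent (insert v B)" using B independent_insertI by blast
  from pair.linear_independent_extend[OF this, of "\<lambda>u. if u = v then 1 else 0"]
  obtain g where g: "Vector_Spaces.linear sc (*) g" "\<forall>u\<in>insert v B. g u = (if u = v then 1 else 0)" by blast
  have "v \<notin> B" using v span_base by blast
  hence "g u = 0" if "u \<in> B" for u using g that by auto
  hence "g u = 0" if "u \<in> span B" for u
    using pair.linear_eq_0_on_span[OF g(1), of B u] that by blast
  thus ?thesis using g B by auto
qed

text \<open>The formal sum of the entries, as a vector in the rational space of functions on the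
  field: the class of the diagonal form before isometries are divided out.\<close>

definition mult_of :: "'a list \<Rightarrow> 'a \<Rightarrow> rat" where
  "mult_of xs a = of_nat (count (mset xs) a)"

lemma mult_of_append: "mult_of (xs @ ys) a = mult_of xs a + mult_of ys a"
  by (simp add: mult_of_def)

definition copies :: "nat \<Rightarrow> 'a list \<Rightarrow> 'a list" where
  "copies n xs = concat (replicate n xs)"

lemma set_copies: "set (copies n xs) \<subseteq> set xs"
  by (auto simp: copies_def)

lemma mset_copies: "mset (copies n xs) = repeat_mset n (mset xs)"
  by (induction n) (auto simp: copies_def)

lemma mult_of_copies: "mult_of (copies n xs) a = of_nat n * mult_of xs a"
  by (simp add: mult_of_def mset_copies)

lemma isometric_over_append:
  assumes "subfield K" "isometric_over K (diag xs) (diag ys)" "isometric_over K (diag xs') (diag ys')"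
  shows "isometric_over K (diag (xs @ xs')) (diag (ys @ ys'))"
  using isometric_over_osum[OF assms(1) diag_carrier diag_carrier assms(2,3)] by (simp add: osum_diag)

lemma isometric_over_copies:
  assumes "subfield K" "isometric_over K (diag xs) (diag ys)"
  shows "isometric_over K (diag (copies n xs)) (diag (copies n ys))"
  by (induction n) (auto simp: copies_def intro!: isometric_over_append assms isometric_over_refl[OF _ diag_carrier])

definition diag_isometric :: "'a::field set \<Rightarrow> 'a list \<Rightarrow> 'a list \<Rightarrow> bool" where
  "diag_isometric K xs ys \<longleftrightarrow> set xs \<subseteq> K - {0} \<and> set ys \<subseteq> K - {0} \<and> isometric_over K (diag xs) (diag ys)"

lemma diag_isometric_refl: "subfield K \<Longrightarrow> set xs \<subseteq> K - {0} \<Longrightarrow> diag_isometric K xs xs"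
  by (simp add: diag_isometric_def isometric_over_refl[OF _ diag_carrier])

lemma diag_isometric_sym:
  assumes K: "subfield K" and iso: "diag_isometric K xs ys"
  shows "diag_isometric K ys xs"
proof -
  have "elements_mat (diag xs) \<subseteq> K"
    unfolding elements_mat_subset_iff[OF diag_carrier] using iso K nth_mem[of _ xs]
    by (auto simp: diag_isometric_def subfield_0 subset_iff)
  thus ?thesis using iso isometric_over_diag_sym[OF K diag_carrier] by (auto simp: diag_isometric_def)
qed

lemma diag_isometric_append:
  "subfield K \<Longrightarrow> diag_isometric K xs ys \<Longrightarrow> diag_isometric K xs' ys' \<Longrightarrow> diag_isometric K (xs @ xs') (ys @ ys')"
  by (auto simp: diag_isometric_def isometric_over_append)

lemma diag_isometric_copies:
  "subfield K \<Longrightarrow> diag_isometric K xs ys \<Longrightarrow> diag_isometric K (copies n xs) (copies n ys)"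
  using set_copies[of n xs] set_copies[of n ys] by (auto simp: diag_isometric_def isometric_over_copies)

text \<open>Clearing denominators turns a rational combination of relations into a single isometry:
  addition becomes orthogonal sum, a positive multiple becomes repetition, and a negative
  coefficient exchanges the two sides.\<close>

lemma span_isometries:
  fixes sc defines "sc \<equiv> (\<lambda>(q::rat) (f::'a::field \<Rightarrow> rat) x. q * f x)"
  assumes K: "subfield K"
    and v: "v \<in> module.span sc {\<lambda>a. mult_of xs a - mult_of ys a |xs ys. diag_isometric K xs ys}"
  shows "\<exists>N>0. \<exists>xs ys. diag_isometric K xs ys \<and> (\<forall>a. of_nat N * v a = mult_of xs a - mult_of ys a)"
proof -
  interpret vector_space sc unfolding sc_def by (rule vector_space_rat_fun)
  show ?thesis using v
  proof (induction rule: span_induct_alt)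
    case base
    show ?case by (rule exI[of _ 1]) (auto intro!: exI[of _ "[]"] diag_isometric_refl K)
  next
    case (step c u w)
    then obtain N xs ys where 1: "N > 0" "diag_isometric K xs ys" "\<And>a. of_nat N * w a = mult_of xs a - mult_of ys a"
      by blast
    obtain xs' ys' where 2: "diag_isometric K xs' ys'" "u = (\<lambda>a. mult_of xs' a - mult_of ys' a)"
      using step by blast
    obtain p q where pq: "c = of_int p / of_int q" "q > 0" by (cases "quotient_of c") (blast dest: quotient_of_div quotient_of_denom_pos)
    define us ws where "us = (if p \<ge> 0 then xs' else ys')" "ws = (if p \<ge> 0 then ys' else xs')"
    have 3: "diag_isometric K us ws" using 2 diag_isometric_sym[OF K] by (auto simp: us_ws_def)
    have u: "of_int p * u a = of_nat (nat \<bar>p\<bar>) * (mult_of us a - mult_of ws a)" for a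
      by (auto simp: 2 us_ws_def algebra_simps)
    \<comment> \<open>With w over the denominator N and the new coefficient p / q, the common
      denominator is N q. The old isometry is therefore repeated q times and the new one N |p|
      times.\<close>
    let ?X = "copies (nat q) xs @ copies (N * nat \<bar>p\<bar>) us" and ?Y = "copies (nat q) ys @ copies (N * nat \<bar>p\<bar>) ws"
    have "diag_isometric K ?X ?Y" using 1 3 K by (intro diag_isometric_append diag_isometric_copies)
    moreover have "of_nat (N * nat q) * (sc c u + w) a = mult_of ?X a - mult_of ?Y a" for a
    proof -
      have "of_nat (N * nat q) * (sc c u + w) a = of_nat (nat q) * (of_nat N * w a) + of_nat N * (of_int p * u a)"
        using pq by (simp add: sc_def field_simps)
      also have "\<dots> = mult_of ?X a - mult_of ?Y a"
        unfolding u 1(3) by (simp add: mult_of_append mult_of_copies algebra_simps)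
      finally show ?thesis .
    qed
    ultimately show ?case using pq(2) 1(1) by (intro exI[of _ "N * nat q"] conjI exI[of _ ?X] exI[of _ ?Y]) auto
  qed
qed

text \<open>Besides the isometry it records that both sides have entries in \<open>K\<close>, so
  that \<open>isometric_over_diag_sym\<close> can reverse it.\<close>

definition diagonalizes :: "'a::field set \<Rightarrow> 'a mat \<Rightarrow> 'a list \<Rightarrow> bool" where
  "diagonalizes K A xs \<longleftrightarrow> A \<in> carrier_mat (length xs) (length xs) \<and> elements_mat A \<subseteq> K \<and>
     set xs \<subseteq> K - {0} \<and> isometric_over K A (diag xs)"

lemma diagonalizesI:
  assumes "A \<in> carrier_mat n n" "elements_mat A \<subseteq> K" "set xs \<subseteq> K - {0}" "isometric_over K A (diag xs)"
  shows "diagonalizes K A xs"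
  using carrier_matD(1)[OF isometric_over_dim[OF assms(4,1)]] assms by (simp add: diagonalizes_def)

lemma diagonalizes_diag:
  assumes K: "subfield K" and xs: "set xs \<subseteq> K - {0}"
  shows "diagonalizes K (diag xs) xs"
proof (rule diagonalizesI[OF diag_carrier])
  show "elements_mat (diag xs) \<subseteq> K"
    unfolding elements_mat_subset_iff[OF diag_carrier] using xs K nth_mem[of _ xs]
    by (auto simp: subfield_0 subset_iff)
qed (use K xs isometric_over_refl[OF K diag_carrier] in auto)

lemma diagonalizes_osum:
  assumes "subfield K" "diagonalizes K A xs" "diagonalizes K B ys"
  shows "diagonalizes K (osum A B) (xs @ ys)"
proof (rule diagonalizesI)
  show "osum A B \<in> carrier_mat (length xs + length ys) (length xs + length ys)"
    using assms by (intro osum_carrier) (auto simp: diagonalizes_def)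
  show "elements_mat (osum A B) \<subseteq> K"
    using assms by (intro elements_mat_osum[of K A "length xs" B "length ys"]) (auto simp: diagonalizes_def)
  show "isometric_over K (osum A B) (diag (xs @ ys))"
    unfolding osum_diag[symmetric] using assms
    by (intro isometric_over_osum[of K A "length xs" B "length ys"]) (auto simp: diagonalizes_def)
qed (use assms in \<open>auto simp: diagonalizes_def\<close>)

lemma diagonalizes_osum_list:
  "subfield K \<Longrightarrow> (\<And>i. i \<in> set is \<Longrightarrow> diagonalizes K (A i) (xs i)) \<Longrightarrow>
    diagonalizes K (osum_list (map A is)) (concat (map xs is))"
proof (induction "is")
  case Nil
  thus ?case using diagonalizes_diag[of K "[]"] by (simp add: osum_list_def diag_Nil)
next
  case (Cons i "is")
  thus ?case using diagonalizes_osum[of K "A i" "xs i" "osum_list (map A is)" "concat (map xs is)"]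
    by (simp add: osum_list_def)
qed

lemma diagonalizes_isometric_iff:
  assumes K: "subfield K" and A: "diagonalizes K A xs" and B: "diagonalizes K B ys"
  shows "isometric_over K A B \<longleftrightarrow> isometric_over K (diag xs) (diag ys)"
proof -
  have A': "A \<in> carrier_mat (length xs) (length xs)" "isometric_over K A (diag xs)" "isometric_over K (diag xs) A"
    using A isometric_over_diag_sym[OF K] by (auto simp: diagonalizes_def)
  have B': "B \<in> carrier_mat (length ys) (length ys)" "isometric_over K B (diag ys)" "isometric_over K (diag ys) B"
    using B isometric_over_diag_sym[OF K] by (auto simp: diagonalizes_def)
  note t = isometric_over_trans[OF K]
  show ?thesis
    using t[OF diag_carrier A'(3) t[OF A'(1) _ B'(2)]] t[OF A'(1) A'(2) t[OF diag_carrier _ B'(3)]] by blast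
qed

text \<open>A difference of forms outside the rational span of the isometry relations is detected by a linear
  functional, whose values on one-dimensional forms are a good function.\<close>
lemma good_separates:
  fixes K :: "'a::field set"
  assumes K: "subfield K" and xs: "set xs \<subseteq> K - {0}" and ys: "set ys \<subseteq> K - {0}"
    and eq: "\<And>\<phi>. good K \<phi> \<Longrightarrow> sum_list (map \<phi> xs) = sum_list (map \<phi> ys)"
  shows "\<exists>N>0. \<exists>zs. set zs \<subseteq> K - {0} \<and> isometric_over K (diag (copies N xs @ zs)) (diag (copies N ys @ zs))"
proof -
  define sc where "sc = (\<lambda>(q::rat) (f::'a \<Rightarrow> rat) x. q * f x)"
  define v where "v a = mult_of xs a - mult_of ys a" for a
  let ?S = "{\<lambda>a. mult_of xs a - mult_of ys a |xs ys. diag_isometric K xs ys}"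
  have "v \<in> module.span sc ?S"
  proof (rule ccontr)
    assume "v \<notin> module.span sc ?S"
    from separating_functional[OF this[unfolded sc_def]] obtain g where
      g: "Vector_Spaces.linear sc (*) g" "\<And>u. u \<in> ?S \<Longrightarrow> g u = (0::rat)" "g v = 1"
      unfolding sc_def by blast
    interpret g: Vector_Spaces.linear sc "(*)" g by (rule g)
    \<comment> \<open>The value of the functional on the formal sum with the single term
      \<open>a\<close>; additivity then recovers \<open>g\<close> on every
      \<open>mult_of us\<close>.\<close>
    define \<phi> where "\<phi> a = g (\<lambda>b. if b = a then 1 else 0)" for a
    have gm: "g (mult_of us) = sum_list (map \<phi> us)" for us
    proof (induction us)
      case Nil
      have "mult_of [] = (0 :: 'a \<Rightarrow> rat)" by (auto simp: mult_of_def)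
      thus ?case by (metis g.zero list.map(1) sum_list.Nil)
    next
      case (Cons u us)
      have "mult_of (u # us) = (\<lambda>b. if b = u then 1 else 0) + mult_of us" by (auto simp: mult_of_def)
      hence "g (mult_of (u # us)) = \<phi> u + g (mult_of us)" by (simp only: g.add \<phi>_def)
      thus ?case using Cons by simp
    qed
    have gd: "g (\<lambda>a. mult_of us a - mult_of ws a) = sum_list (map \<phi> us) - sum_list (map \<phi> ws)" for us ws
    proof -
      have "(\<lambda>a. mult_of us a - mult_of ws a) = mult_of us - mult_of ws" by auto
      thus ?thesis by (simp add: g.diff gm)
    qed
    have "good K \<phi>" unfolding good_def
    proof (intro allI impI)
      fix us ws assume "set us \<subseteq> K - {0}" "set ws \<subseteq> K - {0}" "isometric_over K (diag us) (diag ws)"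
      hence "(\<lambda>a. mult_of us a - mult_of ws a) \<in> ?S" by (auto simp: diag_isometric_def)
      from g(2)[OF this] show "sum_list (map \<phi> us) = sum_list (map \<phi> ws)" by (simp add: gd)
    qed
    from eq[OF this] have "g (\<lambda>a. mult_of xs a - mult_of ys a) = 0" by (simp add: gd)
    moreover have "v = (\<lambda>a. mult_of xs a - mult_of ys a)" by (auto simp: v_def)
    ultimately show False using g(3) by simp
  qed
  from span_isometries[OF K this[unfolded sc_def]] obtain N us ws where
    N: "N > 0" and iso: "diag_isometric K us ws" and eqv: "\<And>a. of_nat N * v a = mult_of us a - mult_of ws a"
    by blast
  \<comment> \<open>The span gives N (xs - ys) = us - ws as formal sums, which is an equality of
    multisets once the negative terms are moved across. The isometry of \<open>us\<close> and
    \<open>ws\<close> then makes the added forms on both sides equal.\<close>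
  have m: "mset (copies N xs @ ws) = mset (copies N ys @ us)"
  proof (rule multiset_eqI)
    fix a
    have "mult_of (copies N xs @ ws) a = mult_of (copies N ys @ us) a"
      using eqv[of a] by (simp add: v_def mult_of_append mult_of_copies algebra_simps)
    thus "count (mset (copies N xs @ ws)) a = count (mset (copies N ys @ us)) a"
      unfolding mult_of_def by (simp only: of_nat_eq_iff)
  qed
  have sets: "set us \<subseteq> K - {0}" "set ws \<subseteq> K - {0}" using iso by (auto simp: diag_isometric_def)
  have sets': "set (copies N ys) \<subseteq> K - {0}" using ys set_copies by fast
  have "isometric_over K (diag (copies N xs @ ws)) (diag (copies N ys @ us))"
    by (rule isometric_over_diag_perm[OF K m]) (use sets sets' in auto)
  moreover have "isometric_over K (diag (copies N ys @ us)) (diag (copies N ys @ ws))"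
    using diag_isometric_append[OF K diag_isometric_refl[OF K sets'] iso] by (simp add: diag_isometric_def)
  ultimately have "isometric_over K (diag (copies N xs @ ws)) (diag (copies N ys @ ws))"
    by (rule isometric_over_trans[OF K diag_carrier])
  thus ?thesis using N sets by blast
qed

section \<open>Traces and trace forms\<close>

text \<open>Filling up to a square matrix with a zero row \<open>n\<close> makes the determinant
  vanish, so there is a nonzero vector in the kernel.\<close>

lemma kernel_nontrivial:
  fixes A :: "nat \<Rightarrow> nat \<Rightarrow> 'a::field"
  assumes "n < m"
  shows "\<exists>c. (\<exists>j<m. c j \<noteq> 0) \<and> (\<forall>i<n. (\<Sum>j<m. A i j * c j) = 0)"
proof -
  define M where "M = mat\<^sub>r m m (\<lambda>i. if i = n then 0\<^sub>v m else vec m (A i))"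
  have M: "M \<in> carrier_mat m m" by (simp add: M_def)
  have "det M = 0" unfolding M_def by (rule det_row_0) (use assms in auto)
  then obtain v where v: "v \<in> carrier_vec m" "v \<noteq> 0\<^sub>v m" "M *\<^sub>v v = 0\<^sub>v m"
    using det_0_iff_vec_prod_zero_field[OF M] by blast
  have "\<exists>j<m. v $ j \<noteq> 0" using v(1,2) by (auto simp: vec_eq_iff)
  moreover have "(\<Sum>j<m. A i j * v $ j) = 0" if "i < n" for i
  proof -
    have "(M *\<^sub>v v) $ i = (\<Sum>j<m. A i j * v $ j)"
      using that assms v(1) by (auto simp: M_def scalar_prod_def lessThan_atLeast0 intro!: sum.cong)
    thus ?thesis using v(3) that assms by simp
  qed
  ultimately show ?thesis by (intro exI[of _ "\<lambda>j. v $ j"]) auto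
qed

text \<open>The relation at \<open>x * y\<close> minus \<open>h y\<close> times the relation at
  \<open>x\<close> loses the term of \<open>h\<close> and has coefficients
  \<open>c g * (g y - h y)\<close> on the smaller set. Only values on \<open>F\<close> enter, so the
  result covers restrictions of automorphisms to an intermediate field.\<close>

lemma dedekind_independence:
  fixes S :: "('a::field \<Rightarrow> 'a) set"
  assumes "finite S" and F: "1 \<in> F" "\<And>x y. x \<in> F \<Longrightarrow> y \<in> F \<Longrightarrow> x * y \<in> F"
    and mult: "\<And>g. g \<in> S \<Longrightarrow> g 1 = 1" "\<And>g x y. g \<in> S \<Longrightarrow> x \<in> F \<Longrightarrow> y \<in> F \<Longrightarrow> g (x * y) = g x * g y"
    and dist: "\<And>g h. g \<in> S \<Longrightarrow> h \<in> S \<Longrightarrow> g \<noteq> h \<Longrightarrow> \<exists>x\<in>F. g x \<noteq> h x"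
    and zero: "\<And>x. x \<in> F \<Longrightarrow> (\<Sum>g\<in>S. c g * g x) = 0"
  shows "\<forall>g\<in>S. c g = 0"
  using assms(1) mult dist zero
proof (induction S arbitrary: c rule: finite_induct)
  case (insert h S)
  have S: "c g = 0" if g: "g \<in> S" for g
  proof -
    have *: "c g * (g y - h y) = 0" if y: "y \<in> F" for y
    proof (rule insert.IH[where c = "\<lambda>g. c g * (g y - h y)", THEN bspec])
      fix x assume x: "x \<in> F"
      have "0 = (\<Sum>g\<in>insert h S. c g * g (x * y)) - h y * (\<Sum>g\<in>insert h S. c g * g x)"
        using insert.prems(4)[OF x] insert.prems(4)[OF F(2)[OF x y]] by (simp only: mult_zero_right diff_zero)
      also have "\<dots> = (\<Sum>g\<in>insert h S. c g * (g y - h y) * g x)"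
        unfolding sum_distrib_left sum_subtractf[symmetric]
        using insert.prems(2) x y by (intro sum.cong) (auto simp: algebra_simps)
      also have "\<dots> = (\<Sum>g\<in>S. c g * (g y - h y) * g x)" using insert.hyps by simp
      finally show "(\<Sum>g\<in>S. c g * (g y - h y) * g x) = 0" by simp
    qed (use insert.prems g in auto)
    have "g \<noteq> h" using g insert.hyps by blast
    then obtain y where "y \<in> F" "g y \<noteq> h y" using insert.prems(3)[of g h] g by blast
    thus ?thesis using *[of y] by simp
  qed
  have "(\<Sum>g\<in>S. c g * g 1) = 0" using S by (intro sum.neutral ballI) (simp only: mult_zero_left)
  hence "c h * h 1 = 0" using insert.prems(4)[OF F(1)] by (simp only: sum.insert[OF insert.hyps(1,2)] add_0_right)
  hence "c h = 0" using insert.prems(1)[of h] by simp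
  with S show ?case by blast
qed blast

section \<open>Automorphisms and sums over groups of automorphisms\<close>

lemma field_aut_simps:
  assumes "field_aut \<sigma>"
  shows "\<sigma> 0 = 0" "\<sigma> 1 = 1" "\<sigma> (x + y) = \<sigma> x + \<sigma> y" "\<sigma> (x * y) = \<sigma> x * \<sigma> y" "\<sigma> (- x) = - \<sigma> x"
    "\<sigma> (x - y) = \<sigma> x - \<sigma> y" "\<sigma> (inverse x) = inverse (\<sigma> x)" "\<sigma> (x / y) = \<sigma> x / \<sigma> y" "\<sigma> (x ^ n) = \<sigma> x ^ n"
    "\<sigma> (of_nat n) = of_nat n" "\<sigma> (sum f I) = (\<Sum>i\<in>I. \<sigma> (f i))" "\<sigma> x = 0 \<longleftrightarrow> x = 0"
proof -
  show add: "\<sigma> (x + y) = \<sigma> x + \<sigma> y" for x y using assms by (auto simp: field_aut_def)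
  show mult: "\<sigma> (x * y) = \<sigma> x * \<sigma> y" for x y using assms by (auto simp: field_aut_def)
  show one: "\<sigma> 1 = 1" using assms by (auto simp: field_aut_def)
  show zero: "\<sigma> 0 = 0" using add[of 0 0] by (simp only: add_0_right add_cancel_right_right)
  have inj: "inj \<sigma>" using assms by (auto simp: field_aut_def bij_def)
  show nz: "\<sigma> x = 0 \<longleftrightarrow> x = 0" for x using inj zero by (metis injD)
  show minus: "\<sigma> (- x) = - \<sigma> x" for x using add[of x "- x"] zero by (simp add: eq_neg_iff_add_eq_0 add.commute)
  show "\<sigma> (x - y) = \<sigma> x - \<sigma> y" using add[of x "- y"] minus by simp
  show inv: "\<sigma> (inverse x) = inverse (\<sigma> x)" for x
  proof (cases "x = 0")
    case False
    hence "\<sigma> x * \<sigma> (inverse x) = 1" using mult[of x "inverse x"] one by simp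
    thus ?thesis by (metis inverse_unique)
  qed (simp add: zero)
  show "\<sigma> (x / y) = \<sigma> x / \<sigma> y" using mult[of x "inverse y"] inv[of y] by (simp add: divide_inverse)
  show "\<sigma> (x ^ n) = \<sigma> x ^ n" by (induction n) (auto simp: one mult)
  show "\<sigma> (of_nat n) = of_nat n" by (induction n) (auto simp: zero one add)
  show "\<sigma> (sum f I) = (\<Sum>i\<in>I. \<sigma> (f i))"
    by (induction I rule: infinite_finite_induct) (auto simp: zero add)
qed

lemma field_aut_comp: "field_aut \<sigma> \<Longrightarrow> field_aut \<tau> \<Longrightarrow> field_aut (\<sigma> \<circ> \<tau>)"
  by (auto simp: field_aut_def bij_comp)

lemma field_aut_inv:
  assumes "field_aut \<sigma>"
  shows "field_aut (inv_into UNIV \<sigma>)"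
proof -
  have b: "bij \<sigma>" using assms by (auto simp: field_aut_def)
  have 1: "\<sigma> (inv_into UNIV \<sigma> x) = x" "inv_into UNIV \<sigma> (\<sigma> x) = x" for x using b by (auto simp: bij_def surj_f_inv_f)
  show ?thesis unfolding field_aut_def
  proof (intro conjI allI)
    show "inv_into UNIV \<sigma> 1 = 1" using 1(2)[of 1] by (simp add: field_aut_simps[OF assms])
    fix x y
    show "inv_into UNIV \<sigma> (x + y) = inv_into UNIV \<sigma> x + inv_into UNIV \<sigma> y"
      using 1(2)[of "inv_into UNIV \<sigma> x + inv_into UNIV \<sigma> y"] by (simp only: field_aut_simps(3)[OF assms] 1(1))
    show "inv_into UNIV \<sigma> (x * y) = inv_into UNIV \<sigma> x * inv_into UNIV \<sigma> y"
      using 1(2)[of "inv_into UNIV \<sigma> x * inv_into UNIV \<sigma> y"] by (simp only: field_aut_simps(4)[OF assms] 1(1))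
  qed (rule bij_imp_bij_inv[OF b])
qed

lemma Gal_field_aut: "\<sigma> \<in> Gal K \<Longrightarrow> field_aut \<sigma>"
  and Gal_fix: "\<sigma> \<in> Gal K \<Longrightarrow> x \<in> K \<Longrightarrow> \<sigma> x = x"
  by (auto simp: Gal_def)

lemma subgroup_Gal: "subgroup_of (Gal K) (Gal K)"
proof -
  have "inv_into UNIV \<sigma> \<in> Gal K" if "\<sigma> \<in> Gal K" for \<sigma>
  proof -
    have "inv_into UNIV \<sigma> x = x" if "x \<in> K" for x
      using that Gal_fix[OF \<open>\<sigma> \<in> Gal K\<close>] Gal_field_aut[OF \<open>\<sigma> \<in> Gal K\<close>] by (metis field_aut_def bij_def inv_f_f)
    thus ?thesis using that field_aut_inv by (auto simp: Gal_def)
  qed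
  moreover have "id \<in> Gal K" by (auto simp: Gal_def field_aut_def)
  ultimately show ?thesis by (auto simp: subgroup_of_def Gal_def field_aut_comp)
qed

lemma subgroup_trivial: "subgroup_of {id} (Gal K)"
  using subgroup_Gal[of K] by (auto simp: subgroup_of_def)

definition tr :: "('a::field \<Rightarrow> 'a) set \<Rightarrow> 'a \<Rightarrow> 'a" where
  "tr H x = (\<Sum>g\<in>H. g x)"

text \<open>The trace form scaled by \<open>c\<close>. Scaling by an integer corrects the
  normalisation of the trace, and scaling by an element of an intermediate field gives the transfer
  of a one-dimensional form.\<close>

definition trf :: "('a::field \<Rightarrow> 'a) set \<Rightarrow> 'a \<Rightarrow> 'a \<Rightarrow> 'a \<Rightarrow> 'a" where
  "trf H c x y = tr H (c * x * y)"

lemma subfield_fixed: "(\<And>\<sigma>. \<sigma> \<in> H \<Longrightarrow> field_aut \<sigma>) \<Longrightarrow> subfield (fixed_field H)"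
  by (auto simp: subfield_def fixed_field_def field_aut_simps)

section \<open>Bases over a subfield, the trace and Gram matrices\<close>

lemma basis_over_chosen:
  assumes "basis_over K F n e"
  shows "basis_over K F (chosen_dim K F) (chosen_basis K F)"
  using someI[of "\<lambda>nb. basis_over K F (fst nb) (snd nb)" "(n, e)"] assms
  by (simp add: chosen_dim_def chosen_basis_def)

lemma basis_over_unique:
  assumes K: "subfield K" and b: "basis_over K F n b" and cd: "\<And>i. i < n \<Longrightarrow> c i \<in> K" "\<And>i. i < n \<Longrightarrow> d i \<in> K"
    and eq: "(\<Sum>i<n. c i * b i) = (\<Sum>i<n. d i * b i)" and i: "i < n"
  shows "c i = d i"
proof -
  have A: "(\<forall>i<n. c i - d i \<in> K) \<and> (\<Sum>i<n. (c i - d i) * b i) = 0"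
    using cd K eq by (simp add: subfield_diff left_diff_distrib sum_subtractf)
  have "\<forall>c. (\<forall>i<n. c i \<in> K) \<and> (\<Sum>i<n. c i * b i) = 0 \<longrightarrow> (\<forall>i<n. c i = 0)"
    using b unfolding basis_over_def lin_indep_over_def by (elim conjE)
  from mp[OF spec[OF this] A] have "\<forall>i<n. c i - d i = 0" .
  hence "c i - d i = 0" using i by blast
  thus ?thesis by simp
qed

lemma basis_over_coords:
  assumes "basis_over K F n b" "x \<in> F"
  obtains c where "\<And>i. i < n \<Longrightarrow> c i \<in> K" "x = (\<Sum>i<n. c i * b i)"
  using assms by (auto simp: basis_over_def span_over_def)

lemma basis_over_matrix:
  assumes "basis_over K F n b" "\<And>j. j < m \<Longrightarrow> f j \<in> F"
  obtains C where "\<And>i j. i < n \<Longrightarrow> j < m \<Longrightarrow> C i j \<in> K" "\<And>j. j < m \<Longrightarrow> f j = (\<Sum>i<n. C i j * b i)"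
proof -
  have "\<exists>c. (\<forall>i<n. c i \<in> K) \<and> f j = (\<Sum>i<n. c i * b i)" if "j < m" for j
    using basis_over_coords[OF assms(1) assms(2)[OF that]] by metis
  hence "\<forall>j. \<exists>c. j < m \<longrightarrow> (\<forall>i<n. c i \<in> K) \<and> f j = (\<Sum>i<n. c i * b i)" by blast
  then obtain c where "\<And>j. j < m \<Longrightarrow> (\<forall>i<n. c j i \<in> K) \<and> f j = (\<Sum>i<n. c j i * b i)" by metis
  thus thesis using that[of "\<lambda>i j. c j i"] by blast
qed

lemma sum_sum_mult_left:
  fixes p :: "nat \<Rightarrow> 'a::comm_ring_1"
  shows "(\<Sum>i<n. p i * (\<Sum>l<m. q i l * r l)) = (\<Sum>i<n. \<Sum>l<m. p i * q i l * r l)"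
    "(\<Sum>i<n. p i * (\<Sum>l<m. r l * q i l)) = (\<Sum>i<n. \<Sum>l<m. p i * q i l * r l)"
  by (simp_all add: sum_distrib_left mult_ac)

lemma sum_sum_mult_swap:
  fixes r :: "nat \<Rightarrow> 'a::comm_ring_1"
  shows "(\<Sum>i<n. r i * (\<Sum>j<m. q j i * p j)) = (\<Sum>j<m. (\<Sum>i<n. q j i * r i) * p j)"
  unfolding sum_distrib_left sum_distrib_right by (subst sum.swap) (simp add: mult_ac)

text \<open>Removes the arbitrary choices from \<open>trace_over\<close>. With base changes
  \<open>P\<close> and \<open>Q\<close> inverse to each other and CP = PD, one has tr C = tr (CPQ) =
  tr (PDQ) = tr (DQP) = tr D. Everything is written with sums since \<open>P\<close> and
  \<open>Q\<close> are rectangular until n = m is known.\<close>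

lemma trace_over_eq:
  assumes K: "subfield K" and b: "basis_over K F n b"
    and x: "\<And>y. y \<in> F \<Longrightarrow> x * y \<in> F"
    and C: "\<And>i j. i < n \<Longrightarrow> j < n \<Longrightarrow> C i j \<in> K" "\<And>j. j < n \<Longrightarrow> x * b j = (\<Sum>i<n. C i j * b i)"
  shows "trace_over K F x = (\<Sum>i<n. C i i)"
proof -
  define m where "m = chosen_dim K F"
  define e where "e = chosen_basis K F"
  have e: "basis_over K F m e" using basis_over_chosen[OF b] by (simp add: m_def e_def)
  let ?P = "\<lambda>D. (\<forall>i<m. \<forall>j<m. D i j \<in> K) \<and> (\<forall>j<m. x * e j = (\<Sum>i<m. D i j * e i))"
  have "\<exists>D. ?P D"
    using basis_over_matrix[OF e, of m "\<lambda>j. x * e j"] x e by (metis basis_over_def)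
  hence "?P (SOME D. ?P D)" by (rule someI_ex)
  then obtain D where D: "\<And>i j. i < m \<Longrightarrow> j < m \<Longrightarrow> D i j \<in> K" "\<And>j. j < m \<Longrightarrow> x * e j = (\<Sum>i<m. D i j * e i)"
    and tr: "trace_over K F x = (\<Sum>i<m. D i i)"
    unfolding trace_over_def Let_def m_def[symmetric] e_def[symmetric] by blast
  obtain P where P: "\<And>i j. i < n \<Longrightarrow> j < m \<Longrightarrow> P i j \<in> K" "\<And>j. j < m \<Longrightarrow> e j = (\<Sum>i<n. P i j * b i)"
    using basis_over_matrix[OF b, of m e] e by (metis basis_over_def)
  obtain Q where Q: "\<And>i j. i < m \<Longrightarrow> j < n \<Longrightarrow> Q i j \<in> K" "\<And>j. j < n \<Longrightarrow> b j = (\<Sum>i<m. Q i j * e i)"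
    using basis_over_matrix[OF e, of n b] b by (metis basis_over_def)
  have PQ: "(\<Sum>k<m. P i k * Q k j) = (if i = j then 1 else 0)" if ij: "i < n" "j < n" for i j
  proof (rule basis_over_unique[OF K b, where c = "\<lambda>i. \<Sum>k<m. P i k * Q k j" and d = "\<lambda>i. if i = j then 1 else 0"])
    have "b j = (\<Sum>k<m. Q k j * (\<Sum>i<n. P i k * b i))" using Q(2)[OF ij(2)] P(2) by simp
    also have "\<dots> = (\<Sum>i<n. (\<Sum>k<m. P i k * Q k j) * b i)"
      unfolding sum_distrib_left sum_distrib_right by (subst sum.swap) (simp add: mult_ac)
    finally show "(\<Sum>i<n. (\<Sum>k<m. P i k * Q k j) * b i) = (\<Sum>i<n. (if i = j then 1 else 0) * b i)"
      using ij by (simp add: if_distrib[of "\<lambda>c. c * _"] cong: if_cong)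
  qed (use ij P Q K in \<open>auto intro!: subfield_sum subfield_mult simp: subfield_0 subfield_1\<close>)
  have CPD: "(\<Sum>k<n. C i k * P k j) = (\<Sum>k<m. P i k * D k j)" if ij: "i < n" "j < m" for i j
  proof (rule basis_over_unique[OF K b, where c = "\<lambda>i. \<Sum>k<n. C i k * P k j" and d = "\<lambda>i. \<Sum>k<m. P i k * D k j"])
    have "(\<Sum>i<n. (\<Sum>k<n. C i k * P k j) * b i) = (\<Sum>k<n. P k j * (\<Sum>i<n. C i k * b i))"
      unfolding sum_distrib_left sum_distrib_right by (subst sum.swap) (simp add: mult_ac)
    also have "\<dots> = (\<Sum>k<n. P k j * (x * b k))" using C(2) by simp
    also have "\<dots> = x * (\<Sum>k<n. P k j * b k)" by (simp add: sum_distrib_left mult_ac)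
    also have "\<dots> = (\<Sum>k<m. D k j * e k)" by (simp only: P(2)[OF ij(2), symmetric] D(2)[OF ij(2)])
    also have "\<dots> = (\<Sum>k<m. D k j * (\<Sum>i<n. P i k * b i))" using P(2) by simp
    also have "\<dots> = (\<Sum>i<n. (\<Sum>k<m. P i k * D k j) * b i)"
      unfolding sum_distrib_left sum_distrib_right by (subst sum.swap) (simp add: mult_ac)
    finally show "(\<Sum>i<n. (\<Sum>k<n. C i k * P k j) * b i) = (\<Sum>i<n. (\<Sum>k<m. P i k * D k j) * b i)" .
  qed (use ij P C D K in \<open>auto intro!: subfield_sum subfield_mult\<close>)
  have QP: "(\<Sum>k<n. Q i k * P k j) = (if i = j then 1 else 0)" if ij: "i < m" "j < m" for i j
  proof (rule basis_over_unique[OF K e, where c = "\<lambda>i. \<Sum>k<n. Q i k * P k j" and d = "\<lambda>i. if i = j then 1 else 0"])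
    have "e j = (\<Sum>k<n. P k j * (\<Sum>i<m. Q i k * e i))" using P(2)[OF ij(2)] Q(2) by simp
    also have "\<dots> = (\<Sum>i<m. (\<Sum>k<n. Q i k * P k j) * e i)"
      unfolding sum_distrib_left sum_distrib_right by (subst sum.swap) (simp add: mult_ac)
    finally show "(\<Sum>i<m. (\<Sum>k<n. Q i k * P k j) * e i) = (\<Sum>i<m. (if i = j then 1 else 0) * e i)"
      using ij by (simp add: if_distrib[of "\<lambda>c. c * _"] cong: if_cong)
  qed (use ij P Q K in \<open>auto intro!: subfield_sum subfield_mult simp: subfield_0 subfield_1\<close>)
  have "(\<Sum>j<n. C j j) = (\<Sum>j<n. \<Sum>k<n. C j k * (\<Sum>i<m. P k i * Q i j))"
    using PQ by (intro sum.cong) (auto simp: if_distrib[of "\<lambda>c. _ * c"] cong: if_cong)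
  also have "\<dots> = (\<Sum>j<n. \<Sum>i<m. (\<Sum>k<n. C j k * P k i) * Q i j)"
    unfolding sum_distrib_left sum_distrib_right by (rule sum.cong[OF refl], subst sum.swap) (simp add: mult_ac)
  also have "\<dots> = (\<Sum>j<n. \<Sum>i<m. (\<Sum>k<m. P j k * D k i) * Q i j)" using CPD by simp
  also have "\<dots> = (\<Sum>i<m. \<Sum>k<m. D k i * (\<Sum>j<n. Q i j * P j k))"
    unfolding sum_distrib_left sum_distrib_right
    by (subst sum.swap, rule sum.cong[OF refl], subst sum.swap) (simp add: mult_ac)
  also have "\<dots> = (\<Sum>i<m. D i i)"
    using QP by (intro sum.cong) (auto simp: if_distrib[of "\<lambda>c. _ * c"] cong: if_cong)
  finally show ?thesis using tr by simp
qed

lemma orth_basis_basis_over: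
  assumes bil: "bilinear_space (*) K F B" and bs: "orth_basis (*) F B bs"
  shows "basis_over K F (length bs) (\<lambda>i. bs ! i)"
proof -
  interpret bilinear_space "(*)" K F B by fact
  have "c j = 0" if c: "\<forall>i<length bs. c i \<in> K" "(\<Sum>i<length bs. c i * bs ! i) = 0" and j: "j < length bs" for c j
  proof -
    have "0 = B (\<Sum>i<length bs. c i * bs ! i) (bs ! j)" using c j orth_basis_nth[OF bs] by (simp add: B_zero_left)
    also have "\<dots> = (\<Sum>i<length bs. c i * B (bs ! i) (bs ! j))"
      using c j orth_basis_nth[OF bs] by (intro B_lincomb_left) auto
    also have "\<dots> = (\<Sum>i<length bs. if i = j then c j * B (bs ! j) (bs ! j) else 0)"
      using orth_basis_orth[OF bs] j by (intro sum.cong) auto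
    finally show ?thesis using j orth_basis_nonzero[OF bs, of "bs ! j"] by simp
  qed
  moreover have "span_over K (length bs) (\<lambda>i. bs ! i) = F"
  proof
    show "span_over K (length bs) (\<lambda>i. bs ! i) \<subseteq> F"
      using orth_basis_nth[OF bs] by (auto simp: span_over_def intro!: sum_V scale_V)
    show "F \<subseteq> span_over K (length bs) (\<lambda>i. bs ! i)"
      using orth_basis_gen(2)[OF bs] by (fastforce simp: span_over_def)
  qed
  ultimately show ?thesis
    using orth_basis_nth[OF bs] by (auto simp: basis_over_def lin_indep_over_def)
qed

lemma trace_over_orth_basis:
  assumes bil: "bilinear_space (*) K F B" and bs: "orth_basis (*) F B bs"
    and x: "\<And>y. y \<in> F \<Longrightarrow> x * y \<in> F"
  shows "trace_over K F x = (\<Sum>i<length bs. B (x * bs ! i) (bs ! i) / B (bs ! i) (bs ! i))"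
proof -
  interpret bilinear_space "(*)" K F B by fact
  show ?thesis
    by (rule trace_over_eq[OF subfield_K orth_basis_basis_over[OF bil bs] x,
          where C = "\<lambda>i j. B (x * bs ! j) (bs ! i) / B (bs ! i) (bs ! i)"])
       (use orth_basis_expand[OF bs] x orth_basis_nth[OF bs] orth_basis_coeff_K[OF bs] in auto)
qed

text \<open>Connects the Gram matrix in an unspecified basis, as in \<open>trace_form\<close>, with
  an orthogonal basis. The lengths agree by two uses of \<open>inner_dim_ge\<close>: the invertible
  diagonal Gram matrix of \<open>bs\<close> factors through \<open>n\<close>, and the identity
  matrix of size \<open>n\<close> factors through \<open>length bs\<close>.\<close>

lemma gram_isometric:
  assumes bil: "bilinear_space (*) K F B" and bs: "orth_basis (*) F B bs" and b: "basis_over K F n b"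
  shows "isometric_over K (mat n n (\<lambda>(i, j). B (b i) (b j))) (diag (squares B bs))"
proof -
  interpret bilinear_space "(*)" K F B by fact
  have bF: "b i \<in> F" if "i < n" for i using b that by (auto simp: basis_over_def)
  note e = orth_basis_basis_over[OF bil bs]
  obtain P where P: "\<And>i j. i < n \<Longrightarrow> j < length bs \<Longrightarrow> P i j \<in> K"
      "\<And>j. j < length bs \<Longrightarrow> bs ! j = (\<Sum>i<n. P i j * b i)"
    using basis_over_matrix[OF b, of "length bs" "\<lambda>j. bs ! j"] orth_basis_nth[OF bs] by metis
  obtain Q where Q: "\<And>i j. i < length bs \<Longrightarrow> j < n \<Longrightarrow> Q i j \<in> K"
      "\<And>j. j < n \<Longrightarrow> b j = (\<Sum>i<length bs. Q i j * bs ! i)"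
    using basis_over_matrix[OF e, of n b] bF by metis
  have gram: "(\<Sum>i<n. \<Sum>l<n. P i j * B (b i) (b l) * P l k) = B (bs ! j) (bs ! k)"
    if "j < length bs" "k < length bs" for j k
  proof -
    have "B (bs ! j) (bs ! k) = B (\<Sum>i<n. P i j * b i) (bs ! k)" using P that by metis
    also have "\<dots> = (\<Sum>i<n. P i j * B (b i) (bs ! k))"
      using that P bF orth_basis_nth[OF bs] by (intro B_lincomb_left) auto
    also have "\<dots> = (\<Sum>i<n. P i j * B (b i) (\<Sum>l<n. P l k * b l))" using P that by metis
    also have "\<dots> = (\<Sum>i<n. P i j * (\<Sum>l<n. P l k * B (b i) (b l)))"
      using that P bF by (intro sum.cong refl arg_cong2[of _ _ _ _ "(*)"] B_lincomb_right) auto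
    finally show ?thesis by (simp only: sum_sum_mult_left)
  qed
  have "length bs \<le> n"
  proof (rule inner_dim_ge)
    fix j k assume jk: "j < length bs" "k < length bs"
    have "(\<Sum>i<n. P i j * (\<Sum>l<n. B (b i) (b l) * P l k)) = B (bs ! j) (bs ! k)"
      using gram[OF jk] by (simp only: sum_sum_mult_left)
    thus "(\<Sum>i<n. P i j * (\<Sum>l<n. B (b i) (b l) * P l k)) = (if j = k then B (bs ! j) (bs ! j) else 0)"
      using orth_basis_orth[OF bs] jk by auto
  qed (use orth_basis_nonzero[OF bs] in auto)
  moreover have "n \<le> length bs"
  proof (rule inner_dim_ge)
    fix j k assume jk: "j < n" "k < n"
    show "(\<Sum>i<length bs. P j i * Q i k) = (if j = k then 1 else 0)"
    proof (rule basis_over_unique[OF subfield_K b, where c = "\<lambda>j. \<Sum>i<length bs. P j i * Q i k" and d = "\<lambda>j. if j = k then 1 else 0"])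
      have "b k = (\<Sum>i<length bs. Q i k * (\<Sum>j<n. P j i * b j))" using Q(2)[OF jk(2)] P(2) by simp
      also have "\<dots> = (\<Sum>j<n. (\<Sum>i<length bs. P j i * Q i k) * b j)" by (rule sum_sum_mult_swap)
      finally show "(\<Sum>j<n. (\<Sum>i<length bs. P j i * Q i k) * b j) = (\<Sum>j<n. (if j = k then 1 else 0) * b j)"
        using jk by (simp add: if_distrib[of "\<lambda>c. c * _"] cong: if_cong)
    qed (use jk P Q subfield_K in \<open>auto intro!: subfield_sum subfield_mult simp: subfield_0 subfield_1\<close>)
  qed simp
  ultimately have len: "length bs = n" by simp
  show ?thesis
  proof (rule isometric_overI)
    show "diag (squares B bs) \<in> carrier_mat n n" using len diag_carrier[of "squares B bs"] by simp
    show "det (diag (squares B bs)) \<noteq> 0"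
      using orth_basis_nonzero[OF bs] by (intro det_diag_nonzero) auto
    fix j k assume jk: "j < n" "k < n"
    have "(\<Sum>i<n. \<Sum>l<n. P i j * mat n n (\<lambda>(i, j). B (b i) (b j)) $$ (i, l) * P l k) = B (bs ! j) (bs ! k)"
      using gram[of j k] jk len by simp
    thus "(\<Sum>i<n. \<Sum>l<n. P i j * mat n n (\<lambda>(i, j). B (b i) (b j)) $$ (i, l) * P l k) = diag (squares B bs) $$ (j, k)"
      using orth_basis_orth[OF bs, of j k] jk len by auto
  qed (use P len in auto)
qed

section \<open>Sums over the Galois group and trace forms of a Galois extension\<close>

locale galois_extension =
  fixes K :: "'a::field set"
  assumes two: "(2::'a) \<noteq> 0" and galois: "finite_galois K"
begin

abbreviation "G \<equiv> Gal K"

lemma K: "subfield K"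
  using galois by (simp add: finite_galois_def)

lemma fixed_G: "fixed_field G = K"
  using galois by (simp add: finite_galois_def)

lemma subgroup_subset: "subgroup_of H G \<Longrightarrow> \<sigma> \<in> H \<Longrightarrow> \<sigma> \<in> G"
  by (auto simp: subgroup_of_def)

lemma subgroup_aut: "subgroup_of H G \<Longrightarrow> \<sigma> \<in> H \<Longrightarrow> field_aut \<sigma>"
  using subgroup_subset Gal_field_aut by blast

lemmas aut = field_aut_simps[OF subgroup_aut]

lemma fixed_subfield: "subgroup_of H G \<Longrightarrow> subfield (fixed_field H)"
  using subfield_fixed subgroup_aut by blast

lemma K_fixed: "subgroup_of H G \<Longrightarrow> K \<subseteq> fixed_field H"
  using Gal_fix subgroup_subset by (fastforce simp: fixed_field_def)

lemma UNIV_basis: "\<exists>n e. basis_over K UNIV n e"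
  using galois by (simp add: finite_galois_def finite_dim_over_def)

text \<open>More automorphisms than basis elements admit a nontrivial linear relation on the basis.
  It extends to the whole field, because automorphisms fix the coefficients in \<open>K\<close>, and
  so contradicts Dedekind independence.\<close>

lemma finite_G: "finite G"
proof -
  obtain n e where e: "basis_over K UNIV n e" using UNIV_basis by blast
  have "card S \<le> n" if S: "finite S" "S \<subseteq> G" for S
  proof (rule ccontr)
    assume "\<not> card S \<le> n"
    hence "n < card S" by simp
    obtain f where f: "bij_betw f {..<card S} S" using ex_bij_betw_nat_finite[OF S(1)] by (auto simp: lessThan_atLeast0)
    obtain c where c: "\<exists>j<card S. c j \<noteq> 0" "\<And>i. i < n \<Longrightarrow> (\<Sum>j<card S. f j (e i) * c j) = 0"
      using kernel_nontrivial[OF \<open>n < card S\<close>, of "\<lambda>i j. f j (e i)"] by blast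
    have fG: "f j \<in> G" if "j < card S" for j using f S(2) that by (auto simp: bij_betw_def)
    define d where "d g = c (inv_into {..<card S} f g)" for g
    have d: "d (f j) = c j" if "j < card S" for j
      using f that by (simp add: d_def bij_betw_def inv_into_f_f)
    have zero: "(\<Sum>g\<in>S. d g * g x) = 0" for x
    proof -
      obtain a where a: "\<And>i. i < n \<Longrightarrow> a i \<in> K" "x = (\<Sum>i<n. a i * e i)"
        using basis_over_coords[OF e] by blast
      have "(\<Sum>g\<in>S. d g * g x) = (\<Sum>j<card S. d (f j) * f j x)"
        by (rule sum.reindex_bij_betw[OF f, symmetric])
      also have "\<dots> = (\<Sum>j<card S. c j * (\<Sum>i<n. a i * f j (e i)))"
      proof (rule sum.cong[OF refl])
        fix j assume "j \<in> {..<card S}"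
        hence j: "j < card S" by simp
        have "f j x = (\<Sum>i<n. a i * f j (e i))"
          unfolding a(2) using a(1) Gal_fix[OF fG[OF j]]
          by (simp add: field_aut_simps[OF Gal_field_aut[OF fG[OF j]]])
        thus "d (f j) * f j x = c j * (\<Sum>i<n. a i * f j (e i))" using d[OF j] by simp
      qed
      also have "\<dots> = (\<Sum>i<n. a i * (\<Sum>j<card S. f j (e i) * c j))"
        unfolding sum_distrib_left by (subst sum.swap) (simp add: mult_ac)
      also have "\<dots> = 0" using c(2) by simp
      finally show ?thesis .
    qed
    have "d g = 0" if g: "g \<in> S" for g
    proof (rule dedekind_independence[where S = S and F = UNIV and c = d, THEN bspec])
      fix g x y assume "g \<in> S"
      hence "field_aut g" using S(2) Gal_field_aut by blast
      thus "g 1 = 1" "g (x * y) = g x * g y" by (simp_all add: field_aut_simps)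
    qed (use S g zero in auto)
    hence "c j = 0" if "j < card S" for j
      using d[OF that] f that by (metis bij_betwE lessThan_iff)
    thus False using c(1) by blast
  qed
  thus ?thesis using finite_if_finite_subsets_card_bdd by metis
qed

lemma finite_subgroup: "subgroup_of H G \<Longrightarrow> finite H"
  using finite_G finite_subset by (auto simp: subgroup_of_def)

lemma subgroup_comp_bij:
  assumes H: "subgroup_of H G" and h: "h \<in> H"
  shows "bij_betw (\<lambda>g. h \<circ> g) H H"
proof -
  have "bij h" using subgroup_aut[OF H h] by (simp add: field_aut_def)
  hence "inj_on (\<lambda>g. h \<circ> g) H" by (auto simp: inj_on_def bij_def fun_eq_iff dest: injD)
  moreover have "(\<lambda>g. h \<circ> g) ` H \<subseteq> H" using H h by (auto simp: subgroup_of_def)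
  ultimately show ?thesis using endo_inj_surj[OF finite_subgroup[OF H]] by (auto simp: bij_betw_def)
qed

lemma subgroup_comp_bij_right:
  assumes H: "subgroup_of H G" and h: "h \<in> H"
  shows "bij_betw (\<lambda>g. g \<circ> h) H H"
proof -
  have "surj h" using subgroup_aut[OF H h] by (simp add: field_aut_def bij_def)
  hence "inj_on (\<lambda>g. g \<circ> h) H"
    by (intro inj_onI) (metis comp_apply ext surj_f_inv_f)
  moreover have "(\<lambda>g. g \<circ> h) ` H \<subseteq> H" using H h by (auto simp: subgroup_of_def)
  ultimately show ?thesis using endo_inj_surj[OF finite_subgroup[OF H]] by (auto simp: bij_betw_def)
qed

lemma tr_add: "subgroup_of H G \<Longrightarrow> tr H (x + y) = tr H x + tr H y"
  unfolding tr_def sum.distrib[symmetric] by (rule sum.cong) (auto simp: aut)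

lemma tr_diff: "subgroup_of H G \<Longrightarrow> tr H (x - y) = tr H x - tr H y"
  unfolding tr_def sum_subtractf[symmetric] by (rule sum.cong) (auto simp: aut)

lemma tr_scale: "subgroup_of H G \<Longrightarrow> c \<in> fixed_field H \<Longrightarrow> tr H (c * x) = c * tr H x"
  unfolding tr_def sum_distrib_left by (rule sum.cong) (auto simp: aut fixed_field_def)

lemma tr_fixed: "x \<in> fixed_field H \<Longrightarrow> tr H x = of_nat (card H) * x"
  unfolding tr_def fixed_field_def by (subst sum.cong[OF refl, of H _ "\<lambda>_. x"]) auto

lemma tr_zero: "subgroup_of H G \<Longrightarrow> tr H 0 = 0"
  unfolding tr_def by (rule sum.neutral) (auto simp: aut)

lemma tr_sum: "subgroup_of H G \<Longrightarrow> tr H (sum f I) = (\<Sum>i\<in>I. tr H (f i))"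
  by (induction I rule: infinite_finite_induct) (auto simp: tr_zero tr_add)

lemma tr_mem: 
  assumes H: "subgroup_of H G"
  shows "tr H x \<in> fixed_field H"
  unfolding fixed_field_def
proof (intro CollectI ballI)
  fix h assume h: "h \<in> H"
  have "h (tr H x) = (\<Sum>g\<in>H. (h \<circ> g) x)" by (simp add: tr_def aut[OF H h])
  also have "\<dots> = (\<Sum>g\<in>H. g x)" by (rule sum.reindex_bij_betw[OF subgroup_comp_bij[OF H h]])
  finally show "h (tr H x) = tr H x" by (simp add: tr_def)
qed

lemma tr_aut:
  assumes H: "subgroup_of H G" and h: "h \<in> H"
  shows "tr H (h x) = tr H x"
  using sum.reindex_bij_betw[OF subgroup_comp_bij_right[OF H h], of "\<lambda>g. g x"] by (simp add: tr_def)

text \<open>Takes the place of transitivity of the trace. No cosets are chosen, at the price of the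
  factor \<open>card H\<close>, which later disappears as a positive integer.\<close>

lemma tr_tr:
  assumes H: "subgroup_of H G"
  shows "tr G (tr H x) = of_nat (card H) * tr G x"
proof -
  have "tr G (tr H x) = (\<Sum>h\<in>H. tr G (h x))"
    unfolding tr_def[of H] by (rule tr_sum[OF subgroup_Gal])
  also have "\<dots> = (\<Sum>h\<in>H. tr G x)"
    using tr_aut[OF subgroup_Gal] subgroup_subset[OF H] by (intro sum.cong) auto
  finally show ?thesis by simp
qed

text \<open>Dedekind independence with all coefficients 1. In contrast to \<open>tr H 1\<close>,
  which is the order of \<open>H\<close>, this also helps when the characteristic divides that
  order.\<close>

lemma tr_nonzero:
  assumes H: "subgroup_of H G"
  shows "\<exists>x. tr H x \<noteq> 0"
proof (rule ccontr)
  assume "\<not> ?thesis"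
  hence "(\<Sum>g\<in>H. 1 * g x) = 0" for x by (simp add: tr_def)
  moreover have "id \<in> H" using H by (simp add: subgroup_of_def)
  ultimately have "(1::'a) = 0"
    by (intro dedekind_independence[where S = H and F = UNIV and c = "\<lambda>_. 1", THEN bspec[where x = id]])
       (auto simp: finite_subgroup[OF H] aut[OF H])
  thus False by simp
qed

definition invariant_module :: "'a set \<Rightarrow> 'a set \<Rightarrow> bool" where
  "invariant_module F V \<longleftrightarrow> 0 \<in> V \<and> (\<forall>x\<in>V. \<forall>y\<in>V. x + y \<in> V) \<and> (\<forall>c\<in>F. \<forall>x\<in>V. c * x \<in> V)"

lemma invariant_module_subfield: "subfield F' \<Longrightarrow> F \<subseteq> F' \<Longrightarrow> invariant_module F F'"
  by (auto simp: invariant_module_def subfield_closed)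

lemma bilinear_trf:
  assumes H: "subgroup_of H G" and V: "invariant_module (fixed_field H) V"
  shows "bilinear_space (*) (fixed_field H) V (trf H c)"
proof unfold_locales
  fix d x y assume "d \<in> fixed_field H"
  thus "trf H c (d * x) y = d * trf H c x y"
    using tr_scale[OF H, of d "c * x * y"] by (simp add: trf_def mult_ac)
qed (use fixed_subfield[OF H] V tr_mem[OF H] tr_add[OF H] in
      \<open>auto simp: trf_def invariant_module_def algebra_simps\<close>)

text \<open>A basis of the big field over \<open>K\<close> also generates it over the larger field
  \<open>fixed_field H\<close>. This bounds orthogonal families in the big field, and with them
  those in \<open>V\<close>.\<close>

lemma trf_orth_exists:
  assumes H: "subgroup_of H G" and V: "invariant_module (fixed_field H) V"
    and nondeg: "\<And>x. x \<in> V \<Longrightarrow> x \<noteq> 0 \<Longrightarrow> \<exists>y\<in>V. trf H c x y \<noteq> 0"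
  shows "\<exists>bs. orth_basis (*) V (trf H c) bs"
proof -
  interpret U: bilinear_space "(*)" "fixed_field H" UNIV "trf H c"
    by (rule bilinear_trf[OF H]) (simp add: invariant_module_def)
  interpret bilinear_space "(*)" "fixed_field H" V "trf H c" by (rule bilinear_trf[OF H V])
  obtain n e where e: "basis_over K UNIV n e" using UNIV_basis by blast
  have gen: "\<exists>d. (\<forall>i<n. d i \<in> fixed_field H) \<and> x = (\<Sum>i<n. d i * e i)" for x
    using basis_over_coords[OF e, of x] K_fixed[OF H] by (metis UNIV_I subsetD)
  show ?thesis
  proof (rule orth_basis_exists[OF two, where N = n])
    fix bs assume bs: "set bs \<subseteq> V" "\<forall>i<length bs. \<forall>j<length bs. i \<noteq> j \<longrightarrow> trf H c (bs ! i) (bs ! j) = 0"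
      "\<forall>b\<in>set bs. trf H c b b \<noteq> 0"
    show "length bs \<le> n"
      by (rule U.orth_length_le[where e = e]) (use gen bs in auto)
  qed (rule nondeg)
qed

definition stab :: "'a set \<Rightarrow> ('a \<Rightarrow> 'a) set" where
  "stab F = {g \<in> G. \<forall>x\<in>F. g x = x}"

text \<open>Dedekind independence of the distinct restrictions to F, applied to the expansion of y in an orthogonal
  basis, gives |stab F| v = 1 for v = \<Sum> b^2 / tr (b^2). This avoids the degree formula and the Galois
  correspondence; only positivity of the integer |stab F| matters later.\<close>
lemma trace_over_tr:
  assumes F: "subfield F" "K \<subseteq> F" and bs: "orth_basis (*) F (trf G 1) bs" and x: "x \<in> F"
  shows "of_nat (card (stab F)) * trace_over K F x = tr G x"
proof -
  have bil: "bilinear_space (*) K F (trf G 1)"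
    using bilinear_trf[OF subgroup_Gal, of F] invariant_module_subfield F by (simp add: fixed_G)
  let ?n = "length bs"
  define \<delta> where "\<delta> i = tr G (bs ! i * bs ! i)" for i
  have \<delta>0: "\<delta> i \<noteq> 0" if "i < ?n" for i
    using orth_basis_nonzero[OF bs, of "bs ! i"] that by (simp add: \<delta>_def trf_def)
  have \<delta>K: "\<delta> i \<in> K" for i using tr_mem[OF subgroup_Gal] by (simp add: \<delta>_def fixed_G)
  note bF = orth_basis_nth[OF bs]
  \<comment> \<open>Restriction to \<open>F\<close>, set to 0 outside, so that automorphisms with
    the same restriction give equal functions and can be collected.\<close>
  define r where "r g = (\<lambda>x. if x \<in> F then g x else 0)" for g :: "'a \<Rightarrow> 'a"
  define u where "u g = (\<Sum>i<?n. g (bs ! i) * bs ! i / \<delta> i)" for g :: "'a \<Rightarrow> 'a"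
  define N where "N k = card {g \<in> G. r g = k}" for k
  define c where "c k = of_nat (N k) * u k - (if k = r id then 1 else 0)" for k
  have idG: "id \<in> G" using subgroup_Gal[of K] by (simp add: subgroup_of_def)
  have fin: "finite (r ` G)" using finite_G by simp
  have expand: "y = (\<Sum>g\<in>G. g y * u g)" if y: "y \<in> F" for y
  proof -
    have "y = (\<Sum>i<?n. tr G (y * bs ! i) / \<delta> i * bs ! i)"
      using orth_basis_expand[OF bs y] by (simp add: trf_def \<delta>_def)
    also have "\<dots> = (\<Sum>i<?n. \<Sum>g\<in>G. g y * (g (bs ! i) * bs ! i / \<delta> i))"
      by (rule sum.cong[OF refl])
         (simp add: tr_def sum_distrib_right sum_divide_distrib aut[OF subgroup_Gal] mult.assoc cong: sum.cong)
    also have "\<dots> = (\<Sum>g\<in>G. g y * u g)"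
      unfolding u_def sum_distrib_left by (rule sum.swap)
    finally show ?thesis .
  qed
  \<comment> \<open>The expansion of y, grouped by restrictions, and the trivial identity y = id y
    are two combinations of distinct restrictions. Comparing the coefficients at the identity gives
    \<open>N (r id) * u (r id) = 1\<close>.\<close>
  have "c (r id) = 0"
  proof (rule dedekind_independence[where S = "r ` G" and F = F and c = c, THEN bspec])
    fix y assume y: "y \<in> F"
    have "(\<Sum>g\<in>G. g y * u g) = (\<Sum>k\<in>r ` G. \<Sum>g\<in>{g \<in> G. r g = k}. g y * u g)"
      by (rule sum.image_gen[OF finite_G])
    also have "\<dots> = (\<Sum>k\<in>r ` G. of_nat (N k) * u k * k y)"
    proof (rule sum.cong[OF refl])
      fix k assume "k \<in> r ` G"
      have "g y * u g = k y * u k" if "r g = k" for g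
      proof -
        have "g z = k z" if "z \<in> F" for z using \<open>r g = k\<close> that by (auto simp: r_def)
        thus ?thesis using y bF by (simp add: u_def)
      qed
      thus "(\<Sum>g\<in>{g \<in> G. r g = k}. g y * u g) = of_nat (N k) * u k * k y"
        by (simp add: N_def mult_ac)
    qed
    finally have "(\<Sum>k\<in>r ` G. of_nat (N k) * u k * k y) = y" using expand[OF y] by simp
    moreover have "(\<Sum>k\<in>r ` G. (if k = r id then 1 else 0) * k y) = y"
    proof -
      have "(\<Sum>k\<in>r ` G. (if k = r id then 1 else 0) * k y) = (\<Sum>k\<in>r ` G. if k = r id then r id y else 0)"
        by (rule sum.cong) auto
      also have "\<dots> = r id y" using fin idG by simp
      finally show ?thesis using y by (simp add: r_def)
    qed
    ultimately show "(\<Sum>k\<in>r ` G. c k * k y) = 0"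
      unfolding c_def left_diff_distrib sum_subtractf by simp
  next
    fix g assume "g \<in> r ` G"
    then obtain h where h: "h \<in> G" "g = r h" by blast
    show "g 1 = 1" using h F(1) by (simp add: r_def subfield_1 aut[OF subgroup_Gal])
    fix x y assume "x \<in> F" "y \<in> F"
    thus "g (x * y) = g x * g y" using h F(1) by (simp add: r_def subfield_mult aut[OF subgroup_Gal])
  next
    fix g h assume "g \<in> r ` G" "h \<in> r ` G" "g \<noteq> h"
    thus "\<exists>x\<in>F. g x \<noteq> h x" by (auto simp: r_def fun_eq_iff split: if_splits)
  qed (use F idG fin in \<open>auto intro: subfield_1 subfield_mult\<close>)
  moreover have "{g \<in> G. r g = r id} = stab F"
    by (auto simp: stab_def r_def fun_eq_iff)
  moreover define v where "v = (\<Sum>i<?n. bs ! i * bs ! i / \<delta> i)"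
  moreover have "u (r id) = v" using bF by (simp add: u_def v_def r_def)
  ultimately have mv: "of_nat (card (stab F)) * v = 1" by (simp add: c_def N_def)
  have "trace_over K F x = (\<Sum>i<?n. tr G (x * bs ! i * bs ! i) / \<delta> i)"
    using trace_over_orth_basis[OF bil bs, of x] x F(1) by (simp add: subfield_mult trf_def \<delta>_def)
  also have "\<dots> = (\<Sum>i<?n. \<Sum>g\<in>G. g x * (g (bs ! i * bs ! i) / \<delta> i))"
    by (rule sum.cong[OF refl])
       (simp add: tr_def sum_distrib_right sum_divide_distrib aut[OF subgroup_Gal] mult.assoc cong: sum.cong)
  also have "\<dots> = (\<Sum>g\<in>G. g x * (\<Sum>i<?n. g (bs ! i * bs ! i) / \<delta> i))"
    unfolding sum_distrib_left by (rule sum.swap)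
  also have "\<dots> = (\<Sum>g\<in>G. g x * g v)"
  proof (rule sum.cong[OF refl])
    fix g assume g: "g \<in> G"
    show "g x * (\<Sum>i<?n. g (bs ! i * bs ! i) / \<delta> i) = g x * g v"
      by (simp add: v_def aut[OF subgroup_Gal g] Gal_fix[OF g \<delta>K])
  qed
  finally have "of_nat (card (stab F)) * trace_over K F x = (\<Sum>g\<in>G. g x * (of_nat (card (stab F)) * g v))"
    by (simp add: sum_distrib_left mult_ac)
  also have "\<dots> = (\<Sum>g\<in>G. g x)"
  proof (rule sum.cong[OF refl])
    fix g assume g: "g \<in> G"
    have "of_nat (card (stab F)) * g v = g (of_nat (card (stab F)) * v)" by (simp add: aut[OF subgroup_Gal g])
    thus "g x * (of_nat (card (stab F)) * g v) = g x" using mv by (simp add: aut[OF subgroup_Gal g])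
  qed
  finally show ?thesis by (simp add: tr_def)
qed

text \<open>If it were zero, \<open>tr G\<close> would vanish on \<open>F\<close>, in particular on
  the squares of the basis vectors. Hence division by this integer is legitimate whenever an
  orthogonal basis exists.\<close>

lemma card_stab_nonzero:
  assumes "subfield F" "K \<subseteq> F" "orth_basis (*) F (trf G 1) bs"
  shows "(of_nat (card (stab F)) :: 'a) \<noteq> 0"
proof
  assume "(of_nat (card (stab F)) :: 'a) = 0"
  hence tr: "tr G x = 0" if "x \<in> F" for x using trace_over_tr[OF assms that] by simp
  have "bs = []"
  proof (rule ccontr)
    assume "bs \<noteq> []"
    then obtain b where b: "b \<in> set bs" by (meson last_in_set)
    have "b * b \<in> F" using orth_basis_set[OF assms(3) b] assms(1) by (simp add: subfield_mult)
    thus False using orth_basis_nonzero[OF assms(3) b] tr by (simp add: trf_def)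
  qed
  thus False using orth_basis_expand[OF assms(3) subfield_1[OF assms(1)]] by simp
qed

lemma orth_basis_rescale:
  assumes c: "c \<in> K" "c \<noteq> 0" and F: "subfield F" "K \<subseteq> F" and bs: "orth_basis (*) F (trf G 1) bs"
  shows "orth_basis (*) F (trf G c) bs"
proof -
  have "trf G c x y = c * trf G 1 x y" for x y
    using tr_scale[OF subgroup_Gal, of c "x * y"] c by (simp add: trf_def fixed_G mult_ac)
  thus ?thesis using bs c unfolding orth_basis_def by simp
qed

text \<open>By \<open>trace_over_tr\<close> the trace of \<open>F\<close> over \<open>K\<close> is
  \<open>tr G\<close> divided by \<open>card (stab F)\<close>; this is the origin of
  \<open>c\<close>.\<close>

lemma trace_form_isometric:
  assumes F: "subfield F" "K \<subseteq> F" and bs: "orth_basis (*) F (trf G 1) bs"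
  defines "c \<equiv> 1 / of_nat (card (stab F))"
  shows "diagonalizes K (trace_form K F) (squares (trf G c) bs)"
proof -
  have m: "(of_nat (card (stab F)) :: 'a) \<noteq> 0" using card_stab_nonzero F bs .
  have c: "c \<in> K" "c \<noteq> 0" using m K by (auto simp: c_def subfield_closed)
  have bil: "bilinear_space (*) K F (trf G c)"
    using bilinear_trf[OF subgroup_Gal, of F] invariant_module_subfield F by (simp add: fixed_G)
  have bil1: "bilinear_space (*) K F (trf G 1)"
    using bilinear_trf[OF subgroup_Gal, of F] invariant_module_subfield F by (simp add: fixed_G)
  note e = basis_over_chosen[OF orth_basis_basis_over[OF bil1 bs]]
  have "trf G c x y = trace_over K F (x * y)" if "x \<in> F" "y \<in> F" for x y
  proof -
    have "trf G c x y = c * tr G (x * y)"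
      using tr_scale[OF subgroup_Gal, of c "x * y"] c by (simp add: trf_def fixed_G mult.assoc)
    also have "tr G (x * y) = of_nat (card (stab F)) * trace_over K F (x * y)"
      using trace_over_tr[OF F bs, of "x * y"] that F(1) by (simp add: subfield_mult)
    finally show ?thesis using m by (simp add: c_def)
  qed
  hence T: "trace_form K F = mat (chosen_dim K F) (chosen_dim K F) (\<lambda>(i, j). trf G c (chosen_basis K F i) (chosen_basis K F j))"
    unfolding trace_form_def Let_def using e by (intro eq_matI) (auto simp: basis_over_def)
  have "trf G c x y \<in> K" for x y using tr_mem[OF subgroup_Gal] by (simp add: trf_def fixed_G)
  moreover have "set (squares (trf G c) bs) \<subseteq> K - {0}"
    by (rule bilinear_space.orth_basis_squares[OF bil orth_basis_rescale[OF c F bs]])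
  ultimately show ?thesis
    using gram_isometric[OF bil orth_basis_rescale[OF c F bs] e] unfolding T
    by (intro diagonalizesI[of _ "chosen_dim K F"]) (auto simp: elements_mat_subset_iff[of _ "chosen_dim K F" "chosen_dim K F"])
qed

text \<open>Treated with multiplication as the form: on \<open>K\<close> the form
  \<open>trf G 1\<close> is |G| times multiplication and vanishes when the characteristic divides
  |G|.\<close>

lemma trace_form_base: "diagonalizes K (trace_form K K) [1]"
proof -
  have bil: "bilinear_space (*) K K (*)"
    by unfold_locales (use K in \<open>auto simp: subfield_closed algebra_simps\<close>)
  have bs: "orth_basis (*) K (*) [1]" using K by (auto simp: orth_basis_def subfield_1)
  note e = basis_over_chosen[OF orth_basis_basis_over[OF bil bs]]
  have "trace_over K K x = x" if "x \<in> K" for x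
    using trace_over_orth_basis[OF bil bs, of x] that K by (simp add: subfield_mult)
  hence T: "trace_form K K = mat (chosen_dim K K) (chosen_dim K K) (\<lambda>(i, j). chosen_basis K K i * chosen_basis K K j)"
    unfolding trace_form_def Let_def using e K by (intro eq_matI) (auto simp: basis_over_def subfield_mult)
  have "chosen_basis K K i * chosen_basis K K j \<in> K" if "i < chosen_dim K K" "j < chosen_dim K K" for i j
    using e that K by (auto simp: basis_over_def subfield_mult)
  thus ?thesis
    using gram_isometric[OF bil bs e] K unfolding T
    by (intro diagonalizesI[of _ "chosen_dim K K"])
       (auto simp: elements_mat_subset_iff[of _ "chosen_dim K K" "chosen_dim K K"] subfield_1)
qed

lemma stab_UNIV: "card (stab UNIV) = 1"
proof -
  have "stab UNIV = {id}"
    using subgroup_Gal[of K] by (auto simp: stab_def subgroup_of_def fun_eq_iff)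
  thus ?thesis by simp
qed

end

section \<open>Transfer along intermediate fields\<close>

text \<open>The relations generating Witt's chain equivalence; they suffice to absorb sums of squares.\<close>
definition binary_good :: "'a::field set \<Rightarrow> ('a \<Rightarrow> rat) \<Rightarrow> bool" where
  "binary_good F \<psi> \<longleftrightarrow> (\<forall>c\<in>F - {0}. \<forall>x\<in>F - {0}. \<psi> (c * x\<^sup>2) = \<psi> c) \<and>
     (\<forall>a\<in>F - {0}. \<forall>b\<in>F - {0}. a + b \<noteq> 0 \<longrightarrow> \<psi> a + \<psi> b = \<psi> (a + b) + \<psi> (a * b * (a + b)))"

text \<open>For t = x^2 + s the binary relation at c x^2 and c s reduces to 2 \<psi>(c) = 2 \<psi>(c
  t), and 2 cancels in the rationals. A vanishing partial sum s is treated separately, since the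
  relation speaks of nonzero entries; \<open>c\<close> varies because the induction hypothesis is
  also used at \<open>c * t\<close>.\<close>

lemma binary_good_squares:
  assumes F: "subfield F" and \<psi>: "binary_good F \<psi>"
  shows "set xs \<subseteq> F \<Longrightarrow> sum_list (map (\<lambda>x. x\<^sup>2) xs) \<noteq> 0 \<Longrightarrow> c \<in> F - {0} \<Longrightarrow>
    \<psi> (c * sum_list (map (\<lambda>x. x\<^sup>2) xs)) = \<psi> c"
proof (induction xs arbitrary: c)
  case (Cons x xs)
  define s where "s = sum_list (map (\<lambda>x. x\<^sup>2) xs)"
  have sq: "\<psi> (c * x\<^sup>2) = \<psi> c" if "c \<in> F - {0}" "x \<in> F - {0}" for c x
    using \<psi> that unfolding binary_good_def by blast
  have bin: "\<psi> a + \<psi> b = \<psi> (a + b) + \<psi> (a * b * (a + b))" if "a \<in> F - {0}" "b \<in> F - {0}" "a + b \<noteq> 0" for a b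
    using \<psi> that unfolding binary_good_def by blast
  have sF: "s \<in> F" using Cons.prems(1) F unfolding s_def
    by (induction xs) (auto simp: subfield_closed)
  consider "x = 0" | "s = 0" | "x \<noteq> 0" "s \<noteq> 0" by blast
  thus ?case
  proof cases
    case 1
    thus ?thesis using Cons by simp
  next
    case 2
    thus ?thesis using Cons.prems sq[of c x] by (auto simp: s_def)
  next
    case 3
    have x: "x \<in> F - {0}" using 3 Cons.prems(1) by simp
    have IH: "\<psi> (c * s) = \<psi> c" if "c \<in> F - {0}" for c
      using Cons.IH[OF _ _ that] Cons.prems(1) 3 by (simp add: s_def)
    have c: "c \<in> F" "c \<noteq> 0" using Cons.prems(3) by auto
    define t where "t = x\<^sup>2 + s"
    have t: "t \<noteq> 0" "t \<in> F" using Cons.prems(2) x sF F by (auto simp: t_def s_def subfield_closed)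
    have ct: "c * t \<in> F - {0}" using c t F by (simp add: subfield_mult)
    have "\<psi> (c * x\<^sup>2) + \<psi> (c * s) = \<psi> (c * x\<^sup>2 + c * s) + \<psi> (c * x\<^sup>2 * (c * s) * (c * x\<^sup>2 + c * s))"
    proof (rule bin)
      show "c * x\<^sup>2 \<in> F - {0}" "c * s \<in> F - {0}" using c x sF F 3 by (auto simp: subfield_closed)
      show "c * x\<^sup>2 + c * s \<noteq> 0" using t c by (simp add: t_def distrib_left[symmetric])
    qed
    also have "c * x\<^sup>2 + c * s = c * t" by (simp add: t_def algebra_simps)
    \<comment> \<open>Up to the square of \<open>c * x\<close> the last argument is
      \<open>c * t * s\<close>, from which the induction hypothesis removes
      \<open>s\<close>.\<close>
    also have "c * x\<^sup>2 * (c * s) * (c * t) = (c * t) * s * (c * x)\<^sup>2" by (simp add: power2_eq_square mult_ac)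
    also have "\<psi> ((c * t) * s * (c * x)\<^sup>2) = \<psi> ((c * t) * s)"
      using ct sF c x 3 F by (intro sq) (auto simp: subfield_mult)
    also have "\<dots> = \<psi> (c * t)" by (rule IH[OF ct])
    finally have "2 * \<psi> c = 2 * \<psi> (c * t)" using sq[of c x] IH[of c] c x by simp
    thus ?thesis by (simp add: t_def s_def)
  qed
qed simp

text \<open>The \<open>F\<close>-span of a list, defined by recursion so that
  \<open>\<Phi>_module_sum\<close> can split off one summand at a time.\<close>

fun module_sum :: "'a::field set \<Rightarrow> 'a list \<Rightarrow> 'a set" where
  "module_sum F [] = {0}"
| "module_sum F (b # bs) = {b * x + y |x y. x \<in> F \<and> y \<in> module_sum F bs}"

lemma module_sum_lincomb: "(\<And>i. i < length bs \<Longrightarrow> c i \<in> F) \<Longrightarrow> (\<Sum>i<length bs. c i * bs ! i) \<in> module_sum F bs"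
proof (induction bs arbitrary: c)
  case (Cons b bs)
  have "(\<Sum>i<length (b # bs). c i * (b # bs) ! i) = b * c 0 + (\<Sum>i<length bs. c (Suc i) * bs ! i)"
    by (simp del: sum.lessThan_Suc add: sum.lessThan_Suc_shift)
  thus ?case using Cons.IH[of "\<lambda>i. c (Suc i)"] Cons.prems by fastforce
qed simp

context galois_extension
begin

definition formally_real :: bool where
  "formally_real \<longleftrightarrow> \<not> sum_of_squares_in K (- 1)"

definition intermediate :: "'a set \<Rightarrow> bool" where
  "intermediate F \<longleftrightarrow> subfield F \<and> K \<subseteq> F"

lemma intermediate_fixed: "subgroup_of H G \<Longrightarrow> intermediate (fixed_field H)"
  by (simp add: intermediate_def fixed_subfield K_fixed)

lemma intermediate_UNIV: "intermediate UNIV"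
  by (simp add: intermediate_def subfield_def)

lemma intermediate_module: "intermediate F \<Longrightarrow> invariant_module K F"
  by (simp add: intermediate_def invariant_module_subfield)

text \<open>If n = 0 in the field, then - 1 is the sum of n - 1 squares of 1.\<close>

lemma char_0:
  assumes "formally_real" "n > 0"
  shows "(of_nat n :: 'a) \<noteq> 0"
proof
  assume n0: "(of_nat n :: 'a) = 0"
  hence "n \<noteq> 1" by auto
  hence "n - 1 \<ge> 1" using assms(2) by simp
  moreover have "(- 1 :: 'a) = (\<Sum>i<n - 1. 1\<^sup>2)"
    using n0 assms(2) by (simp add: of_nat_diff)
  ultimately have "sum_of_squares_in K (- 1)"
    unfolding sum_of_squares_in_def using K by (intro exI[of _ "n - 1"] exI[of _ "\<lambda>_. 1"]) (auto simp: subfield_1)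
  thus False using assms(1) by (simp add: formally_real_def)
qed

lemma bilinear_G: "invariant_module K V \<Longrightarrow> bilinear_space (*) K V (trf G c)"
  using bilinear_trf[OF subgroup_Gal] by (simp add: fixed_G)

text \<open>Nondegeneracy: \<open>x\<close> paired with \<open>inverse (c * x)\<close> gives tr 1 =
  |G|, which is nonzero in characteristic 0.\<close>

lemma intermediate_orth_exists:
  assumes fr: "formally_real" and F: "intermediate F" and c: "c \<in> F" "c \<noteq> 0"
  obtains bs where "orth_basis (*) F (trf G c) bs"
proof -
  have "\<exists>bs. orth_basis (*) F (trf G c) bs"
  proof (rule trf_orth_exists[OF subgroup_Gal, unfolded fixed_G])
    fix x assume x: "x \<in> F" "x \<noteq> 0"
    have "card G > 0" using finite_G subgroup_Gal[of K] by (auto simp: subgroup_of_def card_gt_0_iff)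
    moreover have "c * x * inverse (c * x) = 1" by (rule right_inverse) (use c x in simp)
    hence "trf G c x (inverse (c * x)) = of_nat (card G)"
      using tr_fixed[of 1 G] K by (simp add: trf_def fixed_G subfield_1)
    ultimately have "trf G c x (inverse (c * x)) \<noteq> 0" using char_0[OF fr, of "card G"] by simp
    moreover have "inverse (c * x) \<in> F" using c x F by (simp add: intermediate_def subfield_closed)
    ultimately show "\<exists>y\<in>F. trf G c x y \<noteq> 0" by blast
  qed (rule intermediate_module[OF F])
  thus thesis using that by blast
qed

text \<open>For an intermediate field F, the function \<Phi> \<phi> F is the composite of \<phi> with the transfer from F
  to K. The value is junk if V has no orthogonal basis.\<close>
definition \<Phi> :: "('a \<Rightarrow> rat) \<Rightarrow> 'a set \<Rightarrow> 'a \<Rightarrow> rat" where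
  "\<Phi> \<phi> V c = sum_list (map \<phi> (squares (trf G c) (SOME bs. orth_basis (*) V (trf G c) bs)))"

lemma good_orth_bases:
  assumes \<phi>: "good K \<phi>" and bil: "bilinear_space sc K V B" and bs: "orth_basis sc V B bs" and cs: "orth_basis sc V B cs"
  shows "sum_list (map \<phi> (squares B bs)) = sum_list (map \<phi> (squares B cs))"
proof -
  interpret bilinear_space sc K V B by fact
  show ?thesis
    by (rule goodD[OF \<phi> orth_basis_squares[OF bs] orth_basis_squares[OF cs] orth_basis_isometric[OF bs cs]])
qed

lemma \<Phi>_eq:
  assumes \<phi>: "good K \<phi>" and V: "invariant_module K V" and bs: "orth_basis (*) V (trf G c) bs"
  shows "\<Phi> \<phi> V c = sum_list (map \<phi> (squares (trf G c) bs))"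
  unfolding \<Phi>_def by (rule good_orth_bases[OF \<phi> bilinear_G[OF V] someI bs]) (rule bs)

lemma invariant_module_zero: "invariant_module K {0}"
  by (simp add: invariant_module_def)

text \<open>Transport along a \<open>K\<close>-linear isometry of \<open>V\<close> onto
  \<open>W\<close>, namely multiplication by a field element in \<open>\<Phi>_square\<close> and a
  Galois automorphism in \<open>\<Phi>_conjugate\<close>.\<close>

lemma \<Phi>_image:
  assumes \<phi>: "good K \<phi>" and V: "invariant_module K V" and W: "invariant_module K W"
    and bs: "orth_basis (*) V (trf G c) bs"
    and f: "\<And>x y. f (x + y) = f x + f y" "\<And>k x. k \<in> K \<Longrightarrow> f (k * x) = k * f x"
    and eq: "\<And>x y. x \<in> V \<Longrightarrow> y \<in> V \<Longrightarrow> trf G d (f x) (f y) = trf G c x y"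
    and img: "f ` V = W"
  shows "\<Phi> \<phi> W d = \<Phi> \<phi> V c"
proof -
  have "orth_basis (*) W (trf G d) (map f bs @ map (\<lambda>_::'a. 0) [])"
  proof (rule orth_basis_sum[OF bilinear_G[OF W] bilinear_G[OF V] bilinear_G[OF invariant_module_zero] bs])
    show "orth_basis (*) {0} (trf G 0) []" by (simp add: orth_basis_def)
  qed (use W f eq img in \<open>auto simp: trf_def tr_zero[OF subgroup_Gal] invariant_module_def\<close>)
  moreover have "squares (trf G d) (map f bs) = squares (trf G c) bs"
    using eq orth_basis_set[OF bs] by simp
  ultimately show ?thesis using \<Phi>_eq[OF \<phi> W] \<Phi>_eq[OF \<phi> V bs] by (metis append_Nil2 list.map(1))
qed

lemma \<Phi>_square:
  assumes fr: "formally_real" and \<phi>: "good K \<phi>" and F: "intermediate F" and c: "c \<in> F - {0}" and x: "x \<in> F - {0}"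
  shows "\<Phi> \<phi> F (c * x\<^sup>2) = \<Phi> \<phi> F c"
proof -
  have "c * x\<^sup>2 \<in> F" "c * x\<^sup>2 \<noteq> 0" using c x F by (auto simp: intermediate_def subfield_closed)
  then obtain bs where bs: "orth_basis (*) F (trf G (c * x\<^sup>2)) bs" using intermediate_orth_exists[OF fr F] by blast
  have img: "(*) x ` F = F"
  proof
    show "(*) x ` F \<subseteq> F" using x F by (auto simp: intermediate_def subfield_mult)
    show "F \<subseteq> (*) x ` F"
    proof
      fix y assume "y \<in> F"
      hence "y / x \<in> F" "y = x * (y / x)" using x F by (auto simp: intermediate_def subfield_divide)
      thus "y \<in> (*) x ` F" by blast
    qed
  qed
  have "\<Phi> \<phi> F c = \<Phi> \<phi> F (c * x\<^sup>2)"
    by (rule \<Phi>_image[OF \<phi> intermediate_module[OF F] intermediate_module[OF F] bs _ _ _ img])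
       (auto simp: trf_def power2_eq_square algebra_simps)
  thus ?thesis by simp
qed

text \<open>Over \<open>F\<close> the form <a, b> has the orthogonal vectors (1, 1) and (b, - a)
  with values a + b and a b (a + b). \<open>B\<close> is the transfer of <a, b> to \<open>K\<close>,
  and \<open>?j1\<close>, \<open>?j2\<close> embed the transfers of the two new entries along these
  vectors.\<close>

lemma \<Phi>_binary:
  assumes fr: "formally_real" and \<phi>: "good K \<phi>" and F: "intermediate F"
    and a: "a \<in> F - {0}" and b: "b \<in> F - {0}" and ab: "a + b \<noteq> 0"
  shows "\<Phi> \<phi> F a + \<Phi> \<phi> F b = \<Phi> \<phi> F (a + b) + \<Phi> \<phi> F (a * b * (a + b))"
proof -
  define sc where "sc k v = (k * fst v, k * snd v)" for k :: 'a and v :: "'a \<times> 'a"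
  define B where "B v w = trf G a (fst v) (fst w) + trf G b (snd v) (snd w)" for v w :: "'a \<times> 'a"
  have Fs: "subfield F" "K \<subseteq> F" using F by (auto simp: intermediate_def)
  note M = intermediate_module[OF F]
  note V = bilinear_G[OF M]
  note ta = tr_add[OF subgroup_Gal[of K]] and td = tr_diff[OF subgroup_Gal[of K]]
    and ts = tr_scale[OF subgroup_Gal[of K], unfolded fixed_G] and t0 = tr_zero[OF subgroup_Gal[of K]]
  have trK: "tr G x \<in> K" for x using tr_mem[OF subgroup_Gal, of x] by (simp add: fixed_G)
  have bil: "bilinear_space sc K (F \<times> F) B"
  proof unfold_locales
    fix k x y assume "k \<in> K"
    thus "B (sc k x) y = k * B x y"
      using ts[of k "a * fst x * fst y"] ts[of k "b * snd x * snd y"] by (simp add: B_def sc_def trf_def algebra_simps)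
  next
    fix x y z :: "'a \<times> 'a"
    show "B (x + y) z = B x z + B y z"
      by (simp add: B_def trf_def ta[symmetric] algebra_simps)
  qed (use K Fs trK in \<open>auto simp: sc_def B_def trf_def subfield_closed algebra_simps zero_prod_def prod_eq_iff\<close>)
  have nz: "a * b * (a + b) \<in> F - {0}" "a + b \<in> F - {0}" using a b ab Fs by (auto simp: subfield_closed)
  obtain e1 where e1: "orth_basis (*) F (trf G a) e1" using intermediate_orth_exists[OF fr F] a by blast
  obtain e2 where e2: "orth_basis (*) F (trf G b) e2" using intermediate_orth_exists[OF fr F] b by blast
  obtain e3 where e3: "orth_basis (*) F (trf G (a + b)) e3" using intermediate_orth_exists[OF fr F] nz by blast
  obtain e4 where e4: "orth_basis (*) F (trf G (a * b * (a + b))) e4" using intermediate_orth_exists[OF fr F] nz by blast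
  let ?i1 = "\<lambda>x::'a. (x, 0::'a)" and ?i2 = "\<lambda>y::'a. (0::'a, y)"
  let ?j1 = "\<lambda>x::'a. (x, x)" and ?j2 = "\<lambda>y::'a. (b * y, - (a * y))"
  have o1: "orth_basis sc (F \<times> F) B (map ?i1 e1 @ map ?i2 e2)"
    by (rule orth_basis_sum[OF bil V V e1 e2])
       (use Fs in \<open>auto simp: B_def sc_def trf_def t0 subfield_0\<close>)
  have i1: "B (?i1 x) (?i1 y) = trf G a x y" and i2: "B (?i2 x) (?i2 y) = trf G b x y" for x y
    by (auto simp: B_def trf_def t0)
  have j1: "B (?j1 x) (?j1 y) = trf G (a + b) x y" for x y
    by (simp add: B_def trf_def ta[symmetric] algebra_simps)
  have j2: "B (?j2 x) (?j2 y) = trf G (a * b * (a + b)) x y" for x y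
    by (simp add: B_def trf_def ta[symmetric] algebra_simps)
  have o2: "orth_basis sc (F \<times> F) B (map ?j1 e3 @ map ?j2 e4)"
  proof (rule orth_basis_sum[OF bil V V e3 e4])
    fix x y show "B (?j1 x) (?j2 y) = 0" by (simp add: B_def trf_def ta[symmetric] t0 algebra_simps)
  next
    fix v assume "v \<in> F \<times> F"
    then obtain p q where v: "v = (p, q)" "p \<in> F" "q \<in> F" by blast
    \<comment> \<open>Solution of x + b y = p and x - a y = q, the two components of
      \<open>?j1 x + ?j2 y = (p, q)\<close>.\<close>
    define y where "y = (p - q) / (a + b)"
    define x where "x = (a * p + b * q) / (a + b)"
    have "x + b * y = (a + b) * p / (a + b)" by (simp add: x_def y_def add_divide_distrib[symmetric] algebra_simps)
    moreover have "x - a * y = (a + b) * q / (a + b)" by (simp add: x_def y_def diff_divide_distrib[symmetric] algebra_simps)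
    ultimately have "v = ?j1 x + ?j2 y" using ab v by simp
    moreover have "x \<in> F" "y \<in> F" using v a b Fs by (auto simp: x_def y_def subfield_closed)
    ultimately show "\<exists>x\<in>F. \<exists>y\<in>F. v = ?j1 x + ?j2 y" by blast
  qed (use j1 j2 a b Fs in \<open>auto simp: sc_def subfield_closed algebra_simps\<close>)
  have "sum_list (map \<phi> (squares B (map ?i1 e1 @ map ?i2 e2))) = sum_list (map \<phi> (squares B (map ?j1 e3 @ map ?j2 e4)))"
    by (rule good_orth_bases[OF \<phi> bil o1 o2])
  thus ?thesis
    unfolding \<Phi>_eq[OF \<phi> M e1] \<Phi>_eq[OF \<phi> M e2] \<Phi>_eq[OF \<phi> M e3] \<Phi>_eq[OF \<phi> M e4]
    by (simp add: i1 i2 j1 j2 o_def)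
qed

lemma \<Phi>_binary_good:
  "formally_real \<Longrightarrow> good K \<phi> \<Longrightarrow> intermediate F \<Longrightarrow> binary_good F (\<Phi> \<phi> F)"
  unfolding binary_good_def using \<Phi>_square \<Phi>_binary by blast

lemma \<Phi>_sum_of_squares:
  assumes fr: "formally_real" and \<phi>: "good K \<phi>" and F: "intermediate F"
    and s: "set xs \<subseteq> F" "s = sum_list (map (\<lambda>x. x\<^sup>2) xs)" "s \<noteq> 0" and c: "c \<in> F - {0}"
  shows "\<Phi> \<phi> F (c * s) = \<Phi> \<phi> F c"
  using binary_good_squares[OF _ \<Phi>_binary_good[OF fr \<phi> F] s(1) _ c] F s by (simp add: intermediate_def)

lemma of_nat_sum_squares: "of_nat n = sum_list (map (\<lambda>x. x\<^sup>2) (replicate n (1::'a)))"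
  by (simp add: sum_list_replicate)

text \<open>A positive integer is a sum of squares of 1; division follows from multiplication at
  \<open>c / of_nat n\<close>. This absorbs the integer factors of \<open>trace_over_tr\<close> and
  \<open>tr_tr\<close>.\<close>

lemma \<Phi>_of_nat:
  assumes fr: "formally_real" and \<phi>: "good K \<phi>" and F: "intermediate F" and n: "n > 0" and c: "c \<in> F - {0}"
  shows "\<Phi> \<phi> F (c * of_nat n) = \<Phi> \<phi> F c" "\<Phi> \<phi> F (c / of_nat n) = \<Phi> \<phi> F c"
proof -
  have 1: "\<Phi> \<phi> F (c * of_nat n) = \<Phi> \<phi> F c" if c: "c \<in> F - {0}" for c
    by (rule \<Phi>_sum_of_squares[OF fr \<phi> F _ of_nat_sum_squares char_0[OF fr n] c])
       (use F in \<open>auto simp: intermediate_def subfield_1\<close>)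
  show "\<Phi> \<phi> F (c * of_nat n) = \<Phi> \<phi> F c" by (rule 1[OF c])
  have "c / of_nat n \<in> F - {0}" using c F char_0[OF fr n] by (auto simp: intermediate_def subfield_closed)
  from 1[OF this] show "\<Phi> \<phi> F (c / of_nat n) = \<Phi> \<phi> F c" using char_0[OF fr n] by simp
qed

section \<open>Orthogonal decompositions over an intermediate field\<close>

lemma module_sum_invariant: "intermediate F \<Longrightarrow> invariant_module K (module_sum F bs)"
proof (induction bs)
  case (Cons b bs)
  hence IH: "invariant_module K (module_sum F bs)" and F: "subfield F" "K \<subseteq> F" by (auto simp: intermediate_def)
  show ?case unfolding invariant_module_def module_sum.simps
  proof (intro conjI ballI)
    show "0 \<in> {b * x + y |x y. x \<in> F \<and> y \<in> module_sum F bs}"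
      using IH F by (auto simp: invariant_module_def intro!: exI[of _ 0] subfield_0)
    fix v assume "v \<in> {b * x + y |x y. x \<in> F \<and> y \<in> module_sum F bs}"
    then obtain x y where v: "v = b * x + y" "x \<in> F" "y \<in> module_sum F bs" by blast
    {
      fix w assume "w \<in> {b * x + y |x y. x \<in> F \<and> y \<in> module_sum F bs}"
      then obtain x' y' where w: "w = b * x' + y'" "x' \<in> F" "y' \<in> module_sum F bs" by blast
      have "v + w = b * (x + x') + (y + y')" by (simp add: v w algebra_simps)
      moreover have "x + x' \<in> F" "y + y' \<in> module_sum F bs"
        using v w IH F by (auto simp: invariant_module_def subfield_add)
      ultimately show "v + w \<in> {b * x + y |x y. x \<in> F \<and> y \<in> module_sum F bs}" by blast
    }
    fix k assume "k \<in> K"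
    have "k * v = b * (k * x) + k * y" by (simp add: v algebra_simps)
    moreover have "k * x \<in> F" "k * y \<in> module_sum F bs"
      using v IH F \<open>k \<in> K\<close> by (auto simp: invariant_module_def subfield_mult)
    ultimately show "k * v \<in> {b * x + y |x y. x \<in> F \<and> y \<in> module_sum F bs}" by blast
  qed
qed (simp add: invariant_module_zero)

text \<open>The condition says that b F and b' F are orthogonal for the trace form. The free factor
  \<open>z\<close> also absorbs a scaling by an element of \<open>F\<close>.\<close>

lemma module_sum_orth:
  assumes F: "intermediate F"
  shows "\<forall>b'\<in>set bs. \<forall>z\<in>F. tr G (b * b' * z) = 0 \<Longrightarrow> y \<in> module_sum F bs \<Longrightarrow> z \<in> F \<Longrightarrow> tr G (b * z * y) = 0"
proof (induction bs arbitrary: y)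
  case Nil thus ?case by (simp add: tr_zero[OF subgroup_Gal])
next
  case (Cons b' bs)
  then obtain x y' where y: "y = b' * x + y'" "x \<in> F" "y' \<in> module_sum F bs" by auto
  have "tr G (b * z * y) = tr G (b * b' * (z * x)) + tr G (b * z * y')"
    by (simp add: y tr_add[OF subgroup_Gal, symmetric] algebra_simps)
  also have "tr G (b * b' * (z * x)) = 0" using Cons.prems y F by (simp add: intermediate_def subfield_mult)
  also have "tr G (b * z * y') = 0" using Cons.prems y by (intro Cons.IH) auto
  finally show ?case by simp
qed

text \<open>On the summand b F the form tr (c x y) becomes, after division by b, the transfer of <c
  d(b)>. An element \<open>d b\<close> of \<open>F\<close> stands in for b^2, which need not lie in
  \<open>F\<close>; only its traces against \<open>F\<close> have to agree.\<close>

lemma \<Phi>_module_sum: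
  assumes fr: "formally_real" and \<phi>: "good K \<phi>" and F: "intermediate F" and c: "c \<in> F - {0}"
    and orth: "sorted_wrt (\<lambda>b b'. \<forall>z\<in>F. tr G (b * b' * z) = 0) bs"
    and d: "\<And>b. b \<in> set bs \<Longrightarrow> d b \<in> F - {0}" "\<And>b z. b \<in> set bs \<Longrightarrow> z \<in> F \<Longrightarrow> tr G (b * b * z) = tr G (d b * z)"
  shows "\<Phi> \<phi> (module_sum F bs) c = (\<Sum>b\<leftarrow>bs. \<Phi> \<phi> F (c * d b))"
proof -
  have "\<exists>cs. orth_basis (*) (module_sum F bs) (trf G c) cs \<and>
      sum_list (map \<phi> (squares (trf G c) cs)) = (\<Sum>b\<leftarrow>bs. \<Phi> \<phi> F (c * d b))"
    using orth d
  proof (induction bs)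
    case Nil
    show ?case by (rule exI[of _ "[]"]) (simp add: orth_basis_def)
  next
    case (Cons b bs)
    then obtain cs where cs: "orth_basis (*) (module_sum F bs) (trf G c) cs"
      "sum_list (map \<phi> (squares (trf G c) cs)) = (\<Sum>b\<leftarrow>bs. \<Phi> \<phi> F (c * d b))" by auto
    have Fs: "subfield F" using F by (simp add: intermediate_def)
    have cd: "c * d b \<in> F" "c * d b \<noteq> 0" using c Cons.prems(2)[of b] Fs by (auto simp: subfield_mult)
    obtain es where es: "orth_basis (*) F (trf G (c * d b)) es" using intermediate_orth_exists[OF fr F cd] by blast
    note M = module_sum_invariant[OF F]
    have f: "trf G c (b * x) (b * y) = trf G (c * d b) x y" if "x \<in> F" "y \<in> F" for x y
      using Cons.prems(3)[of b "c * x * y"] that c Fs by (simp add: trf_def subfield_mult mult_ac)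
    have "orth_basis (*) (module_sum F (b # bs)) (trf G c) (map ((*) b) es @ map (\<lambda>x. x) cs)"
    proof (rule orth_basis_sum[OF bilinear_G[OF M] bilinear_G[OF intermediate_module[OF F]] bilinear_G[OF M] es cs(1)])
      fix x assume "x \<in> F"
      moreover have "0 \<in> module_sum F bs" using M by (simp add: invariant_module_def)
      ultimately show "b * x \<in> module_sum F (b # bs)" by force
    next
      fix y assume "y \<in> module_sum F bs"
      moreover have "0 \<in> F" using Fs by (rule subfield_0)
      ultimately show "y \<in> module_sum F (b # bs)" by force
    next
      fix x y assume "x \<in> F" "y \<in> module_sum F bs"
      thus "trf G c (b * x) y = 0"
        using module_sum_orth[OF F, of bs b y "c * x"] Cons.prems(1) c Fs by (simp add: trf_def subfield_mult mult_ac)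
    qed (use f in \<open>auto simp: algebra_simps\<close>)
    moreover
    have "squares (trf G c) (map ((*) b) es @ map (\<lambda>x. x) cs) = squares (trf G (c * d b)) es @ squares (trf G c) cs"
      using f orth_basis_set[OF es] by simp
    hence "sum_list (map \<phi> (squares (trf G c) (map ((*) b) es @ map (\<lambda>x. x) cs))) = (\<Sum>b\<leftarrow>b # bs. \<Phi> \<phi> F (c * d b))"
      using cs(2) \<Phi>_eq[OF \<phi> intermediate_module[OF F] es] by (simp only: map_append sum_list_append list.map sum_list.Cons)
    ultimately show ?case by blast
  qed
  then obtain cs where cs: "orth_basis (*) (module_sum F bs) (trf G c) cs"
    "sum_list (map \<phi> (squares (trf G c) cs)) = (\<Sum>b\<leftarrow>bs. \<Phi> \<phi> F (c * d b))" by blast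
  show ?thesis unfolding \<Phi>_eq[OF \<phi> module_sum_invariant[OF F] cs(1)] by (rule cs(2))
qed

end

section \<open>Relations and injectivity\<close>

text \<open>The definition asks for at least one summand and for nonzero ones. For \<open>al\<close>
  different from 0, dropping zeros from an arbitrary list achieves both.\<close>

lemma sum_of_squares_list:
  fixes al :: "'a::field"
  assumes "al \<noteq> 0"
  shows "sum_of_squares_in K al \<longleftrightarrow> (\<exists>xs. set xs \<subseteq> K \<and> al = sum_list (map (\<lambda>x. x\<^sup>2) xs))"
proof
  assume "sum_of_squares_in K al"
  then obtain m :: nat and x :: "nat \<Rightarrow> 'a" where x: "\<forall>i<m. x i \<in> K \<and> x i \<noteq> 0" "al = (\<Sum>i<m. (x i)\<^sup>2)"
    unfolding sum_of_squares_in_def by (elim exE conjE)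
  have "al = sum_list (map (\<lambda>x. x\<^sup>2) (map x [0..<m]))"
    unfolding x(2) by (simp add: sum_list_sum_nth atLeast0LessThan)
  thus "\<exists>xs. set xs \<subseteq> K \<and> al = sum_list (map (\<lambda>x. x\<^sup>2) xs)"
    using x(1) by (intro exI[of _ "map x [0..<m]"]) auto
next
  assume "\<exists>xs. set xs \<subseteq> K \<and> al = sum_list (map (\<lambda>x. x\<^sup>2) xs)"
  then obtain xs where xs: "set xs \<subseteq> K" "al = sum_list (map (\<lambda>x. x\<^sup>2) xs)" by blast
  define ys where "ys = filter (\<lambda>x. x \<noteq> 0) xs"
  have al: "al = sum_list (map (\<lambda>x. x\<^sup>2) ys)" unfolding xs(2) ys_def by (induction xs) auto
  hence "length ys \<ge> 1" using assms by (cases ys) auto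
  moreover have "al = (\<Sum>i<length ys. (ys ! i)\<^sup>2)" unfolding al by (rule sum_nth_eq_sum_list[symmetric])
  moreover have "ys ! i \<in> K \<and> ys ! i \<noteq> 0" if "i < length ys" for i
    using nth_mem[OF that] xs(1) by (auto simp: ys_def)
  ultimately show "sum_of_squares_in K al"
    unfolding sum_of_squares_in_def by blast
qed

lemma sum_list_squares_scale:
  "sum_list (map (\<lambda>x. x\<^sup>2) (map (\<lambda>x. x * d) xs)) = sum_list (map (\<lambda>x. x\<^sup>2) xs) * (d :: 'a::comm_ring_1)\<^sup>2"
  by (induction xs) (auto simp: power_mult_distrib distrib_right)

lemma good_binary_good:
  fixes K :: "'a::field set"
  assumes K: "subfield K" and \<phi>: "good K \<phi>"
  shows "binary_good K \<phi>"
  unfolding binary_good_def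
proof (intro conjI ballI impI)
  fix c x assume c: "c \<in> K - {0}" and x: "x \<in> K - {0}"
  have nz: "0 \<notin> set [c * x\<^sup>2]" using c x by simp
  have "isometric_over K (diag [c]) (diag [c * x\<^sup>2])"
    unfolding isometric_over_diag_iff[OF nz]
    using x by (auto intro!: exI[of _ "\<lambda>_ _. x"] simp: power2_eq_square)
  from goodD[OF \<phi> _ _ this] show "\<phi> (c * x\<^sup>2) = \<phi> c" using c x K by (simp add: subfield_closed)
next
  fix a b assume a: "a \<in> K - {0}" and b: "b \<in> K - {0}" and ab: "a + b \<noteq> 0"
  have nz: "0 \<notin> set [a + b, a * b * (a + b)]" using a b ab by simp
  \<comment> \<open>Columns (1, 1) and (b, - a), as in the transferred version.\<close>
  define P where "P i j = (if j = 0 then 1 else if i = 0 then b else - a)" for i j :: nat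
  have "isometric_over K (diag [a, b]) (diag [a + b, a * b * (a + b)])"
    unfolding isometric_over_diag_iff[OF nz]
  proof (intro conjI exI[of _ P] allI impI)
    fix i j show "P i j \<in> K" using a b K by (auto simp: P_def subfield_closed)
  next
    fix j k assume "j < length [a, b]" "k < length [a, b]"
    hence "(j = 0 \<or> j = 1) \<and> (k = 0 \<or> k = 1)" by auto
    thus "(\<Sum>i<length [a, b]. P i j * [a, b] ! i * P i k) = (if j = k then [a + b, a * b * (a + b)] ! j else 0)"
      by (auto simp: P_def algebra_simps)
  qed simp
  from goodD[OF \<phi> _ _ this] show "\<phi> a + \<phi> b = \<phi> (a + b) + \<phi> (a * b * (a + b))"
    using a b ab K by (simp add: subfield_closed)
qed

section \<open>From rational invariants to the Dress map\<close>

lemma sum_list_copies: "sum_list (map \<phi> (copies n xs)) = of_nat n * sum_list (map (\<phi> :: _ \<Rightarrow> rat) xs)"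
  by (induction n) (auto simp: copies_def algebra_simps)

text \<open>The positive part of a combination: \<open>nat\<close> discards negative coefficients,
  and the negative part is obtained at \<open>- a\<close>, as in \<open>dress\<close>.\<close>

definition weighted :: "(nat \<Rightarrow> int) \<Rightarrow> (nat \<Rightarrow> 'a list) \<Rightarrow> nat \<Rightarrow> 'a list" where
  "weighted a xs n = concat (map (\<lambda>i. copies (nat (a i)) (xs i)) [0..<n])"

lemma osum_list_concat_replicate:
  "osum_list (concat (map (\<lambda>i. replicate (m i) (A i)) is)) = osum_list (map A (concat (map (\<lambda>i. replicate (m i) i) is)))"
  by (simp add: map_concat o_def)

lemma diagonalizes_weighted:
  assumes K: "subfield K" and A: "\<And>i. i < n \<Longrightarrow> a i > 0 \<Longrightarrow> diagonalizes K (A i) (xs i)"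
  shows "diagonalizes K (osum_list (concat (map (\<lambda>i. replicate (nat (a i)) (A i)) [0..<n]))) (weighted a xs n)"
proof -
  let ?is = "concat (map (\<lambda>i. replicate (nat (a i)) i) [0..<n])"
  have "weighted a xs n = concat (map xs ?is)"
    by (induction n) (auto simp: weighted_def copies_def)
  thus ?thesis unfolding osum_list_concat_replicate
    using diagonalizes_osum_list[OF K, of ?is A xs] A by fastforce
qed

lemma sum_list_weighted:
  "sum_list (map \<phi> (weighted a xs n)) = (\<Sum>i<n. of_nat (nat (a i)) * sum_list (map (\<phi> :: _ \<Rightarrow> rat) (xs i)))"
  by (induction n) (auto simp: weighted_def sum_list_copies)

lemma mset_weighted_scale: "mset (weighted (\<lambda>i. int N * a i) xs n) = mset (copies N (weighted a xs n))"
proof (induction n)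
  case (Suc n)
  have "nat (int N * a n) = N * nat (a n)" by (simp add: nat_mult_distrib)
  moreover have "repeat_mset N (A + B) = repeat_mset N A + repeat_mset N B" for A B :: "'a multiset"
    by (rule multiset_eqI) (simp add: algebra_simps)
  moreover have "repeat_mset (N * k) A = repeat_mset N (repeat_mset k A)" for k and A :: "'a multiset"
    by (rule multiset_eqI) simp
  ultimately show ?case using Suc by (simp add: weighted_def mset_copies)
qed (simp add: weighted_def mset_copies)

lemma set_weighted: "(\<And>i. i < n \<Longrightarrow> a i > 0 \<Longrightarrow> set (xs i) \<subseteq> S) \<Longrightarrow> set (weighted a xs n) \<subseteq> S"
  unfolding weighted_def copies_def by fastforce

text \<open>A combination on which all good functions vanish has torsion image: some multiple N a
  maps to zero, injectivity gives N a = 0, and N is positive. Diagonalisations are requested only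
  where \<open>a i\<close> is nonzero, because in arbitrary characteristic only the extreme
  subgroups are diagonalised.\<close>

lemma injective_relation_trivial:
  fixes K :: "'a::field set"
  assumes K: "subfield K" and inj: "dress_injective K reps"
    and d: "\<And>i. i < length reps \<Longrightarrow> a i \<noteq> 0 \<Longrightarrow> diagonalizes K (trace_form K (fixed_field (reps ! i))) (xs i)"
    and rel: "\<And>\<phi>. good K \<phi> \<Longrightarrow> (\<Sum>i<length reps. of_int (a i) * sum_list (map \<phi> (xs i))) = 0"
    and i: "i < length reps"
  shows "a i = 0"
proof -
  let ?n = "length reps"
  define X where "X = weighted a xs ?n"
  define Y where "Y = weighted (\<lambda>i. - a i) xs ?n"
  have xsK: "set (xs i) \<subseteq> K - {0}" if "i < ?n" "a i \<noteq> 0" for i using d[OF that] by (simp add: diagonalizes_def)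
  have XK: "set X \<subseteq> K - {0}" unfolding X_def using xsK by (intro set_weighted) auto
  have YK: "set Y \<subseteq> K - {0}" unfolding Y_def using xsK by (intro set_weighted) auto
  have "sum_list (map \<phi> X) = sum_list (map \<phi> Y)" if "good K \<phi>" for \<phi>
  proof -
    have "sum_list (map \<phi> X) - sum_list (map \<phi> Y) = (\<Sum>i<?n. of_int (a i) * sum_list (map \<phi> (xs i)))"
      unfolding X_def Y_def sum_list_weighted sum_subtractf[symmetric]
    proof (rule sum.cong[OF refl])
      fix i
      have "(of_nat (nat (a i)) - of_nat (nat (- a i)) :: rat) = of_int (a i)" by (cases "a i \<ge> 0") auto
      thus "of_nat (nat (a i)) * sum_list (map \<phi> (xs i)) - of_nat (nat (- a i)) * sum_list (map \<phi> (xs i)) =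
          of_int (a i) * sum_list (map \<phi> (xs i))" by (metis left_diff_distrib)
    qed
    thus ?thesis using rel[OF that] by simp
  qed
  from good_separates[OF K XK YK this] obtain N zs where N: "N > 0" and zs: "set zs \<subseteq> K - {0}"
    and iso: "isometric_over K (diag (copies N X @ zs)) (diag (copies N Y @ zs))" by blast
  \<comment> \<open>Repeating both sides N times is realised by the coefficient vector N a, up to
    the order of the entries.\<close>
  define b where "b i = int N * a i" for i
  let ?T = "\<lambda>i. trace_form K (fixed_field (reps ! i))"
  define P where "P = weighted b xs ?n"
  define Q where "Q = weighted (\<lambda>i. - b i) xs ?n"
  have mP: "mset P = mset (copies N X)"
    unfolding P_def X_def b_def by (rule mset_weighted_scale)
  have mQ: "mset Q = mset (copies N Y)"
    unfolding Q_def Y_def b_def using mset_weighted_scale[of N "\<lambda>i. - a i"] by simp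
  have dP: "diagonalizes K (fst (dress K reps b)) P"
    unfolding dress_def fst_conv P_def by (intro diagonalizes_weighted[OF K] d) (auto simp: b_def)
  have dQ: "diagonalizes K (snd (dress K reps b)) Q"
    unfolding dress_def snd_conv Q_def by (intro diagonalizes_weighted[OF K] d) (auto simp: b_def)
  have d0: "diagonalizes K (fst (dress K reps (\<lambda>_. 0))) []" "diagonalizes K (snd (dress K reps (\<lambda>_. 0))) []"
    using diagonalizes_diag[OF K, of "[]"]
    by (simp_all add: dress_def osum_list_def diag_Nil map_replicate_const)
  note dz = diagonalizes_diag[OF K zs]
  have nz: "0 \<notin> set (P @ zs)" "0 \<notin> set (Q @ zs)" "0 \<notin> set (copies N X @ zs)" "0 \<notin> set (copies N Y @ zs)"
    using mset_eq_setD[OF mP] mset_eq_setD[OF mQ] set_copies[of N X] set_copies[of N Y] XK YK zs by auto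
  note t = isometric_over_trans[OF K diag_carrier]
  have "isometric_over K (diag (P @ zs)) (diag (copies N X @ zs))"
    by (rule isometric_over_diag_perm[OF K]) (use mP nz in auto)
  moreover have "isometric_over K (diag (copies N Y @ zs)) (diag (Q @ zs))"
    by (rule isometric_over_diag_perm[OF K]) (use mQ nz in auto)
  ultimately have "isometric_over K (diag (P @ zs)) (diag (Q @ zs))"
    using iso t by blast
  hence "isometric_over K (diag ((P @ []) @ zs)) (diag (([] @ Q) @ zs))" by simp
  hence "isometric_over K (osum (osum (fst (dress K reps b)) (snd (dress K reps (\<lambda>_. 0)))) (diag zs))
      (osum (osum (fst (dress K reps (\<lambda>_. 0))) (snd (dress K reps b))) (diag zs))"
    using diagonalizes_isometric_iff[OF K diagonalizes_osum[OF K diagonalizes_osum[OF K dP d0(2)] dz]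
        diagonalizes_osum[OF K diagonalizes_osum[OF K d0(1) dQ] dz]] by blast
  moreover have "form_over K (diag zs)"
  proof -
    have "transpose_mat (diag zs) = diag zs" by (rule eq_matI) auto
    thus ?thesis using dz det_diag_nonzero[of zs] zs by (auto simp: form_over_def diagonalizes_def)
  qed
  ultimately have "gw_eq K (dress K reps b) (dress K reps (\<lambda>_. 0))" unfolding gw_eq_def by blast
  hence "b i = 0" using inj i unfolding dress_injective_def by blast
  thus ?thesis using N by (simp add: b_def)
qed

context galois_extension
begin

lemma conjugate_card:
  assumes H: "subgroup_of H G" and c: "conjugate_in G H H'"
  shows "card H' = card H"
proof -
  obtain \<sigma> where \<sigma>: "\<sigma> \<in> G" "H' = (\<lambda>\<tau>. \<sigma> \<circ> \<tau> \<circ> inv_into UNIV \<sigma>) ` H" using c by (auto simp: conjugate_in_def)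
  have b: "bij \<sigma>" using Gal_field_aut[OF \<sigma>(1)] by (simp add: field_aut_def)
  have "inj_on (\<lambda>\<tau>. \<sigma> \<circ> \<tau> \<circ> inv_into UNIV \<sigma>) H"
  proof (rule inj_onI)
    fix \<tau> \<tau>' assume eq: "\<sigma> \<circ> \<tau> \<circ> inv_into UNIV \<sigma> = \<sigma> \<circ> \<tau>' \<circ> inv_into UNIV \<sigma>"
    show "\<tau> = \<tau>'"
    proof
      fix x
      have "\<sigma> (\<tau> x) = \<sigma> (\<tau>' x)" using fun_cong[OF eq, of "\<sigma> x"] b by (simp add: bij_def)
      thus "\<tau> x = \<tau>' x" using b by (simp add: bij_def inj_eq)
    qed
  qed
  thus ?thesis using \<sigma> card_image by blast
qed

lemma conjugate_fixed:
  assumes \<sigma>: "\<sigma> \<in> G"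
  shows "fixed_field ((\<lambda>\<tau>. \<sigma> \<circ> \<tau> \<circ> inv_into UNIV \<sigma>) ` H) = \<sigma> ` fixed_field H"
proof -
  have b: "bij \<sigma>" using Gal_field_aut[OF \<sigma>] by (simp add: field_aut_def)
  have 1: "\<sigma> (inv_into UNIV \<sigma> x) = x" "inv_into UNIV \<sigma> (\<sigma> x) = x" for x using b by (auto simp: bij_def surj_f_inv_f)
  have 2: "\<sigma> x = \<sigma> y \<longleftrightarrow> x = y" for x y using b by (simp add: bij_def inj_eq)
  show ?thesis
  proof
    show "\<sigma> ` fixed_field H \<subseteq> fixed_field ((\<lambda>\<tau>. \<sigma> \<circ> \<tau> \<circ> inv_into UNIV \<sigma>) ` H)"
      using 1 by (auto simp: fixed_field_def)
    show "fixed_field ((\<lambda>\<tau>. \<sigma> \<circ> \<tau> \<circ> inv_into UNIV \<sigma>) ` H) \<subseteq> \<sigma> ` fixed_field H"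
    proof
      fix x assume x: "x \<in> fixed_field ((\<lambda>\<tau>. \<sigma> \<circ> \<tau> \<circ> inv_into UNIV \<sigma>) ` H)"
      have "inv_into UNIV \<sigma> x \<in> fixed_field H"
        unfolding fixed_field_def
      proof (intro CollectI ballI)
        fix \<tau> assume "\<tau> \<in> H"
        hence "\<sigma> (\<tau> (inv_into UNIV \<sigma> x)) = \<sigma> (inv_into UNIV \<sigma> x)" using x 1 by (auto simp: fixed_field_def)
        thus "\<tau> (inv_into UNIV \<sigma> x) = inv_into UNIV \<sigma> x" by (simp only: 2)
      qed
      thus "x \<in> \<sigma> ` fixed_field H" using 1(1)[of x] by (metis imageI)
    qed
  qed
qed

text \<open>The trace form differs from the form of \<open>tr G\<close> by the factor 1 /
  \<open>card (stab ?F)\<close>, which good functions do not see.\<close>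

lemma trace_form_\<Phi>:
  assumes fr: "formally_real" and H: "subgroup_of H G"
  shows "\<exists>xs. diagonalizes K (trace_form K (fixed_field H)) xs \<and>
    (\<forall>\<phi>. good K \<phi> \<longrightarrow> sum_list (map \<phi> xs) = \<Phi> \<phi> (fixed_field H) 1)"
proof -
  let ?F = "fixed_field H"
  let ?c = "1 / of_nat (card (stab ?F)) :: 'a"
  have F: "intermediate ?F" by (rule intermediate_fixed[OF H])
  hence F': "subfield ?F" "K \<subseteq> ?F" by (auto simp: intermediate_def)
  have one: "(1::'a) \<in> ?F" by (rule subfield_1[OF F'(1)])
  obtain bs where bs: "orth_basis (*) ?F (trf G 1) bs" using intermediate_orth_exists[OF fr F one] by auto
  have m: "(of_nat (card (stab ?F)) :: 'a) \<noteq> 0" by (rule card_stab_nonzero[OF F' bs])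
  hence m0: "card (stab ?F) > 0" by (metis neq0_conv of_nat_0)
  have c: "?c \<in> K" "?c \<noteq> 0" using m K by (auto simp: subfield_closed)
  have "sum_list (map \<phi> (squares (trf G ?c) bs)) = \<Phi> \<phi> ?F 1" if \<phi>: "good K \<phi>" for \<phi>
    using \<Phi>_eq[OF \<phi> intermediate_module[OF F] orth_basis_rescale[OF c F' bs]]
      \<Phi>_of_nat(2)[OF fr \<phi> F m0, of 1] one by simp
  thus ?thesis using trace_form_isometric[OF F' bs] by blast
qed

lemma \<Phi>_conjugate:
  assumes fr: "formally_real" and \<phi>: "good K \<phi>" and H: "subgroup_of H G" and H': "subgroup_of H' G"
    and c: "conjugate_in G H H'"
  shows "\<Phi> \<phi> (fixed_field H') 1 = \<Phi> \<phi> (fixed_field H) 1"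
proof -
  obtain \<sigma> where \<sigma>: "\<sigma> \<in> G" "H' = (\<lambda>\<tau>. \<sigma> \<circ> \<tau> \<circ> inv_into UNIV \<sigma>) ` H" using c by (auto simp: conjugate_in_def)
  note s = aut[OF subgroup_Gal \<sigma>(1)]
  have F: "intermediate (fixed_field H)" "intermediate (fixed_field H')" using intermediate_fixed H H' by auto
  have one: "(1::'a) \<in> fixed_field H" using F by (auto simp: intermediate_def subfield_1)
  obtain bs where bs: "orth_basis (*) (fixed_field H) (trf G 1) bs" using intermediate_orth_exists[OF fr F(1) one] by auto
  show ?thesis
  proof (rule \<Phi>_image[OF \<phi> intermediate_module[OF F(1)] intermediate_module[OF F(2)] bs, of \<sigma>])
    show "\<sigma> ` fixed_field H = fixed_field H'" unfolding \<sigma>(2) by (rule conjugate_fixed[OF \<sigma>(1), symmetric])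
    fix k x assume "k \<in> K"
    thus "\<sigma> (k * x) = k * \<sigma> x" using Gal_fix[OF \<sigma>(1)] by (simp add: s)
  next
    fix x y
    show "trf G 1 (\<sigma> x) (\<sigma> y) = trf G 1 x y"
      using tr_aut[OF subgroup_Gal \<sigma>(1), of "x * y"] by (simp add: trf_def s)
  qed (simp add: s)
qed

text \<open>Different cardinality is the test that no \<open>H\<close> in \<open>ms\<close> is
  conjugate to \<open>H0\<close>. The class of \<open>H0\<close> therefore keeps the coefficient 1,
  while conjugate members of \<open>ms\<close> may pile up on one index.\<close>

lemma injective_no_relation:
  assumes reps: "subgroup_class_reps G reps" and inj: "dress_injective K reps" and fr: "formally_real"
    and H0: "subgroup_of H0 G"
    and ms: "\<And>m H. (m, H) \<in> set ms \<Longrightarrow> subgroup_of H G \<and> card H \<noteq> card H0"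
    and rel: "\<And>\<phi>. good K \<phi> \<Longrightarrow>
      \<Phi> \<phi> (fixed_field H0) 1 = (\<Sum>(m, H)\<leftarrow>ms. of_int m * \<Phi> \<phi> (fixed_field H) 1)"
  shows False
proof -
  let ?n = "length reps"
  have sub: "subgroup_of (reps ! i) G" if "i < ?n" for i using reps that by (auto simp: subgroup_class_reps_def)
  define ix where "ix H = (SOME i. i < ?n \<and> conjugate_in G (reps ! i) H)" for H
  have ix: "ix H < ?n" "conjugate_in G (reps ! ix H) H" if "subgroup_of H G" for H
  proof -
    have "\<exists>i. i < ?n \<and> conjugate_in G (reps ! i) H" using reps that by (auto simp: subgroup_class_reps_def)
    from someI_ex[OF this] show "ix H < ?n" "conjugate_in G (reps ! ix H) H" by (auto simp: ix_def)
  qed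
  have "\<forall>i. \<exists>xs. i < ?n \<longrightarrow> diagonalizes K (trace_form K (fixed_field (reps ! i))) xs \<and>
      (\<forall>\<phi>. good K \<phi> \<longrightarrow> sum_list (map \<phi> xs) = \<Phi> \<phi> (fixed_field (reps ! i)) 1)"
    using trace_form_\<Phi>[OF fr sub] by blast
  then obtain xs where xs: "\<And>i. i < ?n \<Longrightarrow> diagonalizes K (trace_form K (fixed_field (reps ! i))) (xs i)"
    "\<And>i \<phi>. i < ?n \<Longrightarrow> good K \<phi> \<Longrightarrow> sum_list (map \<phi> (xs i)) = \<Phi> \<phi> (fixed_field (reps ! i)) 1" by metis
  define \<delta> where "\<delta> H i = (if i = ix H then 1 else 0 :: int)" for H i
  define a where "a i = \<delta> H0 i - (\<Sum>(m, H)\<leftarrow>ms. m * \<delta> H i)" for i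
  have pick: "(\<Sum>i<?n. of_int (\<delta> H i) * sum_list (map \<phi> (xs i))) = \<Phi> \<phi> (fixed_field H) 1"
    if "subgroup_of H G" "good K \<phi>" for H \<phi>
  proof -
    have "(\<Sum>i<?n. of_int (\<delta> H i) * sum_list (map \<phi> (xs i))) = (\<Sum>i<?n. if i = ix H then sum_list (map \<phi> (xs i)) else 0)"
      by (rule sum.cong) (auto simp: \<delta>_def)
    also have "\<dots> = \<Phi> \<phi> (fixed_field (reps ! ix H)) 1" using ix(1)[OF that(1)] xs(2) that(2) by simp
    also have "\<dots> = \<Phi> \<phi> (fixed_field H) 1"
      using \<Phi>_conjugate[OF fr that(2) sub[OF ix(1)[OF that(1)]] that(1) ix(2)[OF that(1)]] by simp
    finally show ?thesis .
  qed
  have "a (ix H0) = 0"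
  proof (rule injective_relation_trivial[OF K inj, of a xs])
    fix \<phi> assume \<phi>: "good K \<phi>"
    have "(\<Sum>i<?n. of_int (\<Sum>(m, H)\<leftarrow>ms'. m * \<delta> H i) * sum_list (map \<phi> (xs i))) =
        (\<Sum>(m, H)\<leftarrow>ms'. of_int m * \<Phi> \<phi> (fixed_field H) 1)" if "set ms' \<subseteq> set ms" for ms'
      using that
    proof (induction ms')
      case (Cons p ms')
      obtain m H where p: "p = (m, H)" by (cases p)
      have "subgroup_of H G" using Cons.prems ms[of m H] p by auto
      have "(\<Sum>i<?n. of_int (\<Sum>(m, H)\<leftarrow>p # ms'. m * \<delta> H i) * sum_list (map \<phi> (xs i))) =
          of_int m * (\<Sum>i<?n. of_int (\<delta> H i) * sum_list (map \<phi> (xs i))) +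
          (\<Sum>i<?n. of_int (\<Sum>(m, H)\<leftarrow>ms'. m * \<delta> H i) * sum_list (map \<phi> (xs i)))"
        unfolding sum_distrib_left sum.distrib[symmetric] by (rule sum.cong) (auto simp: p algebra_simps)
      also have "\<dots> = (\<Sum>(m, H)\<leftarrow>p # ms'. of_int m * \<Phi> \<phi> (fixed_field H) 1)"
        using Cons pick[OF \<open>subgroup_of H G\<close> \<phi>] by (simp add: p)
      finally show ?case .
    qed simp
    from this[OF subset_refl] show "(\<Sum>i<?n. of_int (a i) * sum_list (map \<phi> (xs i))) = 0"
      using pick[OF H0 \<phi>] rel[OF \<phi>] by (simp add: a_def left_diff_distrib sum_subtractf)
  qed (use xs(1) ix(1)[OF H0] in auto)
  moreover have "(\<Sum>(m, H)\<leftarrow>ms'. m * \<delta> H (ix H0)) = 0" if "set ms' \<subseteq> set ms" for ms'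
    using that
  proof (induction ms')
    case (Cons p ms')
    obtain m H where p: "p = (m, H)" by (cases p)
    have H: "subgroup_of H G" "card H \<noteq> card H0" using Cons.prems ms[of m H] p by auto
    have "ix H \<noteq> ix H0"
      using conjugate_card[OF sub[OF ix(1)[OF H(1)]] ix(2)[OF H(1)]] conjugate_card[OF sub[OF ix(1)[OF H0]] ix(2)[OF H0]] H(2)
      by auto
    thus ?case using Cons by (simp add: p \<delta>_def)
  qed simp
  from this[OF subset_refl] have "a (ix H0) = 1" by (simp add: a_def \<delta>_def)
  ultimately show False by simp
qed

text \<open>If - 1 is a sum of squares, then so is every element of K, and forms are determined up to torsion by
  their rank.\<close>
lemma injective_formally_real:
  assumes reps: "subgroup_class_reps G reps" and inj: "dress_injective K reps" and neq: "K \<noteq> UNIV"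
  shows "formally_real"
proof (rule ccontr)
  assume "\<not> formally_real"
  hence "sum_of_squares_in K (- 1)" by (simp add: formally_real_def)
  then obtain us where us: "set us \<subseteq> K" "- 1 = sum_list (map (\<lambda>x. x\<^sup>2) us)"
    using sum_of_squares_list[of "- 1 :: 'a" K] by auto
  have const: "\<phi> c = \<phi> 1" if \<phi>: "good K \<phi>" and c: "c \<in> K - {0}" for \<phi> c
  proof -
    \<comment> \<open>From c = ((c + 1) / 2)^2 - ((c - 1) / 2)^2, with - 1 replaced by the squares
      of \<open>us\<close>.\<close>
    let ?us = "(c + 1) / 2 # map (\<lambda>u. u * ((c - 1) / 2)) us"
    have "sum_list (map (\<lambda>x. x\<^sup>2) ?us) = ((c + 1) / 2)\<^sup>2 + sum_list (map (\<lambda>x. x\<^sup>2) us) * ((c - 1) / 2)\<^sup>2"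
      by (simp only: list.map sum_list.Cons sum_list_squares_scale)
    also have "\<dots> = c"
    proof -
      have "(4::'a) = 2 * 2" by simp
      hence four: "(4::'a) \<noteq> 0" using two by (metis mult_eq_0_iff)
      have "((c + 1) / 2)\<^sup>2 + - 1 * ((c - 1) / 2)\<^sup>2 = ((c + 1)\<^sup>2 - (c - 1)\<^sup>2) / 4"
        by (simp add: power_divide diff_divide_distrib[symmetric])
      also have "(c + 1)\<^sup>2 - (c - 1)\<^sup>2 = 4 * c" by (simp add: power2_eq_square algebra_simps)
      finally show ?thesis using four us(2) by simp
    qed
    finally have s: "sum_list (map (\<lambda>x. x\<^sup>2) ?us) = c" .
    have "(c + 1) / 2 \<in> K" "(c - 1) / 2 \<in> K" using c K by (auto intro!: subfield_closed)
    hence "set ?us \<subseteq> K" unfolding list.set set_map insert_subset image_subset_iff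
      using us(1) K by (blast intro: subfield_mult)
    from binary_good_squares[OF K good_binary_good[OF K \<phi>] this, of 1] show ?thesis
      unfolding s using c K by (simp add: subfield_1)
  qed
  have mod: "invariant_module (fixed_field G) UNIV" by (simp add: invariant_module_def)
  \<comment> \<open>In positive characteristic tr 1 may vanish, so nondegeneracy is tested by
    pairing x with w / x.\<close>
  obtain w where w: "tr G w \<noteq> 0" using tr_nonzero[OF subgroup_Gal] by blast
  have "\<exists>bs. orth_basis (*) UNIV (trf G 1) bs"
  proof (rule trf_orth_exists[OF subgroup_Gal mod])
    fix x :: 'a assume "x \<noteq> 0"
    thus "\<exists>y\<in>UNIV. trf G 1 x y \<noteq> 0" using w by (intro bexI[of _ "w / x"]) (auto simp: trf_def)
  qed
  then obtain bs where bs: "orth_basis (*) UNIV (trf G 1) bs" by blast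
  define x1 where "x1 = squares (trf G (1 / of_nat (card (stab UNIV)))) bs"
  have d1: "diagonalizes K (trace_form K UNIV) x1"
    unfolding x1_def using trace_form_isometric[OF _ _ bs] by (simp add: subfield_def)
  let ?n = "length reps"
  have sub: "subgroup_of (reps ! i) G" if "i < ?n" for i using reps that by (auto simp: subgroup_class_reps_def)
  obtain i where i: "i < ?n" "conjugate_in G (reps ! i) {id}"
    using reps subgroup_trivial[of K] by (auto simp: subgroup_class_reps_def)
  obtain j where j: "j < ?n" "conjugate_in G (reps ! j) G"
    using reps subgroup_Gal[of K] by (auto simp: subgroup_class_reps_def)
  have ri: "reps ! i = {id}"
  proof -
    have "card (reps ! i) = 1" using conjugate_card[OF sub[OF i(1)] i(2)] by simp
    moreover have "id \<in> reps ! i" using sub[OF i(1)] by (simp add: subgroup_of_def)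
    ultimately show ?thesis by (metis card_1_singletonE singletonD)
  qed
  have rj: "reps ! j = G"
    using conjugate_card[OF sub[OF j(1)] j(2)] sub[OF j(1)] card_subset_eq[OF finite_G]
    by (auto simp: subgroup_of_def)
  have "fixed_field {id} = (UNIV :: 'a set)" by (simp add: fixed_field_def)
  hence ij: "i \<noteq> j" using ri rj fixed_G neq by metis
  define xs where "xs k = (if k = i then x1 else [1])" for k
  \<comment> \<open>The coefficient at G/G is minus the rank of the trace form of the big field, so
    that the combination has rank 0.\<close>
  define a where "a k = (if k = i then 1 else if k = j then - int (length x1) else 0)" for k
  have "a i = 0"
  proof (rule injective_relation_trivial[OF K inj, of a xs])
    fix k assume "k < ?n" "a k \<noteq> 0"
    hence "k = i \<or> k = j" by (auto simp: a_def split: if_splits)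
    thus "diagonalizes K (trace_form K (fixed_field (reps ! k))) (xs k)"
      using d1 trace_form_base ri rj fixed_G \<open>fixed_field {id} = UNIV\<close> by (auto simp: xs_def)
  next
    fix \<phi> assume \<phi>: "good K \<phi>"
    have "sum_list (map \<phi> x1) = sum_list (map (\<lambda>_. \<phi> 1) x1)"
      using const[OF \<phi>] d1 by (intro arg_cong[of _ _ sum_list] map_cong) (auto simp: diagonalizes_def)
    hence s: "sum_list (map \<phi> x1) = of_nat (length x1) * \<phi> 1" by (simp add: sum_list_triv)
    have "(\<Sum>k<?n. of_int (a k) * sum_list (map \<phi> (xs k))) =
        (\<Sum>k<?n. (if k = i then sum_list (map \<phi> x1) else 0) + (if k = j then - of_nat (length x1) * \<phi> 1 else 0))"
      using ij by (intro sum.cong) (auto simp: a_def xs_def)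
    also have "\<dots> = 0" using i j s by (simp add: sum.distrib)
    finally show "(\<Sum>k<?n. of_int (a k) * sum_list (map \<phi> (xs k))) = 0" .
  qed (rule i)
  thus False by (simp add: a_def)
qed

end

section \<open>Small subgroups\<close>

text \<open>In the rational group ring of the nonzero elements of \<open>F\<close> modulo squares, k
  + \<Sum> [e] acts injectively: every character has values 1 and - 1 and sends it to an odd
  integer. The induction splits along the value s of the character at e: h(c) = g(c) + s g(c e)
  satisfies h(c e) = s h(c), so e can be merged into k + s, and adding both signs recovers 2
  g.\<close>

lemma odd_sum_cancel:
  fixes g :: "'a::field \<Rightarrow> rat"
  assumes F: "subfield F" and sq: "\<And>c x. c \<in> F - {0} \<Longrightarrow> x \<in> F - {0} \<Longrightarrow> g (c * x\<^sup>2) = g c"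
  shows "set es \<subseteq> F - {0} \<Longrightarrow> odd (k + int (length es)) \<Longrightarrow>
    (\<And>c. c \<in> F - {0} \<Longrightarrow> of_int k * g c + (\<Sum>e\<leftarrow>es. g (c * e)) = 0) \<Longrightarrow> c \<in> F - {0} \<Longrightarrow> g c = 0"
  using sq
proof (induction es arbitrary: g k c)
  case Nil
  hence "of_int k * g c = 0" by fastforce
  moreover have "k \<noteq> 0" using Nil.prems(2) by auto
  ultimately show ?case by simp
next
  case (Cons e es)
  have e: "e \<in> F - {0}" using Cons.prems(1) by simp
  have ce: "c * e \<in> F - {0}" if "c \<in> F - {0}" for c using that e F by (auto simp: subfield_mult)
  have step: "g c + s * g (c * e) = 0" if s: "s = 1 \<or> s = (- 1 :: rat)" and c: "c \<in> F - {0}" for s c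
  proof -
    define j where "j = (if s = 1 then 1 else - 1 :: int)"
    have j: "of_int j = s" using s by (auto simp: j_def)
    have ss: "s * s = 1" using s by auto
    show ?thesis
    proof (rule Cons.IH[where g = "\<lambda>c. g c + s * g (c * e)" and k = "k + j"])
      show "odd (k + j + int (length es))" using Cons.prems(2) by (auto simp: j_def)
      fix c assume c: "c \<in> F - {0}"
      have gce: "g (c * e * e) = g c" using Cons.prems(5)[OF c e] by (simp add: power2_eq_square mult.assoc)
      have 1: "of_int k * g c + g (c * e) + (\<Sum>b\<leftarrow>es. g (c * b)) = 0"
        using Cons.prems(3)[OF c] by simp
      have "of_int k * g (c * e) + g (c * e * e) + (\<Sum>b\<leftarrow>es. g (c * e * b)) = 0"
        using Cons.prems(3)[OF ce[OF c]] by simp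
      hence 2: "of_int k * g (c * e) + g c + (\<Sum>b\<leftarrow>es. g (c * b * e)) = 0"
      proof -
        have "c * e * b = c * b * e" for b by (simp add: mult_ac)
        thus ?thesis using \<open>of_int k * g (c * e) + g (c * e * e) + (\<Sum>b\<leftarrow>es. g (c * e * b)) = 0\<close>
          unfolding gce by (simp only:)
      qed
      have "of_int (k + j) * (g c + s * g (c * e)) + (\<Sum>b\<leftarrow>es. g (c * b) + s * g (c * b * e)) =
          (of_int k * g c + g (c * e) + (\<Sum>b\<leftarrow>es. g (c * b))) +
          s * (of_int k * g (c * e) + g c + (\<Sum>b\<leftarrow>es. g (c * b * e))) + (s * s - 1) * g (c * e)"
        by (simp add: j sum_list_addf sum_list_const_mult algebra_simps)
      thus "of_int (k + j) * (g c + s * g (c * e)) + (\<Sum>b\<leftarrow>es. g (c * b) + s * g (c * b * e)) = 0"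
        using 1 2 ss by simp
    next
      fix c x assume c: "c \<in> F - {0}" and x: "x \<in> F - {0}"
      have "g (c * x\<^sup>2 * e) = g (c * e * x\<^sup>2)" by (simp add: mult_ac)
      thus "g (c * x\<^sup>2) + s * g (c * x\<^sup>2 * e) = g c + s * g (c * e)"
        using Cons.prems(5)[OF c x] Cons.prems(5)[OF ce[OF c] x] by simp
    qed (use Cons.prems(1) c in auto)
  qed
  from step[of 1, OF _ Cons.prems(4)] step[of "- 1", OF _ Cons.prems(4)] show ?case by simp
qed

lemma odd_part: "(m::nat) > 0 \<Longrightarrow> \<exists>k q. odd q \<and> m = 2 ^ k * q"
proof (induction m rule: less_induct)
  case (less m)
  show ?case
  proof (cases "odd m")
    case True thus ?thesis by (intro exI[of _ 0] exI[of _ m]) simp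
  next
    case False
    then obtain n where n: "m = 2 * n" by (auto elim: evenE)
    hence "n < m" "n > 0" using less.prems by auto
    then obtain k q where "odd q" "n = 2 ^ k * q" using less.IH[of n] by blast
    thus ?thesis using n by (intro exI[of _ "Suc k"] exI[of _ q]) simp
  qed
qed

context galois_extension
begin

lemma id_G: "id \<in> G"
  using subgroup_Gal[of K] by (simp add: subgroup_of_def)

lemma comp_G: "\<sigma> \<in> G \<Longrightarrow> \<tau> \<in> G \<Longrightarrow> \<sigma> \<circ> \<tau> \<in> G"
  using subgroup_Gal[of K] by (simp add: subgroup_of_def)

lemma finite_subgroupI:
  assumes "H \<subseteq> G" "id \<in> H" "\<And>\<sigma> \<tau>. \<sigma> \<in> H \<Longrightarrow> \<tau> \<in> H \<Longrightarrow> \<sigma> \<circ> \<tau> \<in> H"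
  shows "subgroup_of H G"
proof -
  have "inv_into UNIV \<sigma> \<in> H" if s: "\<sigma> \<in> H" for \<sigma>
  proof -
    have b: "bij \<sigma>" using Gal_field_aut assms(1) s by (auto simp: field_aut_def)
    have "inj_on (\<lambda>\<tau>. \<sigma> \<circ> \<tau>) H" using b by (auto simp: inj_on_def bij_def fun_eq_iff dest: injD)
    moreover have "(\<lambda>\<tau>. \<sigma> \<circ> \<tau>) ` H \<subseteq> H" using assms(3) s by auto
    moreover have "finite H" using assms(1) finite_G finite_subset by blast
    ultimately have "(\<lambda>\<tau>. \<sigma> \<circ> \<tau>) ` H = H" using endo_inj_surj by blast
    then obtain \<tau> where t: "\<tau> \<in> H" "\<sigma> \<circ> \<tau> = id" using assms(2) by (metis imageE)
    have "inv_into UNIV \<sigma> = \<tau>"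
    proof
      fix x
      have "\<sigma> (\<tau> x) = x" using t(2) by (metis comp_apply id_apply)
      thus "inv_into UNIV \<sigma> x = \<tau> x" using b by (metis bij_def inv_f_f)
    qed
    thus ?thesis using t by simp
  qed
  thus ?thesis using assms by (auto simp: subgroup_of_def)
qed

lemma funpow_G: "g \<in> G \<Longrightarrow> g ^^ n \<in> G"
  by (induction n) (auto simp: id_G[unfolded id_def[symmetric]] id_G comp_G)

lemma funpow_cancel:
  assumes "g \<in> G" "g ^^ i = g ^^ j" "i \<le> j"
  shows "g ^^ (j - i) = id"
proof -
  have b: "bij (g ^^ i)" using Gal_field_aut[OF funpow_G[OF assms(1)]] by (simp add: field_aut_def)
  have "g ^^ i \<circ> g ^^ (j - i) = g ^^ (i + (j - i))" by (rule funpow_add[symmetric])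
  also have "\<dots> = g ^^ i" using assms by simp
  finally have "g ^^ i \<circ> g ^^ (j - i) = g ^^ i" .
  hence "(g ^^ i) ((g ^^ (j - i)) x) = (g ^^ i) x" for x by (metis comp_apply)
  hence "(g ^^ (j - i)) x = x" for x using b by (simp add: bij_def inj_eq)
  thus ?thesis by auto
qed

text \<open>Write the order of \<open>g\<close> as 2^k q with q odd. If q = 1, then k is at least 2
  because g^2 is nontrivial, and g^(2^(k - 2)) has order 4. Otherwise g^(2^k) has the odd order q >
  1.\<close>

lemma exists_special_subgroup:
  assumes g: "g \<in> G" and gg: "g \<circ> g \<noteq> id"
  shows "(\<exists>h\<in>G. h ^^ 4 = id \<and> h ^^ 2 \<noteq> id) \<or> (\<exists>H. subgroup_of H G \<and> odd (card H) \<and> card H > 1)"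
proof -
  have "\<not> inj (\<lambda>i. g ^^ i)"
  proof
    assume "inj (\<lambda>i. g ^^ i)"
    moreover have "range (\<lambda>i. g ^^ i) \<subseteq> G" using funpow_G[OF g] by blast
    ultimately show False using finite_G finite_subset range_inj_infinite by blast
  qed
  then obtain i j where ij: "i \<noteq> j" "g ^^ i = g ^^ j" by (auto simp: inj_def)
  hence ex: "\<exists>m. m > 0 \<and> g ^^ m = id"
    using funpow_cancel[OF g, of i j] funpow_cancel[OF g, of j i]
    by (metis linorder_neqE_nat nat_less_le zero_less_diff)
  define m where "m = (LEAST m. m > 0 \<and> g ^^ m = id)"
  have m: "m > 0" "g ^^ m = id" using LeastI_ex[OF ex] by (auto simp: m_def)
  have min: "g ^^ n \<noteq> id" if "0 < n" "n < m" for n using not_less_Least[of n "\<lambda>m. m > 0 \<and> g ^^ m = id"] that by (auto simp: m_def)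
  obtain k q where kq: "odd q" "m = 2 ^ k * q" using odd_part[OF m(1)] by blast
  show ?thesis
  proof (cases "q = 1")
    case True
    have "m \<noteq> 1" "m \<noteq> 2" using m(2) gg by (auto simp: numeral_2_eq_2)
    hence "k \<ge> 2" using kq True by (cases k; cases "k - 1") auto
    then obtain l where k: "k = Suc (Suc l)" using le_Suc_ex[of 2 k] by auto
    define h where "h = g ^^ (2 ^ l)"
    have hn: "h ^^ n = g ^^ (2 ^ l * n)" for n by (simp add: h_def funpow_mult)
    have "h ^^ 4 = id" using m kq True by (simp add: hn k mult.commute)
    moreover have "h ^^ 2 \<noteq> id" unfolding hn by (rule min) (use kq True in \<open>auto simp: k\<close>)
    moreover have "h \<in> G" by (simp add: h_def funpow_G[OF g])
    ultimately show ?thesis by blast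
  next
    case False
    hence q: "q > 1" using kq by (cases q) auto
    define h where "h = g ^^ (2 ^ k)"
    have h: "h \<in> G" by (simp add: h_def funpow_G[OF g])
    have hn: "h ^^ n = g ^^ (2 ^ k * n)" for n by (simp add: h_def funpow_mult)
    have hq: "h ^^ q = id" using m kq by (simp add: hn)
    have hmod: "h ^^ (n mod q) = h ^^ n" for n
    proof -
      have "h ^^ n = h ^^ (n mod q + q * (n div q))" by simp
      also have "\<dots> = h ^^ (n mod q) \<circ> (h ^^ q) ^^ (n div q)" by (simp only: funpow_add funpow_mult mult.commute)
      finally show ?thesis by (simp add: hq)
    qed
    define H where "H = (\<lambda>i. h ^^ i) ` {..<q}"
    have inj: "inj_on (\<lambda>i. h ^^ i) {..<q}"
    proof (rule linorder_inj_onI)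
      fix i j assume ij: "i < j" "i \<in> {..<q}" "j \<in> {..<q}"
      show "h ^^ i \<noteq> h ^^ j"
      proof
        assume "h ^^ i = h ^^ j"
        from funpow_cancel[OF h this] ij have "g ^^ (2 ^ k * (j - i)) = id" by (simp add: hn)
        moreover have "0 < 2 ^ k * (j - i)" "2 ^ k * (j - i) < m" using ij kq(2) by auto
        ultimately show False using min by blast
      qed
    qed auto
    have "subgroup_of H G"
    proof (rule finite_subgroupI)
      show "H \<subseteq> G" using funpow_G[OF h] by (auto simp: H_def)
      show "id \<in> H" using q by (auto simp: H_def intro!: image_eqI[of _ _ 0])
      fix \<sigma> \<tau> assume "\<sigma> \<in> H" "\<tau> \<in> H"
      then obtain i j where "\<sigma> = h ^^ i" "\<tau> = h ^^ j" by (auto simp: H_def)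
      hence "\<sigma> \<circ> \<tau> = h ^^ ((i + j) mod q)" by (simp add: hmod funpow_add)
      moreover have "(i + j) mod q < q" using q by simp
      ultimately show "\<sigma> \<circ> \<tau> \<in> H" unfolding H_def by blast
    qed
    moreover have "card H = q" using card_image[OF inj] by (simp add: H_def)
    ultimately show ?thesis using q kq(1) by blast
  qed
qed

section \<open>Torsion relations for the three kinds of subgroup\<close>

lemma fixed_id: "fixed_field {id} = UNIV"
  by (simp add: fixed_field_def)

text \<open>An automorphism preserves the trace, hence tr x = - tr x. This is the source of
  orthogonality between eigenspaces.\<close>

lemma tr_negated:
  assumes \<sigma>: "\<sigma> \<in> G" "\<sigma> x = - x"
  shows "tr G x = 0"
proof -
  have "tr G x = tr G (- x)" using tr_aut[OF subgroup_Gal \<sigma>(1), of x] \<sigma>(2) by simp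
  also have "\<dots> = - tr G x" using tr_diff[OF subgroup_Gal[of K], of 0 x] by (simp add: tr_zero[OF subgroup_Gal])
  finally have "2 * tr G x = 0" by (metis mult_2 add.right_inverse)
  thus ?thesis using two by simp
qed

text \<open>The degree as an identity in the field: Dedekind independence at \<open>id\<close> gives
  \<Sum> b^2 / tr (b^2) = 1, and each term has trace 1. \<open>char_0_inj\<close> turns it into an
  equality of numbers.\<close>

lemma orth_basis_length:
  assumes H: "subgroup_of H G" and bs: "orth_basis (*) UNIV (trf H 1) bs"
  shows "(of_nat (length bs) :: 'a) = of_nat (card H)"
proof -
  let ?n = "length bs"
  define \<delta> where "\<delta> i = tr H (bs ! i * bs ! i)" for i
  have \<delta>0: "\<delta> i \<noteq> 0" if "i < ?n" for i
    using orth_basis_nonzero[OF bs, of "bs ! i"] that by (simp add: \<delta>_def trf_def)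
  have \<delta>F: "\<delta> i \<in> fixed_field H" for i using tr_mem[OF H] by (simp add: \<delta>_def)
  define u where "u g = (\<Sum>i<?n. g (bs ! i) * bs ! i / \<delta> i)" for g :: "'a \<Rightarrow> 'a"
  have idH: "id \<in> H" using H by (simp add: subgroup_of_def)
  have "\<forall>g\<in>H. u g - (if g = id then 1 else 0) = 0"
  proof (rule dedekind_independence[where F = UNIV and c = "\<lambda>g. u g - (if g = id then 1 else 0)"])
    fix y :: 'a
    have "y = (\<Sum>i<?n. tr H (y * bs ! i) / \<delta> i * bs ! i)"
      using orth_basis_expand[OF bs, of y] by (simp add: trf_def \<delta>_def)
    also have "\<dots> = (\<Sum>i<?n. \<Sum>g\<in>H. g y * (g (bs ! i) * bs ! i / \<delta> i))"
      by (rule sum.cong[OF refl])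
         (simp add: tr_def sum_distrib_right sum_divide_distrib aut[OF H] mult.assoc cong: sum.cong)
    also have "\<dots> = (\<Sum>g\<in>H. g y * u g)"
      unfolding u_def sum_distrib_left by (rule sum.swap)
    finally have 1: "(\<Sum>g\<in>H. u g * g y) = y" by (simp add: mult.commute)
    have "(\<Sum>g\<in>H. (if g = id then 1 else 0) * g y) = (\<Sum>g\<in>H. if g = id then y else 0)"
      by (rule sum.cong) auto
    also have "\<dots> = y" using finite_subgroup[OF H] idH by simp
    finally show "(\<Sum>g\<in>H. (u g - (if g = id then 1 else 0)) * g y) = 0"
      using 1 by (simp only: left_diff_distrib sum_subtractf diff_self)
  qed (auto simp: finite_subgroup[OF H] aut[OF H])
  hence w: "(\<Sum>i<?n. bs ! i * bs ! i / \<delta> i) = 1" using idH by (auto simp: u_def)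
  have "tr H (bs ! i * bs ! i / \<delta> i) = 1" if "i < ?n" for i
  proof -
    have "inverse (\<delta> i) \<in> fixed_field H" using \<delta>F fixed_subfield[OF H] by (simp add: subfield_inverse)
    from tr_scale[OF H this, of "bs ! i * bs ! i"] show ?thesis
      using \<delta>0[OF that] by (simp add: \<delta>_def divide_inverse mult.commute)
  qed
  hence "tr H (\<Sum>i<?n. bs ! i * bs ! i / \<delta> i) = of_nat ?n" by (simp add: tr_sum[OF H])
  moreover have "tr H 1 = of_nat (card H)"
    using tr_fixed[of 1 H] fixed_subfield[OF H] by (simp add: subfield_1)
  ultimately show ?thesis using w by simp
qed

lemma char_0_inj:
  assumes fr: "formally_real" and eq: "(of_nat m :: 'a) = of_nat n"
  shows "m = n"
proof (rule ccontr)
  assume "m \<noteq> n"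
  hence "m < n \<or> n < m" by auto
  thus False
  proof
    assume "m < n"
    thus False using char_0[OF fr, of "n - m"] eq by (simp add: of_nat_diff)
  next
    assume "n < m"
    thus False using char_0[OF fr, of "m - n"] eq by (simp add: of_nat_diff)
  qed
qed

lemma module_sum_UNIV:
  assumes H: "subgroup_of H G" and bs: "orth_basis (*) UNIV (trf H 1) bs"
  shows "module_sum (fixed_field H) bs = UNIV"
proof -
  interpret bilinear_space "(*)" "fixed_field H" UNIV "trf H 1"
    by (rule bilinear_trf[OF H]) (simp add: invariant_module_def)
  have "x \<in> module_sum (fixed_field H) bs" for x
  proof -
    have "(\<Sum>i<length bs. (trf H 1 x (bs ! i) / trf H 1 (bs ! i) (bs ! i)) * bs ! i) \<in> module_sum (fixed_field H) bs"
      by (rule module_sum_lincomb) (rule orth_basis_coeff_K[OF bs], auto)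
    thus ?thesis using orth_basis_expand[OF bs, of x] by simp
  qed
  thus ?thesis by blast
qed

text \<open>The diagonal entries of the trace form of the odd extension L / L^H are sums of squares in L, hence
  multiplication by them fixes its transfer; as the rank is odd, the form itself can be cancelled.\<close>
lemma \<Phi>_odd_subgroup:
  assumes fr: "formally_real" and \<phi>: "good K \<phi>" and H: "subgroup_of H G" and odd: "odd (card H)"
  shows "\<Phi> \<phi> (fixed_field {id}) 1 = of_nat (card H) * \<Phi> \<phi> (fixed_field H) 1"
proof -
  let ?F = "fixed_field H" and ?n = "card H"
  have F: "intermediate ?F" by (rule intermediate_fixed[OF H])
  have Fs: "subfield ?F" by (rule fixed_subfield[OF H])
  have n: "?n > 0" using odd by (cases ?n) auto
  note n0 = char_0[OF fr n]
  obtain w where w: "tr H w \<noteq> 0" using tr_nonzero[OF H] by blast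
  have "\<exists>bs. orth_basis (*) UNIV (trf H 1) bs"
  proof (rule trf_orth_exists[OF H])
    show "invariant_module ?F UNIV" by (simp add: invariant_module_def)
    fix x :: 'a assume "x \<noteq> 0"
    thus "\<exists>y\<in>UNIV. trf H 1 x y \<noteq> 0" using w by (intro bexI[of _ "w / x"]) (auto simp: trf_def)
  qed
  then obtain bs where bs: "orth_basis (*) UNIV (trf H 1) bs" by blast
  have len: "length bs = ?n" by (rule char_0_inj[OF fr orth_basis_length[OF H bs]])
  define e where "e b = tr H (b * b)" for b
  have eF: "e b \<in> ?F - {0}" if "b \<in> set bs" for b
    using orth_basis_nonzero[OF bs that] tr_mem[OF H] by (auto simp: e_def trf_def)
  have enF: "e b / of_nat ?n \<in> ?F - {0}" if "b \<in> set bs" for b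
    using eF[OF that] Fs n0 by (auto simp: subfield_closed)
  \<comment> \<open>The factor \<open>card H\<close> comes from \<open>tr_tr\<close>. It is divided
    out in the entries \<open>e b / of_nat ?n\<close> and then removed by
    \<open>\<Phi>_of_nat\<close>.\<close>
  have trH: "of_nat ?n * tr G (b * b' * z) = tr G (tr H (b * b') * z)" if "z \<in> ?F" for b b' z
    using tr_tr[OF H, of "b * b' * z"] tr_scale[OF H that, of "b * b'"] by (simp add: mult.commute)
  have orth: "sorted_wrt (\<lambda>b b'. \<forall>z\<in>?F. tr G (b * b' * z) = 0) bs"
    unfolding sorted_wrt_iff_nth_less
  proof (intro allI impI ballI)
    fix i j z assume ij: "i < j" "j < length bs" and z: "z \<in> ?F"
    have "tr H (bs ! i * bs ! j) = 0" using orth_basis_orth[OF bs, of i j] ij by (simp add: trf_def)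
    hence "of_nat ?n * tr G (bs ! i * bs ! j * z) = 0" using trH[OF z] by (simp add: tr_zero[OF subgroup_Gal])
    thus "tr G (bs ! i * bs ! j * z) = 0" using n0 by simp
  qed
  have d: "tr G (b * b * z) = tr G (e b / of_nat ?n * z)" if "z \<in> ?F" for b z
  proof -
    have "(1 / of_nat ?n :: 'a) \<in> K" using K by (simp add: subfield_closed)
    hence "tr G (e b / of_nat ?n * z) = 1 / of_nat ?n * tr G (e b * z)"
      using tr_scale[OF subgroup_Gal[of K], of "1 / of_nat ?n" "e b * z"] by (simp add: fixed_G)
    also have "\<dots> = tr G (b * b * z)" unfolding e_def trH[OF that, symmetric] using n0 by simp
    finally show ?thesis by simp
  qed
  have U: "\<Phi> \<phi> UNIV c = (\<Sum>b\<leftarrow>bs. \<Phi> \<phi> ?F (c * e b))" if c: "c \<in> ?F - {0}" for c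
  proof -
    have "\<Phi> \<phi> UNIV c = (\<Sum>b\<leftarrow>bs. \<Phi> \<phi> ?F (c * (e b / of_nat ?n)))"
      using \<Phi>_module_sum[OF fr \<phi> F c orth enF d] by (simp add: module_sum_UNIV[OF H bs])
    also have "\<dots> = (\<Sum>b\<leftarrow>bs. \<Phi> \<phi> ?F (c * e b))"
    proof (intro arg_cong[of _ _ sum_list] map_cong refl)
      fix b assume "b \<in> set bs"
      hence "c * e b \<in> ?F - {0}" using eF c Fs by (auto simp: subfield_mult)
      from \<Phi>_of_nat(2)[OF fr \<phi> F n this] show "\<Phi> \<phi> ?F (c * (e b / of_nat ?n)) = \<Phi> \<phi> ?F (c * e b)" by simp
    qed
    finally show ?thesis .
  qed
  obtain hs where hs: "set hs = H" "distinct hs" using finite_distinct_list[OF finite_subgroup[OF H]] by blast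
  \<comment> \<open>The conjugates \<open>h b\<close> lie in the big field and in general not in
    \<open>?F\<close>, so this helps only for the transfer from the big field.\<close>
  have e_sq: "e b = sum_list (map (\<lambda>x. x\<^sup>2) (map (\<lambda>h. h b) hs))" for b
  proof -
    have "e b = (\<Sum>h\<in>set hs. (h b)\<^sup>2)" unfolding e_def tr_def hs(1)
      by (rule sum.cong) (auto simp: aut[OF H] power2_eq_square)
    thus ?thesis by (simp add: sum_list_distinct_conv_sum_set[OF hs(2)] o_def)
  qed
  have fix_e: "\<Phi> \<phi> ?F (e b) = \<Phi> \<phi> ?F 1" if b: "b \<in> set bs" for b
  proof -
    \<comment> \<open>Invariance of the transfer from the big field under \<open>e b\<close>,
      expanded by \<open>U\<close>, says that the values g(c e b') sum to 0 over the odd number of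
      basis vectors b'. \<open>odd_sum_cancel\<close> then gives g = 0.\<close>
    define g where "g c = \<Phi> \<phi> ?F (c * e b) - \<Phi> \<phi> ?F c" for c
    have "g 1 = 0"
    proof (rule odd_sum_cancel[OF Fs, where es = "map e bs" and k = 0])
      show "set (map e bs) \<subseteq> ?F - {0}" using eF by auto
      show "odd (0 + int (length (map e bs)))" using odd len by simp
      fix c x assume c: "c \<in> ?F - {0}" and x: "x \<in> ?F - {0}"
      have ce: "c * e b \<in> ?F - {0}" using c eF[OF b] Fs by (auto simp: subfield_mult)
      have eq: "c * x\<^sup>2 * e b = c * e b * x\<^sup>2" by (simp add: mult_ac)
      show "g (c * x\<^sup>2) = g c"
        unfolding g_def eq using \<Phi>_square[OF fr \<phi> F ce x] \<Phi>_square[OF fr \<phi> F c x] by simp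
    next
      fix c assume c: "c \<in> ?F - {0}"
      have ce: "c * e b \<in> ?F - {0}" using c eF[OF b] Fs by (auto simp: subfield_mult)
      have "\<Phi> \<phi> UNIV (c * e b) = \<Phi> \<phi> UNIV c"
        by (rule \<Phi>_sum_of_squares[OF fr \<phi> intermediate_UNIV _ e_sq]) (use eF[OF b] c in auto)
      hence "(\<Sum>b'\<leftarrow>bs. \<Phi> \<phi> ?F (c * e b * e b')) = (\<Sum>b'\<leftarrow>bs. \<Phi> \<phi> ?F (c * e b'))"
        using U[OF c] U[OF ce] by simp
      moreover have "c * e b * e b' = c * e b' * e b" for b' by (simp add: mult_ac)
      ultimately show "of_int 0 * g c + (\<Sum>a\<leftarrow>map e bs. g (c * a)) = 0"
        by (simp add: g_def sum_list_subtractf o_def)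
    qed (use Fs in \<open>auto simp: subfield_1\<close>)
    thus ?thesis by (simp add: g_def)
  qed
  have "\<Phi> \<phi> UNIV 1 = (\<Sum>b\<leftarrow>bs. \<Phi> \<phi> ?F (1 * e b))" by (rule U) (use Fs in \<open>simp add: subfield_1\<close>)
  also have "\<dots> = (\<Sum>b\<leftarrow>bs. \<Phi> \<phi> ?F 1)" using fix_e by (intro arg_cong[of _ _ sum_list] map_cong) auto
  finally show ?thesis by (simp add: fixed_id sum_list_triv len)
qed

lemma module_sum_pair: "module_sum F [1, b] = {x + b * y |x y. x \<in> F \<and> y \<in> F}"
  by auto

text \<open>\<sigma> fixes \<open>F\<close> and negates \<open>b\<close>, so \<open>F\<close> and b
  F are orthogonal by \<open>tr_negated\<close> and contribute the transfers of <1> and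
  <b^2>.\<close>

lemma \<Phi>_quadratic:
  assumes fr: "formally_real" and \<phi>: "good K \<phi>" and F: "intermediate F"
    and b: "b \<noteq> 0" "b\<^sup>2 \<in> F" and \<sigma>: "\<sigma> \<in> G" "\<sigma> b = - b" "\<And>x. x \<in> F \<Longrightarrow> \<sigma> x = x"
  shows "\<Phi> \<phi> (module_sum F [1, b]) 1 = \<Phi> \<phi> F 1 + \<Phi> \<phi> F (b\<^sup>2)"
proof -
  have one: "(1::'a) \<in> F" using F by (simp add: intermediate_def subfield_1)
  have "tr G (1 * b * z) = 0" if "z \<in> F" for z
    using \<sigma> that by (intro tr_negated[OF \<sigma>(1)]) (simp add: aut[OF subgroup_Gal \<sigma>(1)])
  moreover have "x\<^sup>2 \<in> F - {0}" if "x \<in> set [1, b]" for x using that one b by auto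
  ultimately show ?thesis
    using \<Phi>_module_sum[OF fr \<phi> F, of 1 "[1, b]" "\<lambda>x. x\<^sup>2"] one
    by (simp add: power2_eq_square del: module_sum.simps)
qed

lemma square_fixed_of_negated: "\<sigma> \<in> G \<Longrightarrow> \<sigma> b = - b \<Longrightarrow> \<sigma> (b\<^sup>2) = b\<^sup>2"
  by (simp add: aut[OF subgroup_Gal])

lemma four: "(4::'a) \<noteq> 0"
proof -
  have "(4::'a) = 2 * 2" by simp
  thus ?thesis using two by (metis mult_eq_0_iff)
qed

text \<open>With y the image of x under an involution, this is the splitting into eigenvectors for 1
  and - 1. Dividing the second part by an eigenvector \<open>e\<close> for - 1 moves it into the
  fixed field.\<close>

lemma half_sum:
  assumes "e \<noteq> 0"
  shows "(x :: 'a) = (x + y) / 2 + e * ((x - y) / (2 * e))"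
proof -
  have "e * ((x - y) / (2 * e)) = (x - y) / 2" using assms by simp
  hence "(x + y) / 2 + e * ((x - y) / (2 * e)) = ((x + y) + (x - y)) / 2" by (simp only: add_divide_distrib)
  also have "\<dots> = 2 * x / 2" by simp
  finally show ?thesis using two by simp
qed

lemma aut_numeral: "\<sigma> \<in> G \<Longrightarrow> \<sigma> (numeral n) = numeral n"
  using aut(10)[OF subgroup_Gal, of \<sigma> "numeral n"] by simp

lemma half_fixed:
  assumes h: "h \<in> G" "h (h x) = x" "h e = - e"
  shows "h ((x + h x) / 2) = (x + h x) / 2" "h ((x - h x) / (2 * e)) = (x - h x) / (2 * e)"
proof -
  note a = aut[OF subgroup_Gal h(1)] aut_numeral[OF h(1)]
  show "h ((x + h x) / 2) = (x + h x) / 2" by (simp add: a h(2) add.commute)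
  have "h ((x - h x) / (2 * e)) = (h x - x) / (2 * - e)" by (simp only: a h(2,3))
  also have "\<dots> = - (x - h x) / - (2 * e)" by (simp only: minus_diff_eq mult_minus_right)
  finally show "h ((x - h x) / (2 * e)) = (x - h x) / (2 * e)" by (simp only: minus_divide_divide)
qed

text \<open>The classical fact that a quadratic extension contained in a cyclic one of degree 4 is
  generated by the root of a sum of two squares. It is made explicit by an element on which h^2 acts
  as - 1.\<close>

lemma \<Phi>_cyclic4:
  assumes fr: "formally_real" and \<phi>: "good K \<phi>" and h: "h \<in> G" and h4: "h ^^ 4 = id" and h2: "h ^^ 2 \<noteq> id"
    and C4: "subgroup_of {id, h, h ^^ 2, h ^^ 3} G"
  shows "\<Phi> \<phi> (fixed_field {id, h ^^ 2}) 1 = 2 * \<Phi> \<phi> (fixed_field {id, h, h ^^ 2, h ^^ 3}) 1"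
proof -
  let ?F = "fixed_field {id, h, h ^^ 2, h ^^ 3}"
  have Fx: "x \<in> ?F \<longleftrightarrow> h x = x" for x by (auto simp: fixed_field_def eval_nat_numeral)
  have Ex: "x \<in> fixed_field {id, h ^^ 2} \<longleftrightarrow> h (h x) = x" for x by (auto simp: fixed_field_def eval_nat_numeral)
  have F: "intermediate ?F" by (rule intermediate_fixed[OF C4])
  have Fs: "subfield ?F" using F by (simp add: intermediate_def)
  note a = aut[OF subgroup_Gal h]
  have hhhh: "h (h (h (h x))) = x" for x using fun_cong[OF h4, of x] by (simp add: eval_nat_numeral)
  obtain x0 where x0: "h (h x0) \<noteq> x0" using h2 by (auto simp: eval_nat_numeral fun_eq_iff)
  \<comment> \<open>On z and w = h z the generator acts as a quarter turn, w going to - z. Hence z w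
    is negated by \<open>h\<close> while z^2 + w^2 is fixed.\<close>
  define z where "z = x0 - h (h x0)"
  define w where "w = h z"
  have z0: "z \<noteq> 0" using x0 by (simp add: z_def)
  moreover have "h w = - z" by (simp add: w_def z_def a hhhh)
  moreover have "w \<noteq> 0" using z0 by (simp add: w_def a)
  ultimately have z: "z \<noteq> 0" "h z = w" "h w = - z" "w \<noteq> 0" by (simp_all add: w_def)
  define b where "b = z * w"
  have b: "b \<noteq> 0" "h b = - b" using z by (auto simp: b_def a)
  have b2: "b\<^sup>2 \<in> ?F" unfolding Fx by (rule square_fixed_of_negated[OF h b(2)])
  define s where "s = z\<^sup>2 + w\<^sup>2"
  \<comment> \<open>Numerator and denominator both change sign under \<open>h\<close>. The identity
    (z^2 - w^2)^2 + 4 (z w)^2 = (z^2 + w^2)^2 becomes b^2 (c^2 + 4) = s^2.\<close>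
  define c where "c = (z\<^sup>2 - w\<^sup>2) / b"
  have sc: "s \<in> ?F" "c \<in> ?F" unfolding Fx using z b by (auto simp: s_def c_def a field_simps)
  have "(c * b)\<^sup>2 = (z\<^sup>2 - w\<^sup>2)\<^sup>2" using b by (simp add: c_def)
  hence eq: "b\<^sup>2 * (c\<^sup>2 + 4) = s\<^sup>2" by (simp add: s_def b_def power2_eq_square algebra_simps)
  have "\<exists>u\<in>?F. \<exists>v\<in>?F. b\<^sup>2 = u\<^sup>2 + v\<^sup>2"
  \<comment> \<open>\<open>?F\<close> may contain a root of - 1 although \<open>K\<close> is
    formally real; then c / 2 is such a root and every element of \<open>?F\<close> is a sum of two
    squares. Otherwise b^2 = s^2 (c^2 + 4) / (c^2 + 4)^2.\<close>
  proof (cases "c\<^sup>2 + 4 = 0")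
    case True
    have "(c / 2)\<^sup>2 * 4 = c\<^sup>2" using four by (simp add: power_divide)
    hence "((c / 2)\<^sup>2 + 1) * 4 = 0" using True by (simp add: distrib_right)
    hence "(c / 2)\<^sup>2 + 1 = 0" using four by (metis mult_eq_0_iff)
    hence c2: "(c / 2)\<^sup>2 = - 1" by (simp only: eq_neg_iff_add_eq_0)
    have "((b\<^sup>2 + 1) / 2)\<^sup>2 + (c / 2 * ((b\<^sup>2 - 1) / 2))\<^sup>2 = ((b\<^sup>2 + 1)\<^sup>2 - (b\<^sup>2 - 1)\<^sup>2) / 4"
      by (simp only: power_mult_distrib c2) (simp add: power_divide diff_divide_distrib[symmetric])
    also have "(b\<^sup>2 + 1)\<^sup>2 - (b\<^sup>2 - 1)\<^sup>2 = 4 * b\<^sup>2" by (simp add: power2_eq_square algebra_simps)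
    finally have "b\<^sup>2 = ((b\<^sup>2 + 1) / 2)\<^sup>2 + (c / 2 * ((b\<^sup>2 - 1) / 2))\<^sup>2" using four by simp
    moreover have "(b\<^sup>2 + 1) / 2 \<in> ?F" "c / 2 * ((b\<^sup>2 - 1) / 2) \<in> ?F"
      using b2 sc Fs by (auto intro!: subfield_closed)
    ultimately show ?thesis by blast
  next
    case False
    have "(s * c / (c\<^sup>2 + 4))\<^sup>2 + (2 * s / (c\<^sup>2 + 4))\<^sup>2 = s\<^sup>2 * (c\<^sup>2 + 4) / (c\<^sup>2 + 4)\<^sup>2"
      by (simp add: power_divide power_mult_distrib add_divide_distrib[symmetric] distrib_left mult.commute)
    also have "\<dots> = s\<^sup>2 / (c\<^sup>2 + 4)" using False by (simp add: power2_eq_square[of "c\<^sup>2 + 4"])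
    also have "\<dots> = b\<^sup>2" using eq False by (simp add: field_simps)
    finally have "b\<^sup>2 = (s * c / (c\<^sup>2 + 4))\<^sup>2 + (2 * s / (c\<^sup>2 + 4))\<^sup>2" by simp
    moreover have "s * c / (c\<^sup>2 + 4) \<in> ?F" "2 * s / (c\<^sup>2 + 4) \<in> ?F"
      using sc Fs by (auto intro!: subfield_closed)
    ultimately show ?thesis by blast
  qed
  then obtain u v where uv: "u \<in> ?F" "v \<in> ?F" "b\<^sup>2 = u\<^sup>2 + v\<^sup>2" by blast
  have one: "(1::'a) \<in> ?F - {0}" using Fs by (simp add: subfield_1)
  have "set [u, v] \<subseteq> ?F" "b\<^sup>2 = sum_list (map (\<lambda>x. x\<^sup>2) [u, v])" using uv by auto
  from \<Phi>_sum_of_squares[OF fr \<phi> F this _ one] have psi: "\<Phi> \<phi> ?F (b\<^sup>2) = \<Phi> \<phi> ?F 1" using b(1) by simp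
  have "fixed_field {id, h ^^ 2} = module_sum ?F [1, b]"
  proof (intro equalityI subsetI)
    fix x assume "x \<in> fixed_field {id, h ^^ 2}"
    hence x: "h (h x) = x" by (simp only: Ex)
    note half_sum[OF b(1), of x "h x"]
    moreover have "(x + h x) / 2 \<in> ?F" unfolding Fx by (rule half_fixed(1)[OF h x b(2)])
    moreover have "(x - h x) / (2 * b) \<in> ?F" unfolding Fx by (rule half_fixed(2)[OF h x b(2)])
    ultimately show "x \<in> module_sum ?F [1, b]" unfolding module_sum_pair by blast
  next
    fix x assume "x \<in> module_sum ?F [1, b]"
    then obtain p q where "x = p + b * q" "h p = p" "h q = q" unfolding module_sum_pair Fx by blast
    thus "x \<in> fixed_field {id, h ^^ 2}" unfolding Ex using b(2) by (simp add: a)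
  qed
  thus ?thesis using \<Phi>_quadratic[OF fr \<phi> F b(1) b2 h b(2)] Fx psi by simp
qed

text \<open>By Dedekind independence the sum of \<chi>(g) g over the group is nonzero at some x, for
  the character \<chi> with value 1 at \<sigma> and - 1 at \<tau>. The resulting element lies in the
  eigenspace of \<chi>.\<close>

lemma klein_eigenvector:
  assumes \<sigma>: "\<sigma> \<in> G" and \<tau>: "\<tau> \<in> G" and ne: "\<sigma> \<noteq> id" "\<tau> \<noteq> id" "\<sigma> \<noteq> \<tau>"
    and inv: "\<sigma> \<circ> \<sigma> = id" "\<tau> \<circ> \<tau> = id" "\<tau> \<circ> \<sigma> = \<sigma> \<circ> \<tau>"
  shows "\<exists>b. b \<noteq> 0 \<and> \<sigma> b = b \<and> \<tau> b = - b"
proof -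
  note a = aut[OF subgroup_Gal \<sigma>] aut[OF subgroup_Gal \<tau>]
  have ss: "\<sigma> (\<sigma> x) = x" for x using fun_cong[OF inv(1), of x] by simp
  have tt: "\<tau> (\<tau> x) = x" for x using fun_cong[OF inv(2), of x] by simp
  have ts: "\<tau> (\<sigma> x) = \<sigma> (\<tau> x)" for x using fun_cong[OF inv(3), of x] by simp
  have dist: "\<sigma> \<circ> \<tau> \<noteq> id" "\<sigma> \<circ> \<tau> \<noteq> \<sigma>" "\<sigma> \<circ> \<tau> \<noteq> \<tau>"
  proof -
    show "\<sigma> \<circ> \<tau> \<noteq> id"
    proof
      assume "\<sigma> \<circ> \<tau> = id"
      hence "\<sigma> (\<sigma> (\<tau> x)) = \<sigma> x" for x by (metis comp_apply id_apply)
      thus False using ne(3) ss by auto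
    qed
    show "\<sigma> \<circ> \<tau> \<noteq> \<sigma>"
    proof
      assume "\<sigma> \<circ> \<tau> = \<sigma>"
      hence "\<sigma> (\<sigma> (\<tau> x)) = \<sigma> (\<sigma> x)" for x by (metis comp_apply)
      thus False using ne(2) ss by auto
    qed
    show "\<sigma> \<circ> \<tau> \<noteq> \<tau>"
    proof
      assume "\<sigma> \<circ> \<tau> = \<tau>"
      hence "\<sigma> (\<tau> (\<tau> x)) = \<tau> (\<tau> x)" for x by (metis comp_apply)
      thus False using ne(1) tt by auto
    qed
  qed
  let ?S = "{id, \<sigma>, \<tau>, \<sigma> \<circ> \<tau>}"
  define c where "c g = (if g = id \<or> g = \<sigma> then 1 else - 1 :: 'a)" for g
  have "\<exists>x. (\<Sum>g\<in>?S. c g * g x) \<noteq> 0"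
  proof (rule ccontr)
    assume "\<not> ?thesis"
    hence "\<forall>g\<in>?S. c g = 0"
      by (intro dedekind_independence[where F = UNIV]) (auto simp: a)
    thus False by (simp add: c_def)
  qed
  then obtain x where "(\<Sum>g\<in>?S. c g * g x) \<noteq> 0" by blast
  moreover have "(\<Sum>g\<in>?S. c g * g x) = x + \<sigma> x - \<tau> x - \<sigma> (\<tau> x)"
    using ne dist by (auto simp: c_def)
  ultimately have "x + \<sigma> x - \<tau> x - \<sigma> (\<tau> x) \<noteq> 0" by simp
  moreover have "\<sigma> (x + \<sigma> x - \<tau> x - \<sigma> (\<tau> x)) = x + \<sigma> x - \<tau> x - \<sigma> (\<tau> x)"
    by (simp add: a ss)
  moreover have "\<tau> (x + \<sigma> x - \<tau> x - \<sigma> (\<tau> x)) = - (x + \<sigma> x - \<tau> x - \<sigma> (\<tau> x))"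
    by (simp add: a ts tt)
  ultimately show ?thesis by blast
qed

text \<open>The big field contributes <1>, <b^2>, <c^2> and <(b c)^2>. Each of the three quadratic
  subextensions contributes <1> and one of the others, so <1> is counted twice too often, whence the
  coefficient - 2.\<close>

lemma \<Phi>_klein:
  assumes fr: "formally_real" and \<phi>: "good K \<phi>"
    and \<sigma>: "\<sigma> \<in> G" and \<tau>: "\<tau> \<in> G" and ne: "\<sigma> \<noteq> id" "\<tau> \<noteq> id" "\<sigma> \<noteq> \<tau>"
    and inv: "\<sigma> \<circ> \<sigma> = id" "\<tau> \<circ> \<tau> = id" "\<tau> \<circ> \<sigma> = \<sigma> \<circ> \<tau>"
    and V: "subgroup_of {id, \<sigma>, \<tau>, \<sigma> \<circ> \<tau>} G"
  shows "\<Phi> \<phi> (fixed_field {id}) 1 = \<Phi> \<phi> (fixed_field {id, \<sigma>}) 1 + \<Phi> \<phi> (fixed_field {id, \<tau>}) 1 +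
    \<Phi> \<phi> (fixed_field {id, \<sigma> \<circ> \<tau>}) 1 - 2 * \<Phi> \<phi> (fixed_field {id, \<sigma>, \<tau>, \<sigma> \<circ> \<tau>}) 1"
proof -
  let ?F = "fixed_field {id, \<sigma>, \<tau>, \<sigma> \<circ> \<tau>}"
  note as = aut[OF subgroup_Gal \<sigma>] aut_numeral[OF \<sigma>] and at = aut[OF subgroup_Gal \<tau>] aut_numeral[OF \<tau>]
  note a = as at
  have ss: "\<sigma> (\<sigma> x) = x" for x using fun_cong[OF inv(1), of x] by simp
  have tt: "\<tau> (\<tau> x) = x" for x using fun_cong[OF inv(2), of x] by simp
  have ts: "\<tau> (\<sigma> x) = \<sigma> (\<tau> x)" for x using fun_cong[OF inv(3), of x] by simp
  have F: "intermediate ?F" by (rule intermediate_fixed[OF V])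
  have Fs: "subfield ?F" using F by (simp add: intermediate_def)
  have Fx: "x \<in> ?F \<longleftrightarrow> \<sigma> x = x \<and> \<tau> x = x" for x by (auto simp: fixed_field_def)
  obtain b where b: "b \<noteq> 0" "\<sigma> b = b" "\<tau> b = - b" using klein_eigenvector[OF \<sigma> \<tau> ne inv] by blast
  obtain c where c: "c \<noteq> 0" "\<tau> c = c" "\<sigma> c = - c"
    using klein_eigenvector[OF \<tau> \<sigma> ne(2,1) ne(3)[symmetric] inv(2,1) inv(3)[symmetric]] by blast
  have sq: "b\<^sup>2 \<in> ?F" "c\<^sup>2 \<in> ?F" "(b * c)\<^sup>2 \<in> ?F" unfolding Fx using b c by (auto simp: a power2_eq_square)
  have st: "\<sigma> \<circ> \<tau> \<in> G" using comp_G \<sigma> \<tau> by blast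
  \<comment> \<open>One argument for the three subgroups of order 2: \<open>h\<close> is a group
    element outside \<open>{id, g}\<close>, it acts on the field fixed by \<open>g\<close> as an
    involution, and \<open>e\<close> is fixed by \<open>g\<close> and negated by
    \<open>h\<close>.\<close>
  have quad: "fixed_field {id, g} = module_sum ?F [1, e]"
    if g: "g \<in> G" "g e = e" and gF: "\<And>x. x \<in> ?F \<Longrightarrow> g x = x" and h: "h \<in> G" "h e = - e" "e \<noteq> 0"
      and fix1: "\<And>x. g x = x \<Longrightarrow> h (h x) = x" and fix2: "\<And>x. g x = x \<Longrightarrow> h x = x \<Longrightarrow> x \<in> ?F"
      and comm: "\<And>x. g (h x) = h (g x)" for g h e
  proof (intro equalityI subsetI)
    note a' = aut[OF subgroup_Gal g(1)] aut_numeral[OF g(1)]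
    fix x assume "x \<in> fixed_field {id, g}"
    hence x: "g x = x" by (simp add: fixed_field_def)
    note half = half_fixed[OF h(1) fix1[OF x] h(2)]
    have "(x + h x) / 2 \<in> ?F"
      by (rule fix2[OF _ half(1)]) (simp add: a' comm x)
    moreover have "(x - h x) / (2 * e) \<in> ?F"
      by (rule fix2[OF _ half(2)]) (simp add: a' comm x g(2))
    ultimately show "x \<in> module_sum ?F [1, e]"
      unfolding module_sum_pair using half_sum[OF h(3), of x "h x"] by blast
  next
    fix x assume "x \<in> module_sum ?F [1, e]"
    then obtain p q where "x = p + e * q" "p \<in> ?F" "q \<in> ?F" unfolding module_sum_pair by blast
    thus "x \<in> fixed_field {id, g}" using gF g(2) by (simp add: fixed_field_def aut[OF subgroup_Gal g(1)])
  qed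
  have A: "fixed_field {id, \<sigma>} = module_sum ?F [1, b]"
    by (rule quad[OF \<sigma> b(2) _ \<tau> b(3,1)]) (auto simp: Fx tt ts)
  have B: "fixed_field {id, \<tau>} = module_sum ?F [1, c]"
    by (rule quad[OF \<tau> c(2) _ \<sigma> c(3,1)]) (auto simp: Fx ss ts)
  have C: "fixed_field {id, \<sigma> \<circ> \<tau>} = module_sum ?F [1, b * c]"
  proof (rule quad[OF st _ _ \<sigma>])
    fix x assume x: "(\<sigma> \<circ> \<tau>) x = x" "\<sigma> x = x"
    hence "\<tau> x = x" by (metis comp_apply ts)
    thus "x \<in> ?F" using x Fx by blast
  qed (use b c in \<open>auto simp: Fx a ss ts\<close>)
  have one: "(1::'a) \<in> ?F - {0}" using Fs by (simp add: subfield_1)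
  have "module_sum ?F [1, b, c, b * c] = UNIV"
  proof -
    have "x \<in> module_sum ?F [1, b, c, b * c]" for x
    proof -
      \<comment> \<open>Four times the projections of x to the eigenspaces of the four characters,
        in the order of 1, b, c, b c.\<close>
      define p q r t where pqrt: "p = x + \<sigma> x + \<tau> x + \<sigma> (\<tau> x)" "q = x + \<sigma> x - \<tau> x - \<sigma> (\<tau> x)"
        "r = x - \<sigma> x + \<tau> x - \<sigma> (\<tau> x)" "t = x - \<sigma> x - \<tau> x + \<sigma> (\<tau> x)"
      have cancel: "e * (y / (4 * e)) = y / 4" if "e \<noteq> 0" for e y :: 'a using that by simp
      have "1 * (p / (4 * 1)) + (b * (q / (4 * b)) + (c * (r / (4 * c)) + (b * c * (t / (4 * (b * c))) + 0))) =
          p / 4 + (q / 4 + (r / 4 + t / 4))"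
        using b(1) c(1) by (simp only: cancel one_neq_zero mult_eq_0_iff not_False_eq_True simp_thms add_0_right)
      also have "\<dots> = (p + (q + (r + t))) / 4" by (simp only: add_divide_distrib)
      also have "p + (q + (r + t)) = 4 * x" by (simp add: pqrt)
      also have "4 * x / 4 = x" using four by simp
      finally have x: "x = 1 * (p / (4 * 1)) + (b * (q / (4 * b)) + (c * (r / (4 * c)) + (b * c * (t / (4 * (b * c))) + 0)))"
        by simp
      have pos: "g (y / (4 * e)) = y / (4 * e)" if "g \<in> G" "g y = y" "g e = e" for g y e
        using that by (simp add: aut[OF subgroup_Gal that(1)] aut_numeral)
      have neg: "g (y / (4 * e)) = y / (4 * e)" if "g \<in> G" "g y = - y" "g e = - e" for g y e
        using that by (simp add: aut[OF subgroup_Gal that(1)] aut_numeral)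
      have "p / (4 * 1) \<in> ?F" unfolding Fx
        by (intro conjI pos \<sigma> \<tau>) (simp_all add: pqrt a ss tt ts)
      moreover have "q / (4 * b) \<in> ?F" unfolding Fx
        by (intro conjI pos[OF \<sigma>] neg[OF \<tau>] b) (simp_all add: pqrt a ss tt ts)
      moreover have "r / (4 * c) \<in> ?F" unfolding Fx
        by (intro conjI neg[OF \<sigma>] pos[OF \<tau>] c) (simp_all add: pqrt a ss tt ts)
      moreover have "t / (4 * (b * c)) \<in> ?F" unfolding Fx
        using b c by (intro conjI neg[OF \<sigma>] neg[OF \<tau>]) (simp_all add: pqrt a ss tt ts)
      ultimately show ?thesis unfolding module_sum.simps using x by blast
    qed
    thus ?thesis by blast
  qed
  moreover have "\<Phi> \<phi> (module_sum ?F [1, b, c, b * c]) 1 = (\<Sum>x\<leftarrow>[1, b, c, b * c]. \<Phi> \<phi> ?F (1 * x\<^sup>2))"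
  proof (rule \<Phi>_module_sum[OF fr \<phi> F one])
    have neg: "tr G (x * z) = 0" if "g \<in> G" "g x = - x" "g z = z" for g x z
      using that by (intro tr_negated[of g]) (simp_all add: aut[OF subgroup_Gal])
    have "tr G (1 * b * z) = 0" "tr G (1 * c * z) = 0" "tr G (1 * (b * c) * z) = 0" "tr G (b * c * z) = 0"
      "tr G (b * (b * c) * z) = 0" "tr G (c * (b * c) * z) = 0" if "z \<in> ?F" for z
      using that b c neg[OF \<tau>, of "1 * b" z] neg[OF \<sigma>, of "1 * c" z] neg[OF \<sigma>, of "1 * (b * c)" z] neg[OF \<sigma>, of "b * c" z]
        neg[OF \<sigma>, of "b * (b * c)" z] neg[OF \<tau>, of "c * (b * c)" z] by (simp_all add: Fx a)
    thus "sorted_wrt (\<lambda>b b'. \<forall>z\<in>?F. tr G (b * b' * z) = 0) [1, b, c, b * c]" by simp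
    fix x assume "x \<in> set [1, b, c, b * c]"
    thus "x\<^sup>2 \<in> ?F - {0}" using one sq b c by auto
  qed (simp add: power2_eq_square)
  ultimately have U: "\<Phi> \<phi> UNIV 1 = \<Phi> \<phi> ?F 1 + \<Phi> \<phi> ?F (b\<^sup>2) + \<Phi> \<phi> ?F (c\<^sup>2) + \<Phi> \<phi> ?F ((b * c)\<^sup>2)"
    by simp
  have A': "\<Phi> \<phi> (fixed_field {id, \<sigma>}) 1 = \<Phi> \<phi> ?F 1 + \<Phi> \<phi> ?F (b\<^sup>2)"
    unfolding A by (rule \<Phi>_quadratic[OF fr \<phi> F b(1) sq(1) \<tau> b(3)]) (simp add: Fx)
  have B': "\<Phi> \<phi> (fixed_field {id, \<tau>}) 1 = \<Phi> \<phi> ?F 1 + \<Phi> \<phi> ?F (c\<^sup>2)"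
    unfolding B by (rule \<Phi>_quadratic[OF fr \<phi> F c(1) sq(2) \<sigma> c(3)]) (simp add: Fx)
  have C': "\<Phi> \<phi> (fixed_field {id, \<sigma> \<circ> \<tau>}) 1 = \<Phi> \<phi> ?F 1 + \<Phi> \<phi> ?F ((b * c)\<^sup>2)"
    unfolding C by (rule \<Phi>_quadratic[OF fr \<phi> F _ sq(3) \<sigma>]) (use b c in \<open>auto simp: Fx a\<close>)
  show ?thesis unfolding fixed_id U A' B' C' by simp
qed

lemma injective_imp_quadratic:
  assumes reps: "subgroup_class_reps G reps" and inj: "dress_injective K reps" and neq: "K \<noteq> UNIV"
  shows "\<exists>\<alpha>\<in>K. \<alpha> \<noteq> 0 \<and> \<not> sum_of_squares_in K \<alpha> \<and> (\<exists>s. s\<^sup>2 = \<alpha> \<and> adjoin K s = UNIV)"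
proof -
  have fr: "formally_real" by (rule injective_formally_real[OF reps inj neq])
  note no_rel = injective_no_relation[OF reps inj fr]
  have no_odd: False if H: "subgroup_of H G" "odd (card H)" "card H > 1" for H
  proof (rule no_rel[OF subgroup_trivial, of "[(int (card H), H)]"])
    fix \<phi> assume "good K \<phi>"
    from \<Phi>_odd_subgroup[OF fr this H(1,2)]
    show "\<Phi> \<phi> (fixed_field {id}) 1 = (\<Sum>(m, H)\<leftarrow>[(int (card H), H)]. of_int m * \<Phi> \<phi> (fixed_field H) 1)" by simp
  qed (use H in auto)
  have no_c4: False if h: "h \<in> G" "h ^^ 4 = id" "h ^^ 2 \<noteq> id" for h
  proof -
    let ?C = "{id, h, h ^^ 2, h ^^ 3}"
    have hh: "h (h (h (h x))) = x" for x using fun_cong[OF h(2), of x] by (simp add: eval_nat_numeral)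
    have C: "subgroup_of ?C G"
    proof (rule finite_subgroupI)
      show "?C \<subseteq> G" using h(1) id_G funpow_G[OF h(1)] by blast
      fix \<sigma> \<tau> assume "\<sigma> \<in> ?C" "\<tau> \<in> ?C"
      thus "\<sigma> \<circ> \<tau> \<in> ?C" using hh by (auto simp: fun_eq_iff eval_nat_numeral)
    qed simp
    have C2: "subgroup_of {id, h ^^ 2} G"
    proof (rule finite_subgroupI)
      show "{id, h ^^ 2} \<subseteq> G" using id_G funpow_G[OF h(1)] by blast
      fix \<sigma> \<tau> assume "\<sigma> \<in> {id, h ^^ 2}" "\<tau> \<in> {id, h ^^ 2}"
      thus "\<sigma> \<circ> \<tau> \<in> {id, h ^^ 2}" using hh by (auto simp: fun_eq_iff eval_nat_numeral)
    qed simp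
    \<comment> \<open>Makes the two subgroups differ in cardinality, as
      \<open>injective_no_relation\<close> asks.\<close>
    have "h \<notin> {id, h ^^ 2}"
    proof
      assume "h \<in> {id, h ^^ 2}"
      hence "h = id \<or> (\<forall>x. h (h x) = h x)" by (auto simp: fun_eq_iff eval_nat_numeral)
      moreover have "h = id" if "\<forall>x. h (h x) = h x"
      proof
        fix x have "h (h (h (h x))) = h x" using that by simp
        thus "h x = id x" using hh by simp
      qed
      ultimately show False using h(3) by (auto simp: eval_nat_numeral)
    qed
    hence "{id, h ^^ 2} \<subset> ?C" by blast
    hence "card {id, h ^^ 2} < card ?C" by (intro psubset_card_mono) auto
    show False
    proof (rule no_rel[OF C2, of "[(2, ?C)]"])
      fix \<phi> assume "good K \<phi>"
      from \<Phi>_cyclic4[OF fr this h C] show "\<Phi> \<phi> (fixed_field {id, h ^^ 2}) 1 =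
        (\<Sum>(m, H)\<leftarrow>[(2, ?C)]. of_int m * \<Phi> \<phi> (fixed_field H) 1)" by simp
    qed (use C \<open>card {id, h ^^ 2} < card ?C\<close> in auto)
  qed
  \<comment> \<open>From here on the group has exponent 2 and is therefore commutative, so two
    distinct nontrivial elements would give a Klein four-group.\<close>
  have inv: "\<sigma> \<circ> \<sigma> = id" if "\<sigma> \<in> G" for \<sigma>
    using exists_special_subgroup[OF that] no_odd no_c4 by blast
  have inv': "\<sigma> (\<sigma> x) = x" if "\<sigma> \<in> G" for \<sigma> x using fun_cong[OF inv[OF that], of x] by simp
  have comm: "\<tau> (\<sigma> x) = \<sigma> (\<tau> x)" if "\<sigma> \<in> G" "\<tau> \<in> G" for \<sigma> \<tau> x
  proof -
    have "\<sigma> (\<tau> (\<sigma> (\<tau> x))) = x" using inv'[OF comp_G[OF that], of x] by simp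
    hence "\<tau> (\<sigma> (\<sigma> (\<tau> (\<sigma> (\<tau> x))))) = \<tau> (\<sigma> x)" by simp
    thus ?thesis using inv'[OF that(1)] inv'[OF that(2)] by simp
  qed
  have no_v4: False if \<sigma>: "\<sigma> \<in> G" "\<tau> \<in> G" and ne: "\<sigma> \<noteq> id" "\<tau> \<noteq> id" "\<sigma> \<noteq> \<tau>" for \<sigma> \<tau>
  proof -
    let ?V = "{id, \<sigma>, \<tau>, \<sigma> \<circ> \<tau>}"
    have c: "\<tau> \<circ> \<sigma> = \<sigma> \<circ> \<tau>" using comm[OF \<sigma>] by auto
    have V: "subgroup_of ?V G"
    proof (rule finite_subgroupI)
      show "?V \<subseteq> G" using \<sigma> id_G comp_G by blast
      fix g h assume "g \<in> ?V" "h \<in> ?V"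
      thus "g \<circ> h \<in> ?V" using inv'[OF \<sigma>(1)] inv'[OF \<sigma>(2)] comm[OF \<sigma>] by (auto simp: fun_eq_iff)
    qed simp
    have sub2: "subgroup_of {id, g} G" if "g \<in> G" for g
    proof (rule finite_subgroupI)
      show "{id, g} \<subseteq> G" using that id_G by blast
      fix h h' assume "h \<in> {id, g}" "h' \<in> {id, g}"
      thus "h \<circ> h' \<in> {id, g}" using inv[OF that] by auto
    qed simp
    have st: "\<sigma> \<circ> \<tau> \<noteq> id"
    proof
      assume "\<sigma> \<circ> \<tau> = id"
      hence "\<sigma> (\<sigma> (\<tau> x)) = \<sigma> x" for x by (metis comp_apply id_apply)
      thus False using ne(3) inv'[OF \<sigma>(1)] by auto
    qed
    show False
    proof (rule no_rel[OF subgroup_trivial, of "[(1, {id, \<sigma>}), (1, {id, \<tau>}), (1, {id, \<sigma> \<circ> \<tau>}), (- 2, ?V)]"])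
      fix \<phi> assume "good K \<phi>"
      from \<Phi>_klein[OF fr this \<sigma> ne inv[OF \<sigma>(1)] inv[OF \<sigma>(2)] c V] show "\<Phi> \<phi> (fixed_field {id}) 1 =
        (\<Sum>(m, H)\<leftarrow>[(1, {id, \<sigma>}), (1, {id, \<tau>}), (1, {id, \<sigma> \<circ> \<tau>}), (- 2, ?V)]. of_int m * \<Phi> \<phi> (fixed_field H) 1)" by simp
    next
      fix m H assume "(m, H) \<in> set [(1, {id, \<sigma>}), (1, {id, \<tau>}), (1, {id, \<sigma> \<circ> \<tau>}), (- 2, ?V)]"
      hence H: "H = {id, \<sigma>} \<or> H = {id, \<tau>} \<or> H = {id, \<sigma> \<circ> \<tau>} \<or> H = ?V" by auto
      have "card {id :: 'a \<Rightarrow> 'a} < card H"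
        by (rule psubset_card_mono) (use H ne st in auto)
      moreover have "subgroup_of H G" using H V sub2[OF \<sigma>(1)] sub2[OF \<sigma>(2)] sub2[OF comp_G[OF \<sigma>]] by auto
      ultimately show "subgroup_of H G \<and> card H \<noteq> card {id :: 'a \<Rightarrow> 'a}" by simp
    qed
  qed
  have "G \<noteq> {id}" using neq fixed_G fixed_id by metis
  then obtain \<sigma> where \<sigma>: "\<sigma> \<in> G" "\<sigma> \<noteq> id" using id_G by blast
  have G: "G = {id, \<sigma>}" using no_v4[OF \<sigma>(1) _ \<sigma>(2)] \<sigma>(1) id_G by blast
  note a = aut[OF subgroup_Gal \<sigma>(1)] aut_numeral[OF \<sigma>(1)]
  have "fixed_field {id, \<sigma>} = K" using fixed_G by (simp only: G)
  hence Kx: "x \<in> K \<longleftrightarrow> \<sigma> x = x" for x by (auto simp: fixed_field_def)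
  obtain x0 where x0: "\<sigma> x0 \<noteq> x0" using \<sigma>(2) by (auto simp: fun_eq_iff)
  define s where "s = x0 - \<sigma> x0"
  have s: "s \<noteq> 0" "\<sigma> s = - s" using x0 inv'[OF \<sigma>(1)] by (auto simp: s_def a)
  have sK: "s\<^sup>2 \<in> K" unfolding Kx by (rule square_fixed_of_negated[OF \<sigma>(1) s(2)])
  have decomp: "\<exists>p\<in>K. \<exists>q\<in>K. x = p + s * q" for x
  proof -
    have "x = (x + \<sigma> x) / 2 + s * ((x - \<sigma> x) / (2 * s))" by (rule half_sum[OF s(1)])
    moreover have "(x + \<sigma> x) / 2 \<in> K" "(x - \<sigma> x) / (2 * s) \<in> K"
      unfolding Kx by (rule half_fixed[OF \<sigma>(1) inv'[OF \<sigma>(1)] s(2)])+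
    ultimately show ?thesis by blast
  qed
  have "adjoin K s = UNIV"
  proof -
    have "x \<in> F" if F: "subfield F" "K \<subseteq> F" "s \<in> F" for x F
    proof -
      obtain p q where "p \<in> K" "q \<in> K" "x = p + s * q" using decomp[of x] by blast
      thus ?thesis using F by (auto intro!: subfield_add subfield_mult)
    qed
    thus ?thesis unfolding adjoin_def by blast
  qed
  moreover have "\<not> sum_of_squares_in K (s\<^sup>2)"
  proof
    assume "sum_of_squares_in K (s\<^sup>2)"
    then obtain xs where xs: "set xs \<subseteq> K" "s\<^sup>2 = sum_list (map (\<lambda>x. x\<^sup>2) xs)"
      using sum_of_squares_list[of "s\<^sup>2" K] s(1) by auto
    have iK: "intermediate K" using K by (simp add: intermediate_def)
    have one: "(1::'a) \<in> K - {0}" using K by (simp add: subfield_1)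
    have U: "module_sum K [1, s] = UNIV" unfolding module_sum_pair using decomp by blast
    show False
    proof (rule no_rel[OF subgroup_trivial, of "[(2, G)]"])
      fix \<phi> assume \<phi>: "good K \<phi>"
      have "\<Phi> \<phi> UNIV 1 = \<Phi> \<phi> K 1 + \<Phi> \<phi> K (s\<^sup>2)"
        using \<Phi>_quadratic[OF fr \<phi> iK s(1) sK \<sigma>(1) s(2)] U Kx by simp
      also have "\<Phi> \<phi> K (s\<^sup>2) = \<Phi> \<phi> K 1"
        using \<Phi>_sum_of_squares[OF fr \<phi> iK xs(1) xs(2) _ one] s(1) by simp
      finally show "\<Phi> \<phi> (fixed_field {id}) 1 = (\<Sum>(m, H)\<leftarrow>[(2, G)]. of_int m * \<Phi> \<phi> (fixed_field H) 1)"
        by (simp add: fixed_id fixed_G)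
    next
      fix m H assume "(m, H) \<in> set [(2 :: int, G)]"
      moreover have "card G = 2" unfolding G using \<sigma>(2) by simp
      ultimately show "subgroup_of H G \<and> card H \<noteq> card {id :: 'a \<Rightarrow> 'a}" using subgroup_Gal[of K] by auto
    qed
  qed
  ultimately show ?thesis using sK s(1) by (intro bexI[of _ "s\<^sup>2"]) auto
qed

end

section \<open>Quadratic extensions\<close>

lemma sum_fun_apply: "(\<Sum>i\<in>I. f i) x = (\<Sum>i\<in>I. f i x :: 'b::comm_monoid_add)"
  by (induction I rule: infinite_finite_induct) auto

text \<open>The stabilising summand in \<open>gw_eq\<close> is an arbitrary Gram matrix, whereas
  cancellation is proved for diagonal forms.\<close>

lemma form_over_diagonalizes:
  fixes K :: "'a::field set"
  assumes two: "(2::'a) \<noteq> 0" and K: "subfield K" and R: "form_over K R"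
  shows "\<exists>zs. diagonalizes K R zs"
proof -
  define n where "n = dim_row R"
  have Rc: "R \<in> carrier_mat n n" and RK: "\<And>i j. i < n \<Longrightarrow> j < n \<Longrightarrow> R $$ (i, j) \<in> K"
    and det: "det R \<noteq> 0"
    using R elements_mat_subset_iff[of R n n K] by (auto simp: form_over_def n_def)
  have Rs: "R $$ (j, i) = R $$ (i, j)" if "i < n" "j < n" for i j
    using R Rc that unfolding form_over_def by (metis carrier_matD index_transpose_mat(1))
  define sc where "sc k v = (\<lambda>i. k * v i)" for k :: 'a and v :: "nat \<Rightarrow> 'a"
  \<comment> \<open>Coordinate vectors are functions on all natural numbers, so that they form a
    type with addition; vanishing from \<open>n\<close> on makes the unit vectors generate.\<close>
  define V where "V = {v :: nat \<Rightarrow> 'a. (\<forall>i<n. v i \<in> K) \<and> (\<forall>i\<ge>n. v i = 0)}"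
  define B where "B v w = (\<Sum>i<n. \<Sum>l<n. v i * R $$ (i, l) * w l)" for v w :: "nat \<Rightarrow> 'a"
  define e where "e j = (\<lambda>i. if i = j then 1 else 0 :: 'a)" for j :: nat
  interpret bilinear_space sc K V B
  proof unfold_locales
    fix v w assume vw: "v \<in> V" "w \<in> V"
    show "B v w \<in> K" unfolding B_def using vw RK K
      by (intro subfield_sum subfield_mult) (auto simp: V_def)
    have "B v w = (\<Sum>l<n. \<Sum>i<n. v i * R $$ (i, l) * w l)" unfolding B_def by (rule sum.swap)
    also have "\<dots> = B w v" unfolding B_def
      by (intro sum.cong refl) (simp add: Rs mult_ac)
    finally show "B v w = B w v" .
  qed (use K in \<open>auto simp: V_def B_def sc_def fun_eq_iff algebra_simps sum_distrib_left sum.distrib subfield_closed\<close>)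
  have eV: "e j \<in> V" if "j < n" for j using that K by (auto simp: e_def V_def subfield_0 subfield_1)
  have gen: "\<exists>c. (\<forall>i<n. c i \<in> K) \<and> v = (\<Sum>i<n. sc (c i) (e i))" if v: "v \<in> V" for v
  proof (intro exI[of _ v] conjI)
    show "v = (\<Sum>i<n. sc (v i) (e i))"
    proof
      fix j
      have "(\<Sum>i<n. sc (v i) (e i)) j = (\<Sum>i<n. if i = j then v j else 0)"
        unfolding sum_fun_apply by (rule sum.cong) (auto simp: sc_def e_def)
      thus "v j = (\<Sum>i<n. sc (v i) (e i)) j" using v by (auto simp: V_def)
    qed
  qed (use v in \<open>auto simp: V_def\<close>)
  have Be: "B v (e j) = (\<Sum>i<n. v i * R $$ (i, j))" if "j < n" for v j
  proof -
    have "(\<Sum>l<n. v i * R $$ (i, l) * e j l) = (\<Sum>l<n. if l = j then v i * R $$ (i, j) else 0)" for i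
      by (rule sum.cong) (auto simp: e_def)
    thus ?thesis using that by (simp add: B_def)
  qed
  have "\<exists>bs. orth_basis sc V B bs"
  proof (rule orth_basis_exists[OF two, where N = n])
    fix bs assume "set bs \<subseteq> V" "\<forall>i<length bs. \<forall>j<length bs. i \<noteq> j \<longrightarrow> B (bs ! i) (bs ! j) = 0"
      "\<forall>b\<in>set bs. B b b \<noteq> 0"
    thus "length bs \<le> n" by (intro orth_length_le[OF eV gen]) auto
  next
    fix v assume v: "v \<in> V" "v \<noteq> 0"
    show "\<exists>w\<in>V. B v w \<noteq> 0"
    proof (rule ccontr)
      assume "\<not> ?thesis"
      hence z: "(\<Sum>i<n. v i * R $$ (i, j)) = 0" if "j < n" for j using Be[OF that, of v] eV[OF that] by auto
      have "R *\<^sub>v vec n v = 0\<^sub>v n"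
      proof (rule eq_vecI)
        fix j assume "j < dim_vec (0\<^sub>v n)"
        hence j: "j < n" by simp
        have "(R *\<^sub>v vec n v) $ j = (\<Sum>i<n. v i * R $$ (i, j))"
          using j Rc by (auto simp: scalar_prod_def lessThan_atLeast0 Rs mult.commute intro!: sum.cong)
        thus "(R *\<^sub>v vec n v) $ j = 0\<^sub>v n $ j" using z[OF j] j by simp
      qed (use Rc in auto)
      moreover have "vec n v \<noteq> 0\<^sub>v n"
      proof
        assume "vec n v = 0\<^sub>v n"
        hence "v i = 0" if "i < n" for i using that by (metis index_vec index_zero_vec(1))
        moreover have "v i = 0" if "i \<ge> n" for i using v(1) that by (simp add: V_def)
        ultimately have "v = 0" by (metis ext not_less zero_fun_apply)
        thus False using v(2) by simp
      qed
      ultimately show False using det det_0_iff_vec_prod_zero_field[OF Rc] vec_carrier by blast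
    qed
  qed
  then obtain bs where bs: "orth_basis sc V B bs" by blast
  have "length bs \<le> n"
    by (rule orth_length_le[OF eV gen]) (use orth_basis_set[OF bs] orth_basis_orth[OF bs] orth_basis_nonzero[OF bs] in auto)
  moreover have "n \<le> length bs"
  proof (rule inner_dim_ge)
    fix j k assume jk: "j < n" "k < n"
    let ?c = "\<lambda>i. B (e k) (bs ! i) / B (bs ! i) (bs ! i)"
    have "(\<Sum>i<length bs. (bs ! i) j * ?c i) = (\<Sum>i<length bs. sc (?c i) (bs ! i)) j"
      unfolding sum_fun_apply by (rule sum.cong) (auto simp: sc_def)
    also have "\<dots> = e k j" using orth_basis_expand[OF bs eV[OF jk(2)]] by simp
    finally show "(\<Sum>i<length bs. (bs ! i) j * ?c i) = (if j = k then 1 else 0)" by (simp add: e_def)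
  qed simp
  ultimately have len: "length bs = n" by simp
  have "isometric_over K R (diag (squares B bs))"
  proof (rule isometric_overI[OF Rc])
    show "diag (squares B bs) \<in> carrier_mat n n" using len diag_carrier[of "squares B bs"] by simp
    show "det (diag (squares B bs)) \<noteq> 0" using orth_basis_nonzero[OF bs] by (intro det_diag_nonzero) auto
    fix j k assume jk: "j < n" "k < n"
    have "(\<Sum>i<n. \<Sum>l<n. (bs ! j) i * R $$ (i, l) * (bs ! k) l) = B (bs ! j) (bs ! k)" by (simp add: B_def)
    thus "(\<Sum>i<n. \<Sum>l<n. (bs ! j) i * R $$ (i, l) * (bs ! k) l) = diag (squares B bs) $$ (j, k)"
      using orth_basis_orth[OF bs, of j k] jk len by auto
  qed (use orth_basis_nth[OF bs] len in \<open>auto simp: V_def\<close>)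
  moreover have "elements_mat R \<subseteq> K" using R by (simp add: form_over_def)
  ultimately have "diagonalizes K R (squares B bs)"
    by (intro diagonalizesI[OF Rc] orth_basis_squares[OF bs])
  thus ?thesis by blast
qed

lemma mset_weighted_two:
  assumes i: "i < n" "j < n" "i \<noteq> j" and only: "\<And>k. k < n \<Longrightarrow> k = i \<or> k = j"
  shows "mset (weighted a xs n) = repeat_mset (nat (a i)) (mset (xs i)) + repeat_mset (nat (a j)) (mset (xs j))"
proof -
  have "mset (weighted a xs n) = (\<Sum>k<n. repeat_mset (nat (a k)) (mset (xs k)))" for n
    by (induction n) (auto simp: weighted_def mset_copies)
  moreover have "{..<n} = {i, j}" using i only by auto
  ultimately show ?thesis using i(3) by simp
qed

section \<open>Comparing multiples of <2, 2 \<alpha>> and <1>\<close>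

lemma diag_isometric_cancel:
  fixes K :: "'a::field set"
  assumes two: "(2::'a) \<noteq> 0" and K: "subfield K" and iso: "diag_isometric K (zs @ xs) (zs @ ys)"
  shows "diag_isometric K xs ys"
proof -
  have s: "set xs \<subseteq> K - {0}" "set ys \<subseteq> K - {0}" "set zs \<subseteq> K - {0}"
    using iso by (auto simp: diag_isometric_def)
  have nz: "0 \<notin> set ys" "0 \<notin> set zs" using s by blast+
  have "isometric_over K (diag xs) (diag ys)"
    by (rule isometric_over_cancel[OF two K nz]) (use iso in \<open>simp add: diag_isometric_def\<close>)
  thus ?thesis using s by (simp add: diag_isometric_def)
qed

text \<open>A form with all entries 1 represents only sums of squares. Column 1 of the isometry
  belongs to the second entry of the target, so it writes 2 \<alpha> as a sum of squares.\<close>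

lemma isometric_copies_sum_of_squares:
  fixes K :: "'a::field set"
  assumes two: "(2::'a) \<noteq> 0" and K: "subfield K" and \<alpha>: "\<alpha> \<in> K" "\<alpha> \<noteq> 0"
    and iso: "diag_isometric K (replicate v 1) (copies d [2, 2 * \<alpha>] @ ys)" and d: "d > 0"
  shows "sum_of_squares_in K \<alpha>"
proof -
  obtain d' where d': "d = Suc d'" using d by (cases d) auto
  have c: "copies d [2, 2 * \<alpha>] @ ys = 2 # 2 * \<alpha> # copies d' [2, 2 * \<alpha>] @ ys" by (simp add: d' copies_def)
  let ?ys = "2 # 2 * \<alpha> # copies d' [2, 2 * \<alpha>] @ ys"
  have iso': "set ?ys \<subseteq> K - {0}" "isometric_over K (diag (replicate v 1)) (diag ?ys)"
    using iso unfolding diag_isometric_def c by auto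
  have nz: "0 \<notin> set ?ys" using iso'(1) by auto
  from iso'(2)[unfolded isometric_over_diag_iff[OF nz] length_replicate]
  obtain P where len: "v = length ?ys" and P: "\<And>i j. i < v \<Longrightarrow> j < v \<Longrightarrow> P i j \<in> K"
    "\<And>j k. j < v \<Longrightarrow> k < v \<Longrightarrow> (\<Sum>i<v. P i j * replicate v 1 ! i * P i k) = (if j = k then ?ys ! j else 0)"
    by blast
  have v: "1 < v" using len by simp
  have P11: "(\<Sum>i<v. (P i 1)\<^sup>2) = 2 * \<alpha>"
    using P(2)[OF v v] by (simp add: power2_eq_square)
  let ?ps = "map (\<lambda>i. P i 1 / 2) [0..<v]"
  have four: "(4::'a) \<noteq> 0"
  proof -
    have "(4::'a) = 2 * 2" by simp
    thus ?thesis using two by (metis mult_eq_0_iff)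
  qed
  have "sum_list (map (\<lambda>x. x\<^sup>2) ?ps) = (\<Sum>i<v. (P i 1)\<^sup>2 / 4)"
    by (simp add: sum_list_sum_nth atLeast0LessThan power_divide)
  also have "\<dots> = 2 * \<alpha> / 4" unfolding P11[symmetric] by (simp add: sum_divide_distrib)
  finally have h: "sum_list (map (\<lambda>x. x\<^sup>2) ?ps) = 2 * \<alpha> / 4" .
  \<comment> \<open>Halving the coordinates gives squares with sum \<alpha> / 2, and listing them
    twice gives \<alpha>.\<close>
  have "sum_list (map (\<lambda>x. x\<^sup>2) (?ps @ ?ps)) = 2 * \<alpha> / 4 + 2 * \<alpha> / 4"
    by (simp only: map_append sum_list_append h)
  also have "\<dots> = \<alpha>" using four by (simp add: add_divide_distrib[symmetric])
  finally have "sum_list (map (\<lambda>x. x\<^sup>2) (?ps @ ?ps)) = \<alpha>" .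
  moreover have "P i 1 / 2 \<in> K" if "i < v" for i using P(1)[OF that v] K by (auto intro!: subfield_closed)
  hence "set (?ps @ ?ps) \<subseteq> K" by auto
  ultimately show ?thesis using sum_of_squares_list[OF \<alpha>(2), of K] by blast
qed

text \<open>If \<open>u\<close> exceeded \<open>u'\<close>, cancelling \<open>zs\<close> and the
  common copies would leave \<open>u - u'\<close> copies of <2, 2 \<alpha>> inside a form with all
  entries 1. The statement is one-sided and is applied in both directions.\<close>

lemma copies_compare:
  fixes K :: "'a::field set"
  assumes two: "(2::'a) \<noteq> 0" and K: "subfield K" and \<alpha>: "\<alpha> \<in> K" "\<alpha> \<noteq> 0" "\<not> sum_of_squares_in K \<alpha>"
    and iso: "diag_isometric K (zs @ copies u' [2, 2 * \<alpha>] @ replicate v' 1) (zs @ copies u [2, 2 * \<alpha>] @ replicate v 1)"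
  shows "u \<le> u'"
proof (rule ccontr)
  assume "\<not> u \<le> u'"
  hence u: "u = u' + (u - u')" "u - u' > 0" by auto
  have app: "copies u [2, 2 * \<alpha>] = copies u' [2, 2 * \<alpha>] @ copies (u - u') [2, 2 * \<alpha>]"
    by (subst u(1)) (simp add: copies_def replicate_add)
  have "diag_isometric K ((zs @ copies u' [2, 2 * \<alpha>]) @ replicate v' 1)
     ((zs @ copies u' [2, 2 * \<alpha>]) @ (copies (u - u') [2, 2 * \<alpha>] @ replicate v 1))"
    using iso by (simp add: app)
  hence "diag_isometric K (replicate v' 1) (copies (u - u') [2, 2 * \<alpha>] @ replicate v 1)"
    by (rule diag_isometric_cancel[OF two K])
  from isometric_copies_sum_of_squares[OF two K \<alpha>(1,2) this u(2)] \<alpha>(3) show False by blast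
qed

context galois_extension
begin

text \<open>Only two classes of subgroups exist. The coefficient of the trivial subgroup is
  determined because \<alpha> is not a sum of squares, and the coefficient of the whole group then
  by the rank.\<close>

lemma quadratic_imp_injective:
  assumes reps: "subgroup_class_reps G reps" and neq: "K \<noteq> UNIV"
    and \<alpha>: "\<alpha> \<in> K" "\<alpha> \<noteq> 0" "\<not> sum_of_squares_in K \<alpha>" and s: "s\<^sup>2 = \<alpha>" "adjoin K s = UNIV"
  shows "dress_injective K reps"
proof -
  have no_sq: "\<alpha> \<noteq> x\<^sup>2" if "x \<in> K" for x
    using that \<alpha> sum_of_squares_list[OF \<alpha>(2), of K] by (auto intro: exI[of _ "[x]"])
  have s0: "s \<noteq> 0" using s \<alpha> by auto
  have ss: "s * s = \<alpha>" using s by (simp add: power2_eq_square)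
  define S where "S = {p + s * q |p q. p \<in> K \<and> q \<in> K}"
  have SI: "p + s * q \<in> S" if "p \<in> K" "q \<in> K" for p q using that by (auto simp: S_def)
  have "subfield S"
    unfolding subfield_def
  proof (intro conjI ballI)
    show "0 \<in> S" using SI[of 0 0] K by (simp add: subfield_0)
    show "1 \<in> S" using SI[of 1 0] K by (simp add: subfield_0 subfield_1)
    fix x assume "x \<in> S"
    then obtain p q where x: "x = p + s * q" "p \<in> K" "q \<in> K" by (auto simp: S_def)
    {
      fix y assume "y \<in> S"
      then obtain p' q' where y: "y = p' + s * q'" "p' \<in> K" "q' \<in> K" by (auto simp: S_def)
      have e1: "x + y = (p + p') + s * (q + q')" by (simp add: x y algebra_simps)
      show "x + y \<in> S" unfolding e1 using x y K by (intro SI subfield_add)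
      have "x * y = (p * p' + s * s * (q * q')) + s * (p * q' + q * p')" by (simp add: x y algebra_simps)
      hence e2: "x * y = (p * p' + \<alpha> * (q * q')) + s * (p * q' + q * p')" by (simp only: ss)
      show "x * y \<in> S" unfolding e2 using x y K \<alpha>(1) by (intro SI subfield_add subfield_mult)
    }
    have "- x = (- p) + s * (- q)" by (simp add: x)
    thus "- x \<in> S" using SI[of "- p" "- q"] x K by (simp add: subfield_minus)
    \<comment> \<open>The norm of x. It vanishes only for x = 0, since otherwise \<alpha> would be
      the square of p / q.\<close>
    define d where "d = p\<^sup>2 - \<alpha> * q\<^sup>2"
    have dK: "d \<in> K" using x K \<alpha>(1) by (simp add: d_def subfield_closed)
    have fac: "x * (p - s * q) = d" by (simp add: x d_def ss[symmetric] power2_eq_square algebra_simps)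
    show "inverse x \<in> S"
    proof (cases "d = 0")
      case False
      hence e: "inverse x = p / d + s * (- q / d)" using fac
        by (intro inverse_unique) (simp add: field_simps)
      show ?thesis unfolding e using x dK K by (intro SI subfield_divide subfield_minus)
    next
      case True
      have "q = 0"
      proof (rule ccontr)
        assume "q \<noteq> 0"
        hence "\<alpha> = (p / q)\<^sup>2" using True by (simp add: d_def power_divide field_simps)
        thus False using no_sq[of "p / q"] x K by (simp add: subfield_divide)
      qed
      hence "x = 0" using True by (simp add: d_def x)
      thus ?thesis using \<open>0 \<in> S\<close> by simp
    qed
  qed
  moreover have "K \<subseteq> S" using SI[of _ 0] K by (auto simp: subfield_0)
  moreover have "s \<in> S" using SI[of 0 1] K by (simp add: subfield_0 subfield_1)
  ultimately have "adjoin K s \<subseteq> S" unfolding adjoin_def by blast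
  hence decomp: "\<exists>p\<in>K. \<exists>q\<in>K. x = p + s * q" for x
  proof -
    have "x \<in> S" using \<open>adjoin K s \<subseteq> S\<close> s(2) by blast
    thus ?thesis unfolding S_def by blast
  qed
  have gs: "g s = s \<or> g s = - s" if "g \<in> G" for g
  proof -
    have "(g s)\<^sup>2 = s\<^sup>2" using Gal_fix[OF that \<alpha>(1)] by (simp add: s(1)[symmetric] aut[OF subgroup_Gal that])
    thus ?thesis by (simp add: power2_eq_iff)
  qed
  have g_eq: "g (p + s * q) = p + g s * q" if "g \<in> G" "p \<in> K" "q \<in> K" for g p q
    using Gal_fix[OF that(1)] that by (simp add: aut[OF subgroup_Gal that(1)])
  have ext: "g = h" if "g \<in> G" "h \<in> G" "g s = h s" for g h
  proof
    fix x obtain p q where x: "p \<in> K" "q \<in> K" "x = p + s * q" using decomp by blast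
    show "g x = h x" unfolding x(3) g_eq[OF that(1) x(1,2)] g_eq[OF that(2) x(1,2)] that(3) ..
  qed
  have "\<exists>\<sigma>\<in>G. \<sigma> s \<noteq> s"
  proof (rule ccontr)
    assume "\<not> ?thesis"
    hence "s \<in> fixed_field G" by (auto simp: fixed_field_def)
    hence "s \<in> K" by (simp add: fixed_G)
    thus False using no_sq[of s] s(1) by simp
  qed
  then obtain \<sigma> where \<sigma>: "\<sigma> \<in> G" "\<sigma> s = - s" using gs by blast
  have ms: "- s \<noteq> s"
  proof
    assume "- s = s"
    hence "2 * s = 0" by (metis add.right_inverse mult_2)
    thus False using two s0 by simp
  qed
  hence \<sigma>id: "\<sigma> \<noteq> id" using \<sigma>(2) by auto
  have G2: "G = {id, \<sigma>}"
  proof (intro equalityI subsetI)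
    fix g assume g: "g \<in> G"
    from gs[OF g] show "g \<in> {id, \<sigma>}"
    proof
      assume "g s = s"
      hence "g = id" by (intro ext[OF g id_G]) simp
      thus ?thesis by simp
    next
      assume "g s = - s"
      hence "g = \<sigma>" by (intro ext[OF g \<sigma>(1)]) (simp add: \<sigma>(2))
      thus ?thesis by simp
    qed
  qed (use id_G \<sigma>(1) in auto)
  have tr2: "tr G x = x + \<sigma> x" for x unfolding tr_def G2 using \<sigma>id by simp
  have bs: "orth_basis (*) UNIV (trf G 1) [1, s]"
    unfolding orth_basis_def
  proof (intro conjI allI impI ballI)
    fix i j assume "i < length [1, s]" "j < length [1, s]" "i \<noteq> j"
    hence "(i = 0 \<and> j = 1) \<or> (i = 1 \<and> j = 0)" by auto
    thus "trf G 1 ([1, s] ! i) ([1, s] ! j) = 0" using \<sigma> by (auto simp: trf_def tr2)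
  next
    fix b assume "b \<in> set [1, s]"
    moreover have "trf G 1 1 1 = 2" by (simp add: trf_def tr2 aut[OF subgroup_Gal \<sigma>(1)])
    moreover have "trf G 1 s s = 2 * \<alpha>" using \<sigma>(2) by (simp add: trf_def tr2 aut[OF subgroup_Gal \<sigma>(1)] ss Gal_fix[OF \<sigma>(1) \<alpha>(1)])
    ultimately show "trf G 1 b b \<noteq> 0" using two \<alpha>(2) by auto
  next
    fix x :: 'a
    obtain p q where x: "p \<in> K" "q \<in> K" "x = p + s * q" using decomp by blast
    have sx: "\<sigma> x = p - s * q" unfolding x(3) g_eq[OF \<sigma>(1) x(1,2)] \<sigma>(2) by simp
    have "trf G 1 x 1 = x + \<sigma> x" by (simp add: trf_def tr2)
    hence "trf G 1 x 1 = 2 * p" unfolding sx by (simp add: x(3))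
    moreover have "trf G 1 x s = x * s + \<sigma> x * \<sigma> s" by (simp add: trf_def tr2 aut[OF subgroup_Gal \<sigma>(1)])
    hence "trf G 1 x s = 2 * (s * s) * q" unfolding sx \<sigma>(2) by (simp add: x(3) algebra_simps)
    moreover have "trf G 1 1 1 = 2" by (simp add: trf_def tr2 aut[OF subgroup_Gal \<sigma>(1)])
    moreover have "trf G 1 s s = 2 * (s * s)" using \<sigma>(2) by (simp add: trf_def tr2 aut[OF subgroup_Gal \<sigma>(1)])
    ultimately show "x = (\<Sum>i<length [1, s]. trf G 1 x ([1, s] ! i) / trf G 1 ([1, s] ! i) ([1, s] ! i) * [1, s] ! i)"
      using two s0 by (simp add: x(3))
  qed simp
  have d1: "diagonalizes K (trace_form K UNIV) [2, 2 * \<alpha>]"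
  proof -
    have "squares (trf G (1 / of_nat (card (stab UNIV)))) [1, s] = [2, 2 * \<alpha>]"
      using \<sigma>(2) by (simp add: stab_UNIV trf_def tr2 aut[OF subgroup_Gal \<sigma>(1)] ss Gal_fix[OF \<sigma>(1) \<alpha>(1)])
    thus ?thesis using trace_form_isometric[OF _ _ bs] by (simp add: subfield_def)
  qed
  let ?n = "length reps"
  have sub: "subgroup_of (reps ! i) G" if "i < ?n" for i using reps that by (auto simp: subgroup_class_reps_def)
  have dich: "reps ! k = {id} \<or> reps ! k = G" if "k < ?n" for k
    using sub[OF that] unfolding G2 subgroup_of_def by blast
  have dist: "k = l" if "k < ?n" "l < ?n" "reps ! k = reps ! l" for k l
  proof -
    have "conjugate_in G (reps ! k) (reps ! l)"
      unfolding conjugate_in_def that(3) using id_G by (intro bexI[of _ id]) (auto simp: image_def)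
    thus ?thesis using reps that by (auto simp: subgroup_class_reps_def)
  qed
  obtain i where i: "i < ?n" "conjugate_in G (reps ! i) {id}"
    using reps subgroup_trivial[of K] by (auto simp: subgroup_class_reps_def)
  obtain j where j: "j < ?n" "conjugate_in G (reps ! j) G"
    using reps subgroup_Gal[of K] by (auto simp: subgroup_class_reps_def)
  have cG: "card G = 2" unfolding G2 using \<sigma>id by simp
  have ci: "card (reps ! i) = 1" using conjugate_card[OF sub[OF i(1)] i(2)] by simp
  have cj: "card (reps ! j) = 2" using conjugate_card[OF sub[OF j(1)] j(2)] cG by simp
  have "reps ! i \<noteq> G" using ci cG by (metis numeral_eq_one_iff num.distinct(1))
  hence ri: "reps ! i = {id}" using dich[OF i(1)] by blast
  have "card {id :: 'a \<Rightarrow> 'a} = 1" by simp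
  hence "reps ! j \<noteq> {id}" using cj by (metis numeral_eq_one_iff num.distinct(1))
  hence rj: "reps ! j = G" using dich[OF j(1)] by blast
  have ij: "i \<noteq> j" using ci cj by (metis numeral_eq_one_iff num.distinct(1))
  have only: "k = i \<or> k = j" if "k < ?n" for k using dich[OF that] dist[OF that] ri rj i(1) j(1) by metis
  define xs where "xs k = (if k = i then [2, 2 * \<alpha>] else [1])" for k
  have dx: "diagonalizes K (trace_form K (fixed_field (reps ! k))) (xs k)" if "k < ?n" for k
    using only[OF that] d1 trace_form_base ri rj fixed_G ij by (auto simp: xs_def fixed_id)
  show ?thesis unfolding dress_injective_def
  proof (intro allI impI)
    fix a b k assume eq: "gw_eq K (dress K reps a) (dress K reps b)" and k: "k < ?n"
    obtain R where R: "form_over K R" and iso: "isometric_over K (osum (osum (fst (dress K reps a)) (snd (dress K reps b))) R)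
        (osum (osum (fst (dress K reps b)) (snd (dress K reps a))) R)"
      using eq by (auto simp: gw_eq_def)
    obtain zs where zs: "diagonalizes K R zs" using form_over_diagonalizes[OF two K R] by blast
    define pos where "pos a = weighted a xs ?n" for a
    define neg where "neg a = weighted (\<lambda>i. - a i) xs ?n" for a
    have dpos: "diagonalizes K (fst (dress K reps a)) (pos a)" for a
      unfolding dress_def fst_conv pos_def by (rule diagonalizes_weighted[OF K dx])
    have dneg: "diagonalizes K (snd (dress K reps a)) (neg a)" for a
      unfolding dress_def snd_conv neg_def by (rule diagonalizes_weighted[OF K dx])
    have dX: "diagonalizes K (osum (osum (fst (dress K reps a)) (snd (dress K reps b))) R) ((pos a @ neg b) @ zs)" for a b
      by (intro diagonalizes_osum[OF K] dpos dneg zs)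
    have iso1: "isometric_over K (diag ((pos a @ neg b) @ zs)) (diag ((pos b @ neg a) @ zs))"
      using iso diagonalizes_isometric_iff[OF K dX dX] by blast
    define u where "u a b = nat (a i) + nat (- b i)" for a b :: "nat \<Rightarrow> int"
    define v where "v a b = nat (a j) + nat (- b j)" for a b :: "nat \<Rightarrow> int"
    \<comment> \<open>Sorted so that \<open>zs\<close> is the prefix to be cancelled, followed by
      all copies of <2, 2 \<alpha>> and then all entries 1.\<close>
    define L where "L a b = zs @ copies (u a b) [2, 2 * \<alpha>] @ replicate (v a b) 1" for a b
    have mL: "mset ((pos a @ neg b) @ zs) = mset (L a b)" for a b
    proof -
      have "repeat_mset m {#1 :: 'a#} = replicate_mset m 1" for m by (rule multiset_eqI) simp
      moreover have "replicate_mset (m + n) x = replicate_mset m x + replicate_mset n x" for m n and x :: 'a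
        by (rule multiset_eqI) simp
      ultimately show ?thesis
        using mset_weighted_two[OF i(1) j(1) ij only, of a xs] mset_weighted_two[OF i(1) j(1) ij only, of "\<lambda>i. - b i" xs] ij
        by (simp add: pos_def neg_def L_def u_def v_def xs_def mset_copies)
    qed
    have XK: "set ((pos a @ neg b) @ zs) \<subseteq> K - {0}" for a b using dX[of a b] by (simp add: diagonalizes_def)
    have LK: "set (L a b) \<subseteq> K - {0}" for a b using XK[of a b] mset_eq_setD[OF mL[of a b]] by blast
    have perm: "isometric_over K (diag (L a b)) (diag ((pos a @ neg b) @ zs))"
      "isometric_over K (diag ((pos a @ neg b) @ zs)) (diag (L a b))" for a b
      using XK[of a b] LK[of a b] mL[of a b] by (auto intro!: isometric_over_diag_perm[OF K])
    note t = isometric_over_trans[OF K diag_carrier]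
    have iso2: "diag_isometric K (L a b) (L b a)"
      unfolding diag_isometric_def using t[OF perm(1) t[OF iso1 perm(2)]] LK by blast
    note cmp = copies_compare[OF two K \<alpha>]
    have "u b a \<le> u a b" using iso2 unfolding L_def by (rule cmp)
    moreover have "u a b \<le> u b a" using diag_isometric_sym[OF K iso2] unfolding L_def by (rule cmp)
    ultimately have ueq: "u a b = u b a" by simp
    have "length (L a b) = length (L b a)"
      using iso2 isometric_over_dim[OF _ diag_carrier] unfolding diag_isometric_def by (metis carrier_matD(1) diag_dims(1))
    hence "v a b = v b a" by (simp add: L_def ueq)
    \<comment> \<open>\<open>nat (a i) + nat (- b i) = nat (b i) + nat (- a i)\<close> is the
      equation \<open>a i = b i\<close> with all terms made nonnegative.\<close>
    hence "a i = b i" "a j = b j" using ueq by (auto simp: u_def v_def split: if_splits)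
    thus "a k = b k" using only[OF k] by auto
  qed
qed

end

theorem theorem1p1:
  fixes K :: "'a::field set" and reps :: "('a \<Rightarrow> 'a) set list"
  assumes "(2::'a) \<noteq> 0"
    and "finite_galois K"
    and "K \<noteq> UNIV"
    and "subgroup_class_reps (Gal K) reps"
  shows "dress_injective K reps \<longleftrightarrow>
    (\<exists>\<alpha>\<in>K. \<alpha> \<noteq> 0 \<and> \<not> sum_of_squares_in K \<alpha> \<and>
        (\<exists>s. s\<^sup>2 = \<alpha> \<and> adjoin K s = UNIV))"
proof -
  interpret galois_extension K by unfold_locales fact+
  show ?thesis
    using injective_imp_quadratic[OF assms(4) _ assms(3)] quadratic_imp_injective[OF assms(4,3)] by blast
qed

end
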